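(* Let $h\in\mathcal H$, let $X_0\in(0,r)$, let $c\in\mathbb R$, and let $Y$ be the process on $(0,r)$ with $Y_0=X_0$ and $$dY_t=dW_t+\left\{\frac{h'(Y_t)}{h(Y_t)}+c\right\}dt,\qquad t<\zeta(Y),$$ where $W$ is a $Q^{h,X_0}$-Brownian motion and $\zeta(Y)$ denotes the first hitting time of $0$ or $r$ by $Y$. Assume that $c\le 0$ if $r=\infty$, and that $c=0$ if $h(x)=x$ for all $x$. Then: (1) $Q^{h,X_0}(\zeta(Y)=\infty)=1$. (2) For any stopping time $S$ that is bounded $Q^{h,X_0}$-a.s. there exists a constant $K$ that does not depend on $X_0$ such that $$E^{h,X_0}\left[\frac1{h(Y_S)}\right]<\frac{K}{h(X_0)}.$$ (3) For any $t>0$ and $p\in[0,1)$, $$E^{h,X_0}\left[\int_0^t\frac{1}{h^{2+p}(Y_s)}ds\right]<\infty.$$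
   Context: Standing setting. Let $r\in(0,\infty]$. Under $P^x$, $X$ is a regular one-dimensional diffusion on $(0,r)$ with $X_0=x$ and $X_t=X_0+\int_0^t\sigma(X_s)dB_s$ for $t<\zeta$, $B$ a Brownian motion, killed at $\zeta=\inf\{t>0:X_t\notin(0,r)\}$. Standing assumptions: $\sigma:(0,r)\to(0,\infty)$ is continuously differentiable with bounded derivative; $\sigma(0+)$ exists and is finite, and so does $\sigma(r-)$ if $r<\infty$; $P^x(\zeta<\infty)>0$ for all $x\in(0,r)$; the boundary $0$ is accessible (reached in finite time with positive probability). Speed measure: $m(dx)=2\sigma^{-2}(x)dx$. Potential density: $u(x,y)=(x\wedge y)(1-\frac{x\vee y}{r})$ if $r<\infty$, $u(x,y)=x\wedge y$ if $r=\infty$. $\mathcal H_0$ is the set of functions $h(x)=\int_{(0,r)}u(x,y)f(y)m(dy)$, where $f:(0,r)\to(0,\infty)$ is continuous with $\int_{(0,r)}f\,dm<\infty$ and $\int_{(0,r)}yf(y)m(dy)<\infty$; such $h$ is concave, $C^2$, and $\frac12\sigma^2h''=-f$. If $r<\infty$, $\mathcal H:=\mathcal H_0$; if $r=\infty$, $\mathcal H:=\mathcal H_0\cup\{x\mapsto x\}$. For $h\in\mathcal H$ and $x\in(0,r)$, $Q^{h,x}$ (with expectation $E^{h,x}$) is the probability measure under which $X_0=x$, $X$ stays in $(0,r)$ for all times, and $dX_t=\sigma(X_t)dW_t+\sigma^2(X_t)\frac{h'(X_t)}{h(X_t)}dt$, with $W$ a $Q^{h,x}$-Brownian motion with respect to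 the filtration $(\mathcal F_t)$. *)

theory Defs
  imports "HOL-Probability.Probability"
begin

text \<open>
  Time is \<^typ>\<open>real\<close>, used on \<open>{0..}\<close> only. Filtrations are indexed by \<^typ>\<open>ennreal\<close>, i.e. by
  \<open>[0,\<infinity>]\<close>, so that the library's \<^const>\<open>stopping_time\<close> is the usual notion of a
  \<open>[0,\<infinity>]\<close>-valued stopping time. Diffusions on \<open>(0,r)\<close>, \<open>0 < r \<le> \<infinity>\<close>, are represented by
  processes with values in the compactification \<open>[0,r] \<subseteq>\<close> \<^typ>\<open>ereal\<close>; in this way an exit through
  \<open>r = \<infinity>\<close> needs no special treatment.
\<close>

definition filtered_prob_space :: "'a measure \<Rightarrow> (ennreal \<Rightarrow> 'a measure) \<Rightarrow> bool" where
  "filtered_prob_space M F \<longleftrightarrow>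
     prob_space M \<and> filtration (space M) F \<and> (\<forall>t. subalgebra M (F t))"

definition adapted :: "(ennreal \<Rightarrow> 'a measure) \<Rightarrow> (real \<Rightarrow> 'a \<Rightarrow> 'b::topological_space) \<Rightarrow> bool" where
  "adapted F Z \<longleftrightarrow> (\<forall>t\<ge>0. Z t \<in> borel_measurable (F (ennreal t)))"

definition progressive :: "(ennreal \<Rightarrow> 'a measure) \<Rightarrow> (real \<Rightarrow> 'a \<Rightarrow> real) \<Rightarrow> bool" where
  "progressive F H \<longleftrightarrow>
     (\<forall>t\<ge>0. (\<lambda>(s, \<omega>). H s \<omega>) \<in> borel_measurable (restrict_space borel {0..t} \<Otimes>\<^sub>M F (ennreal t)))"

definition brownian_motion ::
    "'a measure \<Rightarrow> (ennreal \<Rightarrow> 'a measure) \<Rightarrow> (real \<Rightarrow> 'a \<Rightarrow> real) \<Rightarrow> bool" where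
  "brownian_motion M F W \<longleftrightarrow>
     adapted F W \<and>
     (AE \<omega> in M. W 0 \<omega> = 0 \<and> continuous_on {0..} (\<lambda>t. W t \<omega>)) \<and>
     (\<forall>s t. 0 \<le> s \<longrightarrow> s < t \<longrightarrow>
        distributed M lborel (\<lambda>\<omega>. W t \<omega> - W s \<omega>) (normal_density 0 (sqrt (t - s))) \<and>
        prob_space.indep_set M (sets (F (ennreal s)))
          {(\<lambda>\<omega>. W t \<omega> - W s \<omega>) -` A \<inter> space M | A. A \<in> sets borel})"


subsection \<open>The Ito integral\<close>

definition null_in_prob :: "'a measure \<Rightarrow> (nat \<Rightarrow> 'a \<Rightarrow> ennreal) \<Rightarrow> bool" where
  "null_in_prob M U \<longleftrightarrow>
     (\<forall>\<epsilon>>0. (\<lambda>k. emeasure M {\<omega> \<in> space M. \<epsilon> < U k \<omega>}) \<longlonglongrightarrow> 0)"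

text \<open>A simple process is given by a partition \<open>t 0 \<le> \<dots> \<le> t n\<close> and bounded weights \<open>\<xi> i\<close> that are
  measurable at time \<open>t i\<close>.\<close>

definition simple_data ::
    "'a measure \<Rightarrow> (ennreal \<Rightarrow> 'a measure) \<Rightarrow> nat \<Rightarrow> (nat \<Rightarrow> real) \<Rightarrow> (nat \<Rightarrow> 'a \<Rightarrow> real) \<Rightarrow> bool" where
  "simple_data M F n t \<xi> \<longleftrightarrow>
     0 \<le> t 0 \<and> mono_on {..n} t \<and>
     (\<forall>i<n. \<xi> i \<in> borel_measurable (F (ennreal (t i))) \<and> bounded (\<xi> i ` space M))"

definition simple_process ::
    "nat \<Rightarrow> (nat \<Rightarrow> real) \<Rightarrow> (nat \<Rightarrow> 'a \<Rightarrow> real) \<Rightarrow> real \<Rightarrow> 'a \<Rightarrow> real" where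
  "simple_process n t \<xi> s \<omega> = (\<Sum>i<n. \<xi> i \<omega> * indicator {t i<..t (Suc i)} s)"

definition simple_integral_upto ::
    "(real \<Rightarrow> 'a \<Rightarrow> real) \<Rightarrow> nat \<Rightarrow> (nat \<Rightarrow> real) \<Rightarrow> (nat \<Rightarrow> 'a \<Rightarrow> real) \<Rightarrow> real \<Rightarrow> 'a \<Rightarrow> real" where
  "simple_integral_upto W n t \<xi> T \<omega> =
     (\<Sum>i<n. \<xi> i \<omega> * (W (min T (t (Suc i))) \<omega> - W (min T (t i)) \<omega>))"

text \<open>\<open>I\<^sub>T = \<integral>\<^sub>0\<^sup>T H dW\<close> for all \<open>T \<ge> 0\<close>: for each \<open>T\<close> there are simple processes \<open>G\<^sup>k\<close> with
  \<open>\<integral>\<^sub>0\<^sup>T (G\<^sup>k - H)\<^sup>2 ds \<rightarrow> 0\<close> in probability whose elementary integrals up to \<open>T\<close> converge to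
  \<open>I\<^sub>T\<close> in probability.\<close>

definition has_ito_integral ::
    "'a measure \<Rightarrow> (ennreal \<Rightarrow> 'a measure) \<Rightarrow> (real \<Rightarrow> 'a \<Rightarrow> real) \<Rightarrow> (real \<Rightarrow> 'a \<Rightarrow> real) \<Rightarrow>
     (real \<Rightarrow> 'a \<Rightarrow> real) \<Rightarrow> bool" where
  "has_ito_integral M F W H I \<longleftrightarrow>
     progressive F H \<and> adapted F I \<and> (AE \<omega> in M. continuous_on {0..} (\<lambda>t. I t \<omega>)) \<and>
     (\<forall>T\<ge>0. \<exists>n t \<xi>.
        (\<forall>k. simple_data M F (n k) (t k) (\<xi> k)) \<and>
        null_in_prob M (\<lambda>k \<omega>. \<integral>\<^sup>+ s\<in>{0..T}.
           ennreal ((simple_process (n k) (t k) (\<xi> k) s \<omega> - H s \<omega>)\<^sup>2) \<partial>lborel) \<and>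
        null_in_prob M (\<lambda>k \<omega>.
           ennreal \<bar>simple_integral_upto W (n k) (t k) (\<xi> k) T \<omega> - I T \<omega>\<bar>))"


subsection \<open>Diffusions on \<open>(0,r)\<close>\<close>

definition state_space :: "ereal \<Rightarrow> real set" where
  "state_space r = {x. 0 < x \<and> ereal x < r}"

text \<open>For a continuous process started inside the open set \<open>A\<close> it makes no difference whether the
  infimum is taken over \<open>0 \<le> t\<close> or over \<open>0 < t\<close>. The value is \<open>\<infinity>\<close> if there is no exit.\<close>

definition exit_time :: "ereal set \<Rightarrow> (real \<Rightarrow> 'a \<Rightarrow> ereal) \<Rightarrow> 'a \<Rightarrow> ereal" where
  "exit_time A Z \<omega> = (INF t\<in>{t. 0 \<le> t \<and> Z t \<omega> \<notin> A}. ereal t)"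

definition lifetime :: "ereal \<Rightarrow> (real \<Rightarrow> 'a \<Rightarrow> ereal) \<Rightarrow> 'a \<Rightarrow> ereal" where
  "lifetime r Z = exit_time {0<..<r} Z"

text \<open>The equation \<open>Z\<^sub>t = x + \<integral>\<^sub>0\<^sup>t \<sigma>(Z\<^sub>s) dW\<^sub>s + \<integral>\<^sub>0\<^sup>t \<mu>(Z\<^sub>s) ds\<close> for \<open>t\<close> below the lifetime of \<open>Z\<close>: it is
  required to hold up to the exit from each interval \<open>(a,b)\<close> with \<open>[a,b] \<subseteq> (0,r)\<close>, where both
  integrands are bounded.\<close>

definition solves_sde ::
    "'a measure \<Rightarrow> (ennreal \<Rightarrow> 'a measure) \<Rightarrow> (real \<Rightarrow> 'a \<Rightarrow> real) \<Rightarrow> ereal \<Rightarrow>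
     (real \<Rightarrow> real) \<Rightarrow> (real \<Rightarrow> real) \<Rightarrow> real \<Rightarrow> (real \<Rightarrow> 'a \<Rightarrow> ereal) \<Rightarrow> bool" where
  "solves_sde M F W r \<sigma> \<mu> x Z \<longleftrightarrow>
     adapted F Z \<and> (AE \<omega> in M. Z 0 \<omega> = ereal x) \<and>
     (\<forall>a b. 0 < a \<longrightarrow> ereal b < r \<longrightarrow>
       (let \<tau> = exit_time {ereal a<..<ereal b} Z in
        \<exists>I. has_ito_integral M F W
               (\<lambda>s \<omega>. if ereal s < \<tau> \<omega> then \<sigma> (real_of_ereal (Z s \<omega>)) else 0) I \<and>
            (AE \<omega> in M. \<forall>t\<ge>0.
               let u = real_of_ereal (min (ereal t) (\<tau> \<omega>)) in
               real_of_ereal (Z u \<omega>) =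
                 x + I t \<omega> + (LBINT s:{0..u}. \<mu> (real_of_ereal (Z s \<omega>))))))"

text \<open>Killing is represented by absorption in the boundary point through which the path leaves.\<close>

definition killed_paths :: "ereal \<Rightarrow> 'a set \<Rightarrow> (real \<Rightarrow> 'a \<Rightarrow> ereal) \<Rightarrow> bool" where
  "killed_paths r \<Omega> X \<longleftrightarrow>
     (\<forall>\<omega>\<in>\<Omega>. continuous_on {0..} (\<lambda>t. X t \<omega>) \<and> (\<forall>t\<ge>0. X t \<omega> \<in> {0..r}) \<and>
        (\<forall>s t. 0 \<le> s \<longrightarrow> s \<le> t \<longrightarrow> X s \<omega> \<notin> {0<..<r} \<longrightarrow> X t \<omega> = X s \<omega>))"

definition standing_coefficient :: "ereal \<Rightarrow> (real \<Rightarrow> real) \<Rightarrow> bool" where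
  "standing_coefficient r \<sigma> \<longleftrightarrow>
     (\<forall>x\<in>state_space r. 0 < \<sigma> x) \<and>
     \<sigma> C1_differentiable_on state_space r \<and> bounded (deriv \<sigma> ` state_space r) \<and>
     (\<exists>l. (\<sigma> \<longlongrightarrow> l) (at_right 0)) \<and>
     (r < \<infinity> \<longrightarrow> (\<exists>l. (\<sigma> \<longlongrightarrow> l) (at_left (real_of_ereal r))))"

text \<open>The laws \<open>P\<^sup>x\<close> of the diffusion in natural scale. The filtration may depend on \<open>x\<close>, so that
  augmentation by the \<open>P\<^sup>x\<close>-null sets is covered.\<close>

definition standing_diffusion ::
    "ereal \<Rightarrow> (real \<Rightarrow> real) \<Rightarrow> 'a set \<Rightarrow> (real \<Rightarrow> 'a \<Rightarrow> ereal) \<Rightarrow>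
     (real \<Rightarrow> 'a measure) \<Rightarrow> (real \<Rightarrow> ennreal \<Rightarrow> 'a measure) \<Rightarrow> bool" where
  "standing_diffusion r \<sigma> \<Omega> X P F \<longleftrightarrow>
     killed_paths r \<Omega> X \<and>
     (\<forall>x\<in>state_space r.
        space (P x) = \<Omega> \<and> filtered_prob_space (P x) (F x) \<and>
        (\<exists>B. brownian_motion (P x) (F x) B \<and> solves_sde (P x) (F x) B r \<sigma> (\<lambda>_. 0) x X) \<and>
        \<comment> \<open>regularity\<close>
        (\<forall>y\<in>state_space r. 0 < measure (P x) {\<omega>\<in>\<Omega>. \<exists>t\<ge>0. X t \<omega> = ereal y}) \<and>
        0 < measure (P x) {\<omega>\<in>\<Omega>. lifetime r X \<omega> < \<infinity>} \<and>
        \<comment> \<open>accessibility of \<open>0\<close>\<close>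
        0 < measure (P x) {\<omega>\<in>\<Omega>. \<exists>t\<ge>0. X t \<omega> = 0})"


subsection \<open>The functions \<open>h\<close> and the laws \<open>Q\<^sup>h\<^sup>,\<^sup>x\<close>\<close>

definition speed_measure :: "ereal \<Rightarrow> (real \<Rightarrow> real) \<Rightarrow> real measure" where
  "speed_measure r \<sigma> =
     density lborel (\<lambda>x. indicator (state_space r) x * ennreal (2 / (\<sigma> x)\<^sup>2))"

definition potential_density :: "ereal \<Rightarrow> real \<Rightarrow> real \<Rightarrow> real" where
  "potential_density r x y =
     (if r = \<infinity> then min x y else min x y * (1 - max x y / real_of_ereal r))"

text \<open>Membership in \<open>\<H>\<^sub>0\<close> and \<open>\<H>\<close> only concerns the values on \<open>(0,r)\<close>.\<close>

definition H0 :: "ereal \<Rightarrow> (real \<Rightarrow> real) \<Rightarrow> (real \<Rightarrow> real) set" where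
  "H0 r \<sigma> = {h. \<exists>f.
     (\<forall>y\<in>state_space r. 0 < f y) \<and> continuous_on (state_space r) f \<and>
     set_integrable (speed_measure r \<sigma>) (state_space r) f \<and>
     set_integrable (speed_measure r \<sigma>) (state_space r) (\<lambda>y. y * f y) \<and>
     (\<forall>x\<in>state_space r.
        h x = (LINT y:state_space r|speed_measure r \<sigma>. (potential_density r x y * f y)))}"

definition transform_functions :: "ereal \<Rightarrow> (real \<Rightarrow> real) \<Rightarrow> (real \<Rightarrow> real) set" where
  "transform_functions r \<sigma> =
     H0 r \<sigma> \<union> (if r = \<infinity> then {h. \<forall>x\<in>state_space r. h x = x} else {})"

definition transform_law ::
    "ereal \<Rightarrow> (real \<Rightarrow> real) \<Rightarrow> (real \<Rightarrow> real) \<Rightarrow> real \<Rightarrow> (real \<Rightarrow> 'a \<Rightarrow> ereal) \<Rightarrow>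
     'a measure \<Rightarrow> (ennreal \<Rightarrow> 'a measure) \<Rightarrow> bool" where
  "transform_law r \<sigma> h x X Q F \<longleftrightarrow>
     filtered_prob_space Q F \<and>
     (AE \<omega> in Q. \<forall>t\<ge>0. X t \<omega> \<in> {0<..<r}) \<and>
     (\<exists>W. brownian_motion Q F W \<and>
          solves_sde Q F W r \<sigma> (\<lambda>y. (\<sigma> y)\<^sup>2 * (deriv h y / h y)) x X)"


subsection \<open>The process \<open>Y\<close>\<close>

text \<open>The noise is additive, so no stochastic integral is needed. Nothing is said about \<open>Y\<close> after its
  lifetime, except that it is continuous with values in \<open>[0,r]\<close>.\<close>

definition drifted_process ::
    "'a measure \<Rightarrow> (ennreal \<Rightarrow> 'a measure) \<Rightarrow> ereal \<Rightarrow> (real \<Rightarrow> real) \<Rightarrow> real \<Rightarrow> real \<Rightarrow>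
     (real \<Rightarrow> 'a \<Rightarrow> real) \<Rightarrow> (real \<Rightarrow> 'a \<Rightarrow> ereal) \<Rightarrow> bool" where
  "drifted_process Q F r h c x W Y \<longleftrightarrow>
     adapted F Y \<and>
     (AE \<omega> in Q. continuous_on {0..} (\<lambda>t. Y t \<omega>) \<and> (\<forall>t\<ge>0. Y t \<omega> \<in> {0..r}) \<and>
        Y 0 \<omega> = ereal x \<and>
        (\<forall>t\<ge>0. ereal t < lifetime r Y \<omega> \<longrightarrow>
           real_of_ereal (Y t \<omega>) =
             x + W t \<omega> +
             (LBINT s:{0..t}.
                (deriv h (real_of_ereal (Y s \<omega>)) / h (real_of_ereal (Y s \<omega>)) + c))))"

end

theory Submission
  imports Defs
begin

text \<open>
  Let \<open>L \<phi> = \<phi>'' / 2 + (h' / h + c) \<phi>'\<close> be the generator of \<open>Y\<close>. If \<open>\<phi> \<ge> 0\<close> and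
  \<open>L \<phi> \<le> K \<phi> - \<theta>\<close> with \<open>\<theta> \<ge> 0\<close>, then Dynkin's formula and Gronwall's lemma bound
  \<open>E (\<phi> (Y\<^sub>u)) + E (\<integral>\<^sub>0\<^sup>u \<theta> (Y\<^sub>s) ds)\<close> by \<open>exp (2 K T) \<phi> (X\<^sub>0)\<close> for all stopping times \<open>u \<le> T\<close> before
  the exit from a compact subinterval of \<open>(0,r)\<close>, uniformly in the subinterval. The function \<open>1 / h\<close> is
  not suitable as \<open>\<phi>\<close>, because \<open>L (1 / h)\<close> contains \<open>- h'' / (2 h\<^sup>2)\<close> and \<open>h''\<close> may be unbounded at the
  boundary. Instead let \<open>V = sqrt (1 + s\<^sup>2)\<close> with \<open>s' = exp (- 2 c y - y\<^sup>2) / h\<^sup>2\<close>, a modified scale function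
  (and \<open>V = 1 / h\<close> if \<open>h(x) = x\<close>). Then \<open>V\<close> is comparable to \<open>1 / h\<close> and \<open>L V \<le> k V\<close>. Claim (2) follows
  with \<open>\<phi> = V\<close>, claim (1) with \<open>\<phi> = V\<close> or \<open>\<phi> = V + x\<^sup>2 + 1\<close>, which tend to infinity at both
  boundaries, and claim (3) with a power \<open>V\<^sup>q\<close>, \<open>p \<le> q < 1\<close>: since \<open>q < 1\<close>, the second order term of
  \<open>L (V\<^sup>q)\<close> is negative and of order \<open>h powr (- 2 - q)\<close>.
\<close>


subsection \<open>Taylor expansion and Gaussian increments\<close>

text \<open>The obstacle is that \<open>h'' = - 2 f / \<sigma>\<^sup>2\<close> has no bound near the
  boundary, whereas \<open>h'\<close> is bounded and \<open>h\<close> is comparable to the distance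
  from 0 and from a finite \<open>r\<close>. A scale function removes just this term:
  \<open>s'' / 2 + (h' / h + c) s' = 0\<close> expresses \<open>s''\<close> through first
  derivatives. For \<open>V = sqrt (1 + s^2)\<close> this leaves
  \<open>L V = s'^2 / (2 V^3)\<close>, and as \<open>s'\<close> is of order \<open>h^-2\<close>,
  hence at most of order \<open>V^2\<close>, the result is at most a multiple of \<open>V\<close>.
  That \<open>s\<close> grows like \<open>1 / h\<close> comes from integrating the inverse square of
  a distance; the square root only smooths \<bar>s\<bar> at its zero. At
  \<open>r = \<infinity>\<close> the weight \<open>exp (- 2 c y) / h^2\<close> with c \<le> 0 is not
  integrable, so a Gaussian factor is inserted; its price is the extra term
  \<open>- y s' s / V\<close>, which has the good sign wherever \<open>s\<close> is nonnegative.
  Expectations are controlled by an inequality only, which is why Fatou's lemma suffices both in the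
  discretisation of Dynkin's formula and in the removal of the localisation.\<close>

lemma taylor2_lipschitz:
  fixes \<phi> \<phi>' \<phi>'' :: "real \<Rightarrow> real"
  assumes d1: "\<And>z. (\<phi> has_real_derivative \<phi>' z) (at z)"
    and d2: "\<And>z. (\<phi>' has_real_derivative \<phi>'' z) (at z)"
    and lip: "L-lipschitz_on UNIV \<phi>''"
  shows "\<bar>\<phi> (z + d) - \<phi> z - \<phi>' z * d - \<phi>'' z / 2 * d\<^sup>2\<bar> \<le> L * \<bar>d\<bar>^3"
proof -
  define S where "S = {- \<bar>d\<bar>..\<bar>d\<bar>}"
  have L: "0 \<le> L" using lip by (rule lipschitz_on_nonneg)
  \<comment> \<open>The mean value bound is applied twice, to \<open>\<phi>'\<close> and then to
    \<open>\<phi>\<close>. This yields the constant \<open>L\<close> in place of the sharp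
    \<open>L / 6\<close>; only the cubic order matters later.\<close>
  have *: "\<bar>\<phi>' (z + u) - \<phi>' z - \<phi>'' z * u\<bar> \<le> L * \<bar>d\<bar>^2" if u: "u \<in> S" for u
  proof -
    have "norm ((\<phi>' (z + u) - \<phi>'' z * u) - (\<phi>' (z + 0) - \<phi>'' z * 0)) \<le> (L * \<bar>d\<bar>) * norm (u - 0)"
    proof (rule field_differentiable_bound[where S=S and f' = "\<lambda>u. \<phi>'' (z + u) - \<phi>'' z"])
      show "((\<lambda>u. \<phi>' (z + u) - \<phi>'' z * u) has_real_derivative \<phi>'' (z + v) - \<phi>'' z) (at v within S)" for v
        by (rule has_field_derivative_at_within) (auto intro!: derivative_eq_intros DERIV_chain2[OF d2])
      show "norm (\<phi>'' (z + v) - \<phi>'' z) \<le> L * \<bar>d\<bar>" if "v \<in> S" for v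
      proof -
        have "norm (\<phi>'' (z + v) - \<phi>'' z) \<le> L * dist (z + v) z"
          using lipschitz_onD[OF lip, of "z + v" z] by (simp add: dist_norm)
        also have "\<dots> \<le> L * \<bar>d\<bar>" using that L by (auto simp: S_def dist_real_def intro!: mult_left_mono)
        finally show ?thesis .
      qed
    qed (use u in \<open>auto simp: S_def\<close>)
    also have "\<dots> \<le> (L * \<bar>d\<bar>) * \<bar>d\<bar>" using u L by (intro mult_left_mono) (auto simp: S_def)
    finally show ?thesis by (simp add: power2_eq_square)
  qed
  have "norm ((\<phi> (z + d) - \<phi>' z * d - \<phi>'' z / 2 * d\<^sup>2) - (\<phi> (z + 0) - \<phi>' z * 0 - \<phi>'' z / 2 * 0\<^sup>2))
      \<le> (L * \<bar>d\<bar>^2) * norm (d - 0)"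
  proof (rule field_differentiable_bound[where S=S and f' = "\<lambda>u. \<phi>' (z + u) - \<phi>' z - \<phi>'' z * u"])
    show "((\<lambda>u. \<phi> (z + u) - \<phi>' z * u - \<phi>'' z / 2 * u\<^sup>2) has_real_derivative \<phi>' (z + v) - \<phi>' z - \<phi>'' z * v) (at v within S)" for v
      by (rule has_field_derivative_at_within) (auto intro!: derivative_eq_intros DERIV_chain2[OF d1])
  qed (use * in \<open>auto simp: S_def\<close>)
  then show ?thesis by (simp add: power3_eq_cube power2_eq_square mult_ac)
qed

lemma cube_add_le:
  fixes a b :: real
  assumes "0 \<le> a" "0 \<le> b"
  shows "(a + b)^3 \<le> 4 * a^3 + 4 * b^3"
proof -
  have "4 * a^3 + 4 * b^3 - (a + b)^3 = 3 * (a + b) * (a - b)\<^sup>2"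
    by (simp add: power2_eq_square power3_eq_cube algebra_simps)
  also have "\<dots> \<ge> 0" using assms by simp
  finally show ?thesis by simp
qed

text \<open>Sampling the path at the grid point \<lfloor>t (n + 1)\<rfloor> / (n + 1) uses countably
  many times, so each approximation is jointly measurable, and continuity of the path gives
  pointwise convergence.\<close>

lemma borel_measurable_continuous_paths:
  fixes R :: "real \<Rightarrow> 'a \<Rightarrow> real"
  assumes meas: "\<And>t. R t \<in> borel_measurable M"
    and cont: "\<And>\<omega>. \<omega> \<in> space M \<Longrightarrow> continuous_on UNIV (\<lambda>t. R t \<omega>)"
  shows "(\<lambda>(t, \<omega>). R t \<omega>) \<in> borel_measurable (borel \<Otimes>\<^sub>M M)"
proof (rule borel_measurable_LIMSEQ_real)
  define u where "u n = (\<lambda>(t, \<omega>). R (of_int \<lfloor>t * real (Suc n)\<rfloor> / real (Suc n)) \<omega>)" for n :: nat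
  show "u n \<in> borel_measurable (borel \<Otimes>\<^sub>M M)" for n
  proof -
    have "(\<lambda>p. R (of_int \<lfloor>fst p * real (Suc n)\<rfloor> / real (Suc n)) (snd p)) \<in> borel_measurable (borel \<Otimes>\<^sub>M M)"
      by (rule measurable_compose_countable[where f="\<lambda>i p. R (of_int i / real (Suc n)) (snd p)"])
        (use meas in measurable)
    then show ?thesis by (simp add: u_def case_prod_beta')
  qed
  fix p :: "real \<times> 'a" assume "p \<in> space (borel \<Otimes>\<^sub>M M)"
  then obtain t \<omega> where p: "p = (t, \<omega>)" and \<omega>: "\<omega> \<in> space M" by (auto simp: space_pair_measure)
  have "(\<lambda>n. of_int \<lfloor>t * real (Suc n)\<rfloor> / real (Suc n)) \<longlonglongrightarrow> t"
  proof (rule tendsto_sandwich)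
    show "\<forall>\<^sub>F n in sequentially. t - 1 / real (Suc n) \<le> of_int \<lfloor>t * real (Suc n)\<rfloor> / real (Suc n)"
    proof (rule always_eventually, rule allI)
      fix n
      have "(t * real (Suc n) - 1) / real (Suc n) \<le> of_int \<lfloor>t * real (Suc n)\<rfloor> / real (Suc n)"
        by (intro divide_right_mono) linarith+
      then show "t - 1 / real (Suc n) \<le> of_int \<lfloor>t * real (Suc n)\<rfloor> / real (Suc n)"
        by (simp add: diff_divide_distrib)
    qed
    show "\<forall>\<^sub>F n in sequentially. of_int \<lfloor>t * real (Suc n)\<rfloor> / real (Suc n) \<le> t"
    proof (rule always_eventually, rule allI)
      fix n
      show "of_int \<lfloor>t * real (Suc n)\<rfloor> / real (Suc n) \<le> t"
        by (subst pos_divide_le_eq) auto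
    qed
    have "(\<lambda>n. t - inverse (real (Suc n))) \<longlonglongrightarrow> t - 0"
      by (intro tendsto_intros LIMSEQ_inverse_real_of_nat)
    then show "(\<lambda>n. t - 1 / real (Suc n)) \<longlonglongrightarrow> t" by (simp add: inverse_eq_divide)
  qed simp
  moreover have "isCont (\<lambda>t. R t \<omega>) t" using cont[OF \<omega>] by (simp add: continuous_on_eq_continuous_at)
  ultimately show "(\<lambda>n. u n p) \<longlonglongrightarrow> (case p of (t, \<omega>) \<Rightarrow> R t \<omega>)"
    unfolding u_def p by (auto intro: isCont_tendsto_compose)
qed

section \<open>Moments of Gaussian increments that are independent of the past\<close>

context prob_space
begin

text \<open>The definition of Brownian motion speaks of independent families of sets, while the
  product rule for expectations needs independent random variables. The preimages under
  \<open>w\<close> already form a sigma-algebra, so generating one from them adds nothing.\<close>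

lemma indep_var_of_indep_set:
  assumes sub: "subalgebra M G" and \<xi>: "\<xi> \<in> borel_measurable G" and w: "w \<in> borel_measurable M"
    and ind: "indep_set (sets G) {w -` A \<inter> space M | A. A \<in> sets borel}"
  shows "indep_var borel \<xi> borel w"
  unfolding indep_var_eq
proof (intro conjI)
  show "\<xi> \<in> borel_measurable M" using sub \<xi> by (rule measurable_from_subalg)
  have sp: "space G = space M" using sub by (simp add: subalgebra_def)
  have "sigma_sets (space M) {\<xi> -` A \<inter> space M |A. A \<in> sets borel} \<subseteq> sets G"
    using measurable_sets[OF \<xi>] unfolding sp by (intro sets.sigma_sets_subset[of _ G, unfolded sp]) blast
  note sub\<xi> = this
  have v: "sets (vimage_algebra (space M) w borel) = {w -` A \<inter> space M | A. A \<in> sets borel}"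
    by (rule sets_vimage_algebra2) simp
  have vw: "sigma_sets (space M) {w -` A \<inter> space M |A. A \<in> sets borel} = {w -` A \<inter> space M | A. A \<in> sets borel}"
    using sets.sigma_sets_eq[of "vimage_algebra (space M) w borel"] unfolding v space_vimage_algebra .
  show "indep_set (sigma_sets (space M) {\<xi> -` A \<inter> space M |A. A \<in> sets borel})
     (sigma_sets (space M) {w -` A \<inter> space M |A. A \<in> sets borel})"
    using ind sub\<xi> unfolding vw indep_sets2_eq by blast
qed (rule w)

lemma normal_moments:
  assumes N: "distributed M lborel w (\<lambda>x. ennreal (normal_density 0 (sqrt \<delta>) x))" and \<delta>: "0 < \<delta>"
  shows "integrable M (\<lambda>\<omega>. w \<omega> ^ k)" "integrable M (\<lambda>\<omega>. \<bar>w \<omega>\<bar> ^ k)"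
    "expectation w = 0" "expectation (\<lambda>\<omega>. (w \<omega>)\<^sup>2) = \<delta>"
    "expectation (\<lambda>\<omega>. \<bar>w \<omega>\<bar>) \<le> sqrt \<delta>" "expectation (\<lambda>\<omega>. \<bar>w \<omega>\<bar>^3) \<le> 2 * (\<delta> * sqrt \<delta>)"
proof -
  have s: "0 < sqrt \<delta>" using \<delta> by simp
  have E: "expectation (\<lambda>\<omega>. g (w \<omega>)) = (\<integral>x. normal_density 0 (sqrt \<delta>) x * g x \<partial>lborel)"
    if "g \<in> borel_measurable borel" for g :: "real \<Rightarrow> real"
    using distributed_integral[OF N, of g] that by simp
  have I: "integrable M (\<lambda>\<omega>. g (w \<omega>))" if "g \<in> borel_measurable borel"
    "integrable lborel (\<lambda>x. normal_density 0 (sqrt \<delta>) x * g x)" for g :: "real \<Rightarrow> real"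
    using distributed_integrable[OF N, of g] that by simp
  show "integrable M (\<lambda>\<omega>. w \<omega> ^ k)" "integrable M (\<lambda>\<omega>. \<bar>w \<omega>\<bar> ^ k)"
    using I[of "\<lambda>x. x^k"] I[of "\<lambda>x. \<bar>x\<bar>^k"] integrable_normal_moment[OF s, of 0 k] integrable_normal_moment_abs[OF s, of 0 k]
    by simp_all
  show "expectation w = 0" using E[of "\<lambda>x. x"] integral_normal_moment_odd[OF s, of 0 0] by simp
  show "expectation (\<lambda>\<omega>. (w \<omega>)\<^sup>2) = \<delta>"
    using E[of "\<lambda>x. x^2"] integral_normal_moment_even[OF s, of 0 1] \<delta> by simp
  \<comment> \<open>Odd absolute moments of a Gaussian carry this factor. Bounding it by 1 keeps
    only the order in \<delta>.\<close>
  have sq: "sqrt (2 / pi) \<le> 1" using pi_ge_two by simp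
  have "expectation (\<lambda>\<omega>. \<bar>w \<omega>\<bar>) = sqrt \<delta> * sqrt (2 / pi)"
    using E[of "\<lambda>x. \<bar>x\<bar>"] integral_normal_moment_abs_odd[OF s, of 0 0] by simp
  also have "\<dots> \<le> sqrt \<delta> * 1" using sq s by (intro mult_left_mono) auto
  finally show "expectation (\<lambda>\<omega>. \<bar>w \<omega>\<bar>) \<le> sqrt \<delta>" by simp
  have "expectation (\<lambda>\<omega>. \<bar>w \<omega>\<bar>^3) = 2 * sqrt \<delta> ^ 3 * sqrt (2 / pi)"
    using E[of "\<lambda>x. \<bar>x\<bar>^3"] integral_normal_moment_abs_odd[OF s, of 0 1] by simp
  also have "\<dots> \<le> 2 * sqrt \<delta> ^ 3 * 1" using sq s by (intro mult_left_mono) auto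
  finally show "expectation (\<lambda>\<omega>. \<bar>w \<omega>\<bar>^3) \<le> 2 * (\<delta> * sqrt \<delta>)" using \<delta> by (simp add: power3_eq_cube)
qed

text \<open>These are the first and second order terms of Ito's formula. Independence splits the
  expectation, and both \<open>w\<close> and \<open>w^2 - \<delta>\<close> are centred; the second
  fact is what turns a squared increment into \<open>\<delta>\<close> with no error in the
  mean.\<close>

lemma expectation_mult_increment:
  assumes sub: "subalgebra M G" and \<xi>: "\<xi> \<in> borel_measurable G" and bd: "\<And>\<omega>. \<bar>\<xi> \<omega>\<bar> \<le> C"
    and N: "distributed M lborel w (\<lambda>x. ennreal (normal_density 0 (sqrt \<delta>) x))" and \<delta>: "0 < \<delta>"
    and ind: "indep_set (sets G) {w -` A \<inter> space M | A. A \<in> sets borel}"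
  shows "integrable M (\<lambda>\<omega>. \<xi> \<omega> * w \<omega>)" "expectation (\<lambda>\<omega>. \<xi> \<omega> * w \<omega>) = 0"
    "integrable M (\<lambda>\<omega>. \<xi> \<omega> * ((w \<omega>)\<^sup>2 - \<delta>))" "expectation (\<lambda>\<omega>. \<xi> \<omega> * ((w \<omega>)\<^sup>2 - \<delta>)) = 0"
proof -
  have w: "w \<in> borel_measurable M" using distributed_measurable[OF N] by simp
  note iv = indep_var_of_indep_set[OF sub \<xi> w ind]
  have "\<xi> \<in> borel_measurable M" using sub \<xi> by (rule measurable_from_subalg)
  then have i\<xi>: "integrable M \<xi>" by (rule integrable_const_bound[rotated, where B=C]) (use bd in auto)
  note m = normal_moments[OF N \<delta>]
  have iw: "integrable M w" using m(1)[of 1] by simp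
  show "integrable M (\<lambda>\<omega>. \<xi> \<omega> * w \<omega>)" "expectation (\<lambda>\<omega>. \<xi> \<omega> * w \<omega>) = 0"
    using indep_var_integrable[OF iv i\<xi> iw] indep_var_lebesgue_integral[OF iv i\<xi> iw] m(3) by simp_all
  have iv2: "indep_var borel \<xi> borel (\<lambda>\<omega>. (w \<omega>)\<^sup>2 - \<delta>)"
    using indep_var_compose[OF iv, of id borel "\<lambda>x. x\<^sup>2 - \<delta>" borel] by (simp add: comp_def)
  have iw2: "integrable M (\<lambda>\<omega>. (w \<omega>)\<^sup>2 - \<delta>)" using m(1)[of 2] by simp
  have "expectation (\<lambda>\<omega>. (w \<omega>)\<^sup>2 - \<delta>) = 0" using m(1)[of 2] m(4) by (simp add: prob_space)
  then show "integrable M (\<lambda>\<omega>. \<xi> \<omega> * ((w \<omega>)\<^sup>2 - \<delta>))" "expectation (\<lambda>\<omega>. \<xi> \<omega> * ((w \<omega>)\<^sup>2 - \<delta>)) = 0"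
    using indep_var_integrable[OF iv2 i\<xi> iw2] indep_var_lebesgue_integral[OF iv2 i\<xi> iw2] by simp_all
qed

text \<open>One step of Ito's formula. The terms that are not of order \<open>\<delta>\<^sup>3\<^sup>/\<^sup>2\<close> are centred because
  \<open>w\<close> is independent of the past \<open>G\<close>.\<close>

lemma ito_step:
  fixes \<phi> \<phi>' \<phi>'' :: "real \<Rightarrow> real"
  assumes d1: "\<And>z. (\<phi> has_real_derivative \<phi>' z) (at z)"
    and d2: "\<And>z. (\<phi>' has_real_derivative \<phi>'' z) (at z)"
    and lip: "L-lipschitz_on UNIV \<phi>''"
    and C: "\<And>\<omega>. \<omega> \<in> A \<Longrightarrow> \<bar>\<phi>' (\<xi> \<omega>)\<bar> \<le> C" "\<And>\<omega>. \<omega> \<in> A \<Longrightarrow> \<bar>\<phi>'' (\<xi> \<omega>)\<bar> \<le> C"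
    and sub: "subalgebra M G" and \<xi>: "\<xi> \<in> borel_measurable G" and A: "A \<in> sets G"
    and N: "distributed M lborel w (\<lambda>x. ennreal (normal_density 0 (sqrt \<delta>) x))" and \<delta>: "0 < \<delta>"
    and ind: "indep_set (sets G) {w -` A \<inter> space M | A. A \<in> sets borel}"
    and e: "e \<in> borel_measurable M" "\<And>\<omega>. \<omega> \<in> A \<Longrightarrow> \<bar>e \<omega>\<bar> \<le> B * \<delta>" and B: "0 \<le> B" and C0: "0 \<le> C"
    and D: "\<And>\<omega>. D \<omega> = indicator A \<omega> * (\<phi> (\<xi> \<omega> + w \<omega> + e \<omega>) - \<phi> (\<xi> \<omega>) - \<phi>' (\<xi> \<omega>) * e \<omega> - \<phi>'' (\<xi> \<omega>) / 2 * \<delta>)"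
  shows "integrable M D"
    "\<bar>expectation D\<bar> \<le> \<delta> * (C * B * sqrt \<delta> + C * B\<^sup>2 * \<delta> + 8 * L * sqrt \<delta> + 4 * L * B^3 * \<delta>\<^sup>2)"
proof -
  have w[measurable]: "w \<in> borel_measurable M" using distributed_measurable[OF N] by simp
  note m = normal_moments[OF N \<delta>]
  have L: "0 \<le> L" using lip by (rule lipschitz_on_nonneg)
  have c\<phi>: "continuous_on UNIV \<phi>" "continuous_on UNIV \<phi>'" "continuous_on UNIV \<phi>''"
    using d1 d2 lipschitz_on_continuous_on[OF lip] by (blast intro: DERIV_continuous_on has_field_derivative_at_within)+
  note [measurable] = c\<phi>[THEN borel_measurable_continuous_onI]
  have [measurable]: "\<xi> \<in> borel_measurable M" using sub \<xi> by (rule measurable_from_subalg)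
  have AM[measurable]: "A \<in> events" using sub A by (auto simp: subalgebra_def)
  have [measurable]: "e \<in> borel_measurable M" by fact
  have [measurable]: "D \<in> borel_measurable M" unfolding D[abs_def] by measurable
  define p where "p \<omega> = indicator A \<omega> * \<phi>' (\<xi> \<omega>)" for \<omega>
  define q where "q \<omega> = indicator A \<omega> * (\<phi>'' (\<xi> \<omega>) / 2)" for \<omega>
  note [measurable] = A \<xi>
  have pG: "p \<in> borel_measurable G" "q \<in> borel_measurable G"
    unfolding p_def[abs_def] q_def[abs_def] by measurable
  have pb: "\<bar>p \<omega>\<bar> \<le> C" "\<bar>q \<omega>\<bar> \<le> C" for \<omega>
    using C[of \<omega>] C0 by (auto simp: p_def q_def indicator_def)
  note P = expectation_mult_increment[OF sub pG(1) pb(1) N \<delta> ind]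
  note Q = expectation_mult_increment[OF sub pG(2) pb(2) N \<delta> ind]
  \<comment> \<open>After removal of the two centred terms there remain the Taylor error and the
    terms in which the drift displacement \<open>e\<close> multiplies \<open>w\<close> or itself.
    The bound \<open>bnd\<close> depends on \<open>\<omega>\<close> through powers of \<bar>w\<bar>
    only, and its mean is of order \<open>\<delta> * sqrt \<delta>\<close>.\<close>
  define rest where "rest \<omega> = D \<omega> - p \<omega> * w \<omega> - q \<omega> * ((w \<omega>)\<^sup>2 - \<delta>)" for \<omega>
  define bnd where "bnd \<omega> = C * B * \<delta> * \<bar>w \<omega>\<bar> + C * B\<^sup>2 * \<delta>\<^sup>2 + 4 * L * \<bar>w \<omega>\<bar>^3 + 4 * L * (B * \<delta>)^3" for \<omega>
  have [measurable]: "rest \<in> borel_measurable M"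
    using measurable_from_subalg[OF sub pG(1)] measurable_from_subalg[OF sub pG(2)] unfolding rest_def[abs_def] by measurable
  have rb: "\<bar>rest \<omega>\<bar> \<le> bnd \<omega>" for \<omega>
  proof (cases "\<omega> \<in> A")
    case False
    then show ?thesis using B C0 L \<delta> by (simp add: rest_def D p_def q_def bnd_def)
  next
    case True
    define x v f where "x = \<xi> \<omega>" and "v = w \<omega>" and "f = e \<omega>"
    define T where "T = \<phi> (x + (v + f)) - \<phi> x - \<phi>' x * (v + f) - \<phi>'' x / 2 * (v + f)\<^sup>2"
    have fb: "\<bar>f\<bar> \<le> B * \<delta>" using e(2)[OF True] by (simp add: f_def)
    have cb: "\<bar>\<phi>'' x\<bar> \<le> C" using C(2)[OF True] by (simp add: x_def)
    have "\<bar>T\<bar> \<le> L * \<bar>v + f\<bar>^3" unfolding T_def by (rule taylor2_lipschitz[OF d1 d2 lip])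
    also have "\<dots> \<le> L * (4 * \<bar>v\<bar>^3 + 4 * (B * \<delta>)^3)"
    proof (rule mult_left_mono[OF _ L])
      have "\<bar>v + f\<bar>^3 \<le> (\<bar>v\<bar> + \<bar>f\<bar>)^3" by (intro power_mono) auto
      also have "\<dots> \<le> 4 * \<bar>v\<bar>^3 + 4 * \<bar>f\<bar>^3" by (rule cube_add_le) auto
      also have "\<dots> \<le> 4 * \<bar>v\<bar>^3 + 4 * (B * \<delta>)^3" using power_mono[OF fb, of 3] by simp
      finally show "\<bar>v + f\<bar>^3 \<le> 4 * \<bar>v\<bar>^3 + 4 * (B * \<delta>)^3" .
    qed
    finally have T: "\<bar>T\<bar> \<le> 4 * L * \<bar>v\<bar>^3 + 4 * L * (B * \<delta>)^3" by (simp only: distrib_left mult_ac)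
    have r: "rest \<omega> = T + \<phi>'' x * (v * f) + \<phi>'' x / 2 * f\<^sup>2"
      using True by (simp add: rest_def D p_def q_def T_def x_def v_def f_def power2_eq_square field_simps)
    have "\<bar>\<phi>'' x * (v * f)\<bar> \<le> C * (\<bar>v\<bar> * (B * \<delta>))"
      unfolding abs_mult using cb fb C0 by (intro mult_mono) auto
    moreover have "\<bar>\<phi>'' x / 2 * f\<^sup>2\<bar> \<le> C * (B * \<delta>)\<^sup>2"
    proof -
      have "f\<^sup>2 \<le> (B * \<delta>)\<^sup>2" using power_mono[OF fb, of 2] by simp
      then show ?thesis unfolding abs_mult using cb C0 by (intro mult_mono) auto
    qed
    ultimately have "\<bar>rest \<omega>\<bar> \<le> (4 * L * \<bar>v\<bar>^3 + 4 * L * (B * \<delta>)^3) + C * (\<bar>v\<bar> * (B * \<delta>)) + C * (B * \<delta>)\<^sup>2"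
      using T unfolding r by linarith
    also have "\<dots> = bnd \<omega>" unfolding bnd_def v_def power_mult_distrib by (simp only: mult_ac add_ac)
    finally show ?thesis .
  qed
  have ib: "integrable M bnd" unfolding bnd_def using m(2)[of 1] m(2)[of 3] by simp
  have ir: "integrable M rest" by (rule Bochner_Integration.integrable_bound[OF ib]) (auto intro: order_trans[OF rb abs_ge_self])
  have Deq: "D = (\<lambda>\<omega>. rest \<omega> + p \<omega> * w \<omega> + q \<omega> * ((w \<omega>)\<^sup>2 - \<delta>))" by (rule ext) (simp add: rest_def)
  show "integrable M D" unfolding Deq using ir P(1) Q(3) by simp
  have "expectation D = expectation rest" unfolding Deq using ir P Q by simp
  also have "\<bar>\<dots>\<bar> \<le> expectation (\<lambda>\<omega>. \<bar>rest \<omega>\<bar>)" by (rule integral_abs_bound)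
  also have "\<dots> \<le> expectation bnd" using ir ib rb by (intro integral_mono) auto
  also have "\<dots> = C * B * \<delta> * expectation (\<lambda>\<omega>. \<bar>w \<omega>\<bar>) + C * B\<^sup>2 * \<delta>\<^sup>2 + 4 * L * expectation (\<lambda>\<omega>. \<bar>w \<omega>\<bar>^3) + 4 * L * (B * \<delta>)^3"
    unfolding bnd_def using m(2)[of 1] m(2)[of 3] by (simp add: prob_space)
  also have "\<dots> \<le> C * B * \<delta> * sqrt \<delta> + C * B\<^sup>2 * \<delta>\<^sup>2 + 4 * L * (2 * (\<delta> * sqrt \<delta>)) + 4 * L * (B * \<delta>)^3"
    using m(5,6) B C0 L \<delta> by (intro add_mono mult_left_mono) auto
  also have "\<dots> = \<delta> * (C * B * sqrt \<delta> + C * B\<^sup>2 * \<delta> + 8 * L * sqrt \<delta> + 4 * L * B^3 * \<delta>\<^sup>2)"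
    by (simp add: algebra_simps power2_eq_square power3_eq_cube)
  finally show "\<bar>expectation D\<bar> \<le> \<dots>" .
qed

end


subsection \<open>Dynkin's formula\<close>

lemma set_integral_le_const:
  fixes f :: "real \<Rightarrow> real"
  assumes i: "set_integrable lborel {s..t} f" and f: "\<And>u. u \<in> {s..t} \<Longrightarrow> \<bar>f u\<bar> \<le> C" and st: "s \<le> t"
  shows "\<bar>LBINT u:{s..t}. f u\<bar> \<le> C * (t - s)"
proof -
  have "norm (LBINT u:{s..t}. f u) \<le> (LBINT u:{s..t}. norm (f u))"
    by (rule set_integral_norm_bound[OF i])
  also have "\<dots> \<le> (LBINT u:{s..t}. C)"
    using set_integrable_abs[OF i] borel_integrable_atLeastAtMost'[of s t "\<lambda>_. C"] f
    by (intro set_integral_mono) auto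
  also have "\<dots> = C * (t - s)" using st by (simp add: set_integral_const)
  finally show ?thesis by simp
qed

text \<open>Abstract setting for Dynkin's formula. \<open>Z\<close> is a Brownian motion with the bounded drift
  \<open>b \<circ> R\<close>; in the application \<open>R\<close> is the diffusion clamped to a compact interval, so that \<open>Z\<close>
  and \<open>R\<close> agree up to the exit time from that interval.\<close>

locale drifted_brownian = prob_space M for M :: "'a measure" +
  fixes G :: "real \<Rightarrow> 'a measure" and W R :: "real \<Rightarrow> 'a \<Rightarrow> real" and b :: "real \<Rightarrow> real"
    and lo hi B x :: real
  assumes sub: "\<And>t. 0 \<le> t \<Longrightarrow> subalgebra M (G t)"
    and W_0: "\<And>\<omega>. \<omega> \<in> space M \<Longrightarrow> W 0 \<omega> = 0"
    and W_cont: "\<And>\<omega>. \<omega> \<in> space M \<Longrightarrow> continuous_on {0..} (\<lambda>t. W t \<omega>)"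
    and W_normal: "\<And>s t. 0 \<le> s \<Longrightarrow> s < t \<Longrightarrow>
       distributed M lborel (\<lambda>\<omega>. W t \<omega> - W s \<omega>) (\<lambda>x. ennreal (normal_density 0 (sqrt (t - s)) x))"
    and W_indep: "\<And>s t. 0 \<le> s \<Longrightarrow> s < t \<Longrightarrow>
       indep_set (sets (G s)) {(\<lambda>\<omega>. W t \<omega> - W s \<omega>) -` A \<inter> space M | A. A \<in> sets borel}"
    and R_adapted: "\<And>t. 0 \<le> t \<Longrightarrow> R t \<in> borel_measurable (G t)"
    and R_cont: "\<And>\<omega>. \<omega> \<in> space M \<Longrightarrow> continuous_on {0..} (\<lambda>t. R t \<omega>)"
    and R_range: "\<And>t \<omega>. 0 \<le> t \<Longrightarrow> \<omega> \<in> space M \<Longrightarrow> R t \<omega> \<in> {lo..hi}"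
    and R_0: "\<And>\<omega>. \<omega> \<in> space M \<Longrightarrow> R 0 \<omega> = x"
    and b_cont: "continuous_on UNIV b"
    and b_bound: "\<And>y. \<bar>b y\<bar> \<le> B"
begin

definition J :: "(real \<Rightarrow> real) \<Rightarrow> real \<Rightarrow> 'a \<Rightarrow> real" where
  "J g t \<omega> = (LBINT s:{0..t}. g (R s \<omega>))"

definition Z :: "real \<Rightarrow> 'a \<Rightarrow> real" where
  "Z t \<omega> = x + W t \<omega> + J b t \<omega>"

lemma B_nonneg: "0 \<le> B"
  using b_bound[of 0] by simp

lemma R_meas: "0 \<le> t \<Longrightarrow> R t \<in> borel_measurable M"
  using R_adapted sub measurable_from_subalg by blast

lemma R_joint: "(\<lambda>(t, \<omega>). R (max 0 t) \<omega>) \<in> borel_measurable (borel \<Otimes>\<^sub>M M)"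
proof (rule borel_measurable_continuous_paths)
  show "continuous_on UNIV (\<lambda>t. R (max 0 t) \<omega>)" if "\<omega> \<in> space M" for \<omega>
    by (rule continuous_on_compose2[OF R_cont[OF that]]) (auto intro!: continuous_intros)
qed (simp add: R_meas)

lemma continuous_on_gR:
  assumes "continuous_on UNIV g" "\<omega> \<in> space M"
  shows "continuous_on {0..} (\<lambda>t. g (R t \<omega>))"
  by (rule continuous_on_compose2[OF assms(1) R_cont[OF assms(2)]]) simp

lemma gR_integrable:
  assumes g: "continuous_on UNIV (g :: real \<Rightarrow> real)" and \<omega>: "\<omega> \<in> space M" and s: "0 \<le> s"
  shows "set_integrable lborel {s..t} (\<lambda>u. g (R u \<omega>))"
  by (rule borel_integrable_atLeastAtMost', rule continuous_on_subset[OF continuous_on_gR[OF g \<omega>]])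
    (use s in auto)

lemma J_measurable:
  assumes g: "continuous_on UNIV g"
  shows "J g t \<in> borel_measurable M"
proof -
  have [measurable]: "g \<in> borel_measurable borel" using g by (rule borel_measurable_continuous_onI)
  have [measurable]: "(\<lambda>p. R (max 0 (fst p)) (snd p)) \<in> borel_measurable (borel \<Otimes>\<^sub>M M)"
    using R_joint by (simp add: case_prod_beta')
  have "(\<lambda>p. R (max 0 (fst (snd p, fst p))) (snd (snd p, fst p))) \<in> borel_measurable (M \<Otimes>\<^sub>M lborel)"
    by (rule measurable_compose[where g="\<lambda>p. R (max 0 (fst p)) (snd p)" and N="borel \<Otimes>\<^sub>M M"]) measurable
  then have [measurable]: "(\<lambda>p. R (max 0 (snd p)) (fst p)) \<in> borel_measurable (M \<Otimes>\<^sub>M lborel)" by simp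
  have "(\<lambda>\<omega>. \<integral>s. indicator {0..t} s *\<^sub>R g (R (max 0 s) \<omega>) \<partial>lborel) \<in> borel_measurable M"
    by (rule lborel.borel_measurable_lebesgue_integral) (unfold case_prod_beta', measurable)
  also have "(\<lambda>\<omega>. \<integral>s. indicator {0..t} s *\<^sub>R g (R (max 0 s) \<omega>) \<partial>lborel) = J g t"
    unfolding J_def set_lebesgue_integral_def by (intro ext Bochner_Integration.integral_cong) (auto simp: indicator_def)
  finally show ?thesis .
qed

lemma J_diff:
  assumes g: "continuous_on UNIV g" and \<omega>: "\<omega> \<in> space M" and s: "0 \<le> s" "s \<le> t"
  shows "J g t \<omega> - J g s \<omega> = (LBINT u:{s..t}. g (R u \<omega>))"
proof -
  have "J g t \<omega> = J g s \<omega> + (LBINT u:{s..t}. g (R u \<omega>))"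
    unfolding J_def ivl_disj_un_two_touch(4)[OF s, symmetric]
  proof (rule set_integral_Un_AE)
    show "AE u in lborel. \<not> (u \<in> {0..s} \<and> u \<in> {s..t})"
      using AE_lborel_singleton[of s] by eventually_elim auto
  qed (use gR_integrable[OF g \<omega>] s in auto)
  then show ?thesis by simp
qed

lemma J_lipschitz:
  assumes g: "continuous_on UNIV g" "\<And>y. y \<in> {lo..hi} \<Longrightarrow> \<bar>g y\<bar> \<le> C"
    and \<omega>: "\<omega> \<in> space M" and s: "0 \<le> s" "s \<le> t"
  shows "\<bar>J g t \<omega> - J g s \<omega>\<bar> \<le> C * (t - s)"
  unfolding J_diff[OF g(1) \<omega> s]
  by (rule set_integral_le_const[OF gR_integrable[OF g(1) \<omega> s(1)] _ s(2)]) (use g(2) R_range[OF _ \<omega>] s in auto)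

lemma J_0: "\<omega> \<in> space M \<Longrightarrow> J g 0 \<omega> = 0"
  using set_integral_const[of "{0::real}" lborel "g (R 0 \<omega>)"]
  unfolding J_def by (subst set_lebesgue_integral_cong[of _ _ _ "\<lambda>_. g (R 0 \<omega>)"]) auto

lemma Z_continuous:
  assumes "\<omega> \<in> space M"
  shows "continuous_on {0..} (\<lambda>t. Z t \<omega>)"
proof -
  have "B-lipschitz_on {0..} (\<lambda>t. J b t \<omega>)"
  proof (rule lipschitz_onI)
    fix s t :: real assume st: "s \<in> {0..}" "t \<in> {0..}"
    show "dist (J b s \<omega>) (J b t \<omega>) \<le> B * dist s t"
      using J_lipschitz[OF b_cont b_bound assms, of s t] J_lipschitz[OF b_cont b_bound assms, of t s] st
      by (cases "s \<le> t") (auto simp: dist_real_def abs_minus_commute)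
  qed (rule B_nonneg)
  from lipschitz_on_continuous_on[OF this] show ?thesis
    unfolding Z_def by (intro continuous_intros W_cont assms)
qed

lemma Z_0: "\<omega> \<in> space M \<Longrightarrow> Z 0 \<omega> = x"
  by (simp add: Z_def W_0 J_0)

text \<open>\<open>\<eta>\<close> is rounded up to a grid, so that having to take step
  \<open>i\<close> is known at the start of that step. Summing the one-step formula gives a
  vanishing error plus a Riemann sum, which is bounded and converges. The value of
  \<open>\<phi>\<close> at the rounded time has only a lower bound, and therefore the limit is an
  inequality.\<close>

lemma dynkin:
  fixes \<phi> \<phi>' \<phi>'' :: "real \<Rightarrow> real" and \<eta> :: "'a \<Rightarrow> real"
  assumes T: "0 < T"
    and \<eta>: "\<And>\<omega>. \<omega> \<in> space M \<Longrightarrow> \<eta> \<omega> \<in> {0..T}"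
    and \<eta>_stop: "\<And>t. 0 \<le> t \<Longrightarrow> {\<omega> \<in> space M. t < \<eta> \<omega>} \<in> sets (G t)"
    and ZR: "\<And>t \<omega>. \<omega> \<in> space M \<Longrightarrow> 0 \<le> t \<Longrightarrow> t \<le> \<eta> \<omega> \<Longrightarrow> Z t \<omega> = R t \<omega>"
    and d1: "\<And>z. (\<phi> has_real_derivative \<phi>' z) (at z)"
    and d2: "\<And>z. (\<phi>' has_real_derivative \<phi>'' z) (at z)"
    and lip: "L-lipschitz_on UNIV \<phi>''"
    and lower: "\<And>z. - C0 \<le> \<phi> z"
  shows "(\<lambda>\<omega>. \<phi> (R (\<eta> \<omega>) \<omega>)) \<in> borel_measurable M"
    "(\<lambda>\<omega>. J (\<lambda>y. \<phi>'' y / 2 + b y * \<phi>' y) (\<eta> \<omega>) \<omega>) \<in> borel_measurable M"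
    "expectation (\<lambda>\<omega>. \<phi> (R (\<eta> \<omega>) \<omega>)) \<le> \<phi> x + expectation (\<lambda>\<omega>. J (\<lambda>y. \<phi>'' y / 2 + b y * \<phi>' y) (\<eta> \<omega>) \<omega>)"
proof -
  define g where "g y = \<phi>'' y / 2 + b y * \<phi>' y" for y
  have c\<phi>: "continuous_on UNIV \<phi>" "continuous_on UNIV \<phi>'" "continuous_on UNIV \<phi>''"
    using d1 d2 lipschitz_on_continuous_on[OF lip] by (blast intro: DERIV_continuous_on has_field_derivative_at_within)+
  have cg: "continuous_on UNIV g" unfolding g_def by (intro continuous_intros c\<phi> b_cont) simp
  note [measurable] = c\<phi>[THEN borel_measurable_continuous_onI]
  have "bounded (\<phi>' ` {lo..hi})" "bounded (\<phi>'' ` {lo..hi})"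
    using c\<phi> by (auto intro!: compact_imp_bounded compact_continuous_image intro: continuous_on_subset)
  then obtain C1 C2 where C12: "\<And>y. y \<in> {lo..hi} \<Longrightarrow> \<bar>\<phi>' y\<bar> \<le> C1" "\<And>y. y \<in> {lo..hi} \<Longrightarrow> \<bar>\<phi>'' y\<bar> \<le> C2"
    unfolding bounded_iff real_norm_def by blast
  define C where "C = max 0 (max C1 C2)"
  have C: "\<bar>\<phi>' y\<bar> \<le> C" "\<bar>\<phi>'' y\<bar> \<le> C" if "y \<in> {lo..hi}" for y using C12[OF that] by (auto simp: C_def)
  have C_nn: "0 \<le> C" by (simp add: C_def)
  have gb: "\<bar>g y\<bar> \<le> C + B * C" if y: "y \<in> {lo..hi}" for y
  proof -
    have "\<bar>b y * \<phi>' y\<bar> \<le> B * C" unfolding abs_mult by (intro mult_mono b_bound C(1) y B_nonneg) auto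
    then show ?thesis using C(2)[OF y] C_nn unfolding g_def by linarith
  qed
  define G' where "G' = C + B * C"
  have G'_nn: "0 \<le> G'" using C_nn B_nonneg by (simp add: G'_def)
  define t where "t n i = real i * T / real (Suc n)" for n i
  define \<delta> where "\<delta> n = T / real (Suc n)" for n
  have \<delta>: "0 < \<delta> n" for n using T by (simp add: \<delta>_def)
  have t_nn: "0 \<le> t n i" for n i using T by (simp add: t_def)
  have t_Suc: "t n (Suc i) = t n i + \<delta> n" for n i by (simp add: t_def \<delta>_def add_divide_distrib distrib_right)
  have t0: "t n 0 = 0" for n by (simp add: t_def)
  have tn: "t n (Suc n) = T" for n by (simp add: t_def)
  \<comment> \<open>The number of grid points strictly before \<open>\<eta>\<close>; thus
    \<open>t n (j n \<omega>)\<close> is the first grid point not before \<open>\<eta>\<close>.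
    There are \<open>n + 1\<close> cells, so that \<open>n = 0\<close> causes no division by
    zero.\<close>
  define j where "j n \<omega> = nat \<lceil>\<eta> \<omega> / \<delta> n\<rceil>" for n \<omega>
  have j: "t n i < \<eta> \<omega> \<longleftrightarrow> i < j n \<omega>" if "\<omega> \<in> space M" for n i \<omega>
  proof -
    have "t n i < \<eta> \<omega> \<longleftrightarrow> real i < \<eta> \<omega> / \<delta> n"
      unfolding pos_less_divide_eq[OF \<delta>[of n]] by (simp add: t_def \<delta>_def)
    also have "\<dots> \<longleftrightarrow> i < j n \<omega>" unfolding j_def by linarith
    finally show ?thesis .
  qed
  have jn: "j n \<omega> \<le> Suc n" if "\<omega> \<in> space M" for n \<omega>
    using j[OF that, of n "Suc n"] \<eta>[OF that] tn[of n] by auto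
  have tj: "\<eta> \<omega> \<le> t n (j n \<omega>)" "t n (j n \<omega>) \<le> \<eta> \<omega> + \<delta> n" "t n (j n \<omega>) \<le> T" if "\<omega> \<in> space M" for n \<omega>
  proof -
    show "\<eta> \<omega> \<le> t n (j n \<omega>)" using j[OF that, of n "j n \<omega>"] by simp
    show "t n (j n \<omega>) \<le> \<eta> \<omega> + \<delta> n"
    proof (cases "j n \<omega>")
      case 0 then show ?thesis using \<eta>[OF that] \<delta>[of n] by (simp add: t0)
    next
      case (Suc k)
      then have "t n k < \<eta> \<omega>" using j[OF that, of n k] by simp
      then show ?thesis by (simp add: Suc t_Suc)
    qed
    show "t n (j n \<omega>) \<le> T" using jn[OF that, of n] T by (simp add: t_def pos_divide_le_eq)
  qed
  have \<delta>0: "\<delta> \<longlonglongrightarrow> 0" unfolding \<delta>_def[abs_def]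
    using LIMSEQ_inverse_real_of_nat[THEN tendsto_mult_right_zero, of T] by (simp add: divide_inverse)
  have \<rho>: "(\<lambda>n. t n (j n \<omega>)) \<longlonglongrightarrow> \<eta> \<omega>" if "\<omega> \<in> space M" for \<omega>
  proof (rule tendsto_sandwich[of "\<lambda>_. \<eta> \<omega>" _ _ "\<lambda>n. \<eta> \<omega> + \<delta> n"])
    show "(\<lambda>n. \<eta> \<omega> + \<delta> n) \<longlonglongrightarrow> \<eta> \<omega>" using tendsto_add[OF tendsto_const \<delta>0, of "\<eta> \<omega>"] by simp
  qed (use tj[OF that] in auto)
  define A where "A n i = {\<omega> \<in> space M. t n i < \<eta> \<omega>}" for n i
  have AG: "A n i \<in> sets (G (t n i))" for n i unfolding A_def by (rule \<eta>_stop[OF t_nn])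
  have AM[measurable]: "A n i \<in> events" for n i using AG sub[OF t_nn[of n i]] by (auto simp: subalgebra_def)
  have Aj: "\<omega> \<in> A n i \<longleftrightarrow> i < j n \<omega>" if "\<omega> \<in> space M" for n i \<omega> using j[OF that] that by (simp add: A_def)
  \<comment> \<open>On an active step, \<open>D + E\<close> is the increment of
    \<open>\<phi>\<close> along \<open>Z\<close>: \<open>E\<close> is the Riemann summand, and
    \<open>D\<close> has mean of higher order than \<open>\<delta>\<close>. The expansion starts
    from \<open>R\<close>, which equals \<open>Z\<close> up to \<open>\<eta>\<close> and stays in
    \<open>{lo..hi}\<close>, where the derivatives are bounded.\<close>
  define D where "D n i \<omega> = indicator (A n i) \<omega> * (\<phi> (R (t n i) \<omega> + (W (t n i + \<delta> n) \<omega> - W (t n i) \<omega>) + (J b (t n i + \<delta> n) \<omega> - J b (t n i) \<omega>)) - \<phi> (R (t n i) \<omega>)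
      - \<phi>' (R (t n i) \<omega>) * (J b (t n i + \<delta> n) \<omega> - J b (t n i) \<omega>) - \<phi>'' (R (t n i) \<omega>) / 2 * \<delta> n)" for n i \<omega>
  define E where "E n i \<omega> = indicator (A n i) \<omega> * (\<phi>' (R (t n i) \<omega>) * (J b (t n i + \<delta> n) \<omega> - J b (t n i) \<omega>) + \<phi>'' (R (t n i) \<omega>) / 2 * \<delta> n)" for n i \<omega>
  define err where "err n = C * B * sqrt (\<delta> n) + C * B\<^sup>2 * \<delta> n + 8 * L * sqrt (\<delta> n) + 4 * L * B^3 * (\<delta> n)\<^sup>2" for n
  have D: "integrable M (D n i)" "\<bar>expectation (D n i)\<bar> \<le> \<delta> n * err n" for n i
    unfolding atomize_conj err_def
  proof (intro conjI)
    have *: "0 \<le> t n i" "t n i < t n i + \<delta> n" using t_nn \<delta> by auto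
    note N = W_normal[OF *, simplified]
    note I = W_indep[OF *]
    have m: "(\<lambda>\<omega>. J b (t n i + \<delta> n) \<omega> - J b (t n i) \<omega>) \<in> borel_measurable M"
      by (intro borel_measurable_diff J_measurable b_cont)
    have e: "\<bar>J b (t n i + \<delta> n) \<omega> - J b (t n i) \<omega>\<bar> \<le> B * \<delta> n" if "\<omega> \<in> A n i" for \<omega>
      using J_lipschitz[OF b_cont b_bound _ *(1), of \<omega> "t n i + \<delta> n"] that \<delta>[of n] by (simp add: A_def)
    have Cb: "\<bar>\<phi>' (R (t n i) \<omega>)\<bar> \<le> C" "\<bar>\<phi>'' (R (t n i) \<omega>)\<bar> \<le> C" if "\<omega> \<in> A n i" for \<omega>
      using that C[OF R_range[OF t_nn, of \<omega>]] by (auto simp: A_def)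
    note S = ito_step[OF d1 d2 lip Cb sub[OF t_nn] R_adapted[OF t_nn] AG N \<delta> I m e B_nonneg C_nn D_def]
    show "integrable M (D n i)" by (rule S(1))
    show "\<bar>expectation (D n i)\<bar> \<le> \<delta> n * (C * B * sqrt (\<delta> n) + C * B\<^sup>2 * \<delta> n + 8 * L * sqrt (\<delta> n) + 4 * L * B^3 * (\<delta> n)\<^sup>2)"
      by (rule S(2))
  qed
  have DE: "D n i \<omega> + E n i \<omega> = (if i < j n \<omega> then \<phi> (Z (t n (Suc i)) \<omega>) - \<phi> (Z (t n i) \<omega>) else 0)"
    if \<omega>: "\<omega> \<in> space M" for n i \<omega>
  proof (cases "i < j n \<omega>")
    case True
    then have "t n i \<le> \<eta> \<omega>" using j[OF \<omega>, of n i] by simp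
    then have ZRi: "Z (t n i) \<omega> = R (t n i) \<omega>" by (rule ZR[OF \<omega> t_nn])
    have "R (t n i) \<omega> + (W (t n i + \<delta> n) \<omega> - W (t n i) \<omega>) + (J b (t n i + \<delta> n) \<omega> - J b (t n i) \<omega>) = Z (t n (Suc i)) \<omega>"
      unfolding ZRi[symmetric] t_Suc by (simp add: Z_def)
    then show ?thesis using True Aj[OF \<omega>] by (simp add: D_def E_def ZRi)
  qed (use Aj[OF \<omega>] in \<open>simp add: D_def E_def\<close>)
  define X where "X n \<omega> = \<phi> x + (\<Sum>i<Suc n. D n i \<omega>) + (\<Sum>i<Suc n. E n i \<omega>)" for n \<omega>
  have X: "X n \<omega> = \<phi> (Z (t n (j n \<omega>)) \<omega>)" if \<omega>: "\<omega> \<in> space M" for n \<omega>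
  proof -
    have "(\<Sum>i<Suc n. D n i \<omega>) + (\<Sum>i<Suc n. E n i \<omega>) = (\<Sum>i<Suc n. if i < j n \<omega> then \<phi> (Z (t n (Suc i)) \<omega>) - \<phi> (Z (t n i) \<omega>) else 0)"
      by (simp only: sum.distrib[symmetric] DE[OF \<omega>])
    also have "\<dots> = (\<Sum>i<j n \<omega>. \<phi> (Z (t n (Suc i)) \<omega>) - \<phi> (Z (t n i) \<omega>))"
      using jn[OF \<omega>, of n] by (intro sum.mono_neutral_cong_right) auto
    also have "\<dots> = \<phi> (Z (t n (j n \<omega>)) \<omega>) - \<phi> (Z (t n 0) \<omega>)"
      by (rule sum_lessThan_telescope[of "\<lambda>i. \<phi> (Z (t n i) \<omega>)"])
    finally show ?thesis by (simp add: X_def t0 Z_0[OF \<omega>])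
  qed
  have Xlim: "(\<lambda>n. X n \<omega>) \<longlonglongrightarrow> \<phi> (R (\<eta> \<omega>) \<omega>)" if \<omega>: "\<omega> \<in> space M" for \<omega>
  proof -
    have nn: "\<eta> \<omega> \<in> {0..}" using \<eta>[OF \<omega>] by simp
    \<comment> \<open>The rounded time may exceed \<open>\<eta>\<close>, where \<open>Z\<close> and
      \<open>R\<close> can differ. Continuity of \<open>Z\<close> brings the limit back to
      \<open>\<eta>\<close>, where they agree.\<close>
    have "(\<lambda>n. Z (t n (j n \<omega>)) \<omega>) \<longlonglongrightarrow> Z (\<eta> \<omega>) \<omega>"
      using Z_continuous[OF \<omega>, unfolded continuous_on_sequentially] nn \<rho>[OF \<omega>] t_nn by (auto simp: comp_def)
    moreover have "isCont \<phi> (Z (\<eta> \<omega>) \<omega>)" using d1 by (rule DERIV_isCont)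
    ultimately have "(\<lambda>n. \<phi> (Z (t n (j n \<omega>)) \<omega>)) \<longlonglongrightarrow> \<phi> (Z (\<eta> \<omega>) \<omega>)" by (rule isCont_tendsto_compose[rotated])
    then show ?thesis using ZR[OF \<omega>, of "\<eta> \<omega>"] nn by (simp add: X[OF \<omega>])
  qed
  have Eb: "\<bar>E n i \<omega>\<bar> \<le> G' * \<delta> n" if \<omega>: "\<omega> \<in> space M" for n i \<omega>
  proof -
    define z where "z = J b (t n i + \<delta> n) \<omega> - J b (t n i) \<omega>"
    have z: "\<bar>z\<bar> \<le> B * \<delta> n" using J_lipschitz[OF b_cont b_bound \<omega> t_nn, of n i "t n i + \<delta> n"] \<delta>[of n] by (simp add: z_def)
    note Cr = C[OF R_range[OF t_nn \<omega>]]
    have "\<bar>\<phi>' (R (t n i) \<omega>) * z\<bar> \<le> C * (B * \<delta> n)" unfolding abs_mult using Cr z C_nn by (intro mult_mono) auto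
    moreover have "\<bar>\<phi>'' (R (t n i) \<omega>) / 2 * \<delta> n\<bar> \<le> C * \<delta> n"
      unfolding abs_mult using Cr(2)[of n i] \<delta>[of n] C_nn by (intro mult_mono) auto
    ultimately have "\<bar>\<phi>' (R (t n i) \<omega>) * z + \<phi>'' (R (t n i) \<omega>) / 2 * \<delta> n\<bar> \<le> G' * \<delta> n"
      unfolding G'_def by (simp add: algebra_simps)
    then show ?thesis using G'_nn \<delta>[of n] unfolding E_def z_def[symmetric] by (simp add: indicator_def)
  qed
  define Y where "Y n \<omega> = (\<Sum>i<Suc n. E n i \<omega>)" for n \<omega>
  have Yb: "\<bar>Y n \<omega>\<bar> \<le> G' * T" if \<omega>: "\<omega> \<in> space M" for n \<omega>
  proof -
    have "\<bar>Y n \<omega>\<bar> \<le> (\<Sum>i<Suc n. \<bar>E n i \<omega>\<bar>)" unfolding Y_def by (rule sum_abs)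
    also have "\<dots> \<le> (\<Sum>i<Suc n. G' * \<delta> n)" by (intro sum_mono Eb \<omega>)
    also have "\<dots> = G' * T" by (simp add: \<delta>_def field_simps)
    finally show ?thesis .
  qed
  have [measurable]: "R (t n i) \<in> borel_measurable M" "J b (t n i) \<in> borel_measurable M" "J b (t n i + \<delta> n) \<in> borel_measurable M" for n i
    using R_meas[OF t_nn] J_measurable[OF b_cont] by auto
  have [measurable]: "E n i \<in> borel_measurable M" for n i
    unfolding E_def[abs_def] by measurable
  have [measurable]: "D n i \<in> borel_measurable M" for n i using D(1) by (rule borel_measurable_integrable)
  have [measurable]: "Y n \<in> borel_measurable M" "X n \<in> borel_measurable M" for n
    unfolding Y_def[abs_def] X_def[abs_def] by measurable
  have Ylim: "(\<lambda>n. Y n \<omega>) \<longlonglongrightarrow> J g (\<eta> \<omega>) \<omega>" if \<omega>: "\<omega> \<in> space M" for \<omega>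
  proof -
    have Jlim: "(\<lambda>n. J g (t n (j n \<omega>)) \<omega>) \<longlonglongrightarrow> J g (\<eta> \<omega>) \<omega>"
    proof (rule LIM_zero_cancel, rule Lim_null_comparison)
      show "(\<lambda>n. G' * \<delta> n) \<longlonglongrightarrow> 0" using tendsto_mult_right_zero[OF \<delta>0] by blast
      show "\<forall>\<^sub>F n in sequentially. norm (J g (t n (j n \<omega>)) \<omega> - J g (\<eta> \<omega>) \<omega>) \<le> G' * \<delta> n"
      proof (rule always_eventually, rule allI)
        fix n
        have "norm (J g (t n (j n \<omega>)) \<omega> - J g (\<eta> \<omega>) \<omega>) \<le> G' * (t n (j n \<omega>) - \<eta> \<omega>)"
          using J_lipschitz[OF cg gb \<omega>, of "\<eta> \<omega>" "t n (j n \<omega>)"] \<eta>[OF \<omega>] tj[OF \<omega>] by (simp add: G'_def)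
        also have "\<dots> \<le> G' * \<delta> n" using tj(2)[OF \<omega>, of n] G'_nn by (intro mult_left_mono) auto
        finally show "norm (J g (t n (j n \<omega>)) \<omega> - J g (\<eta> \<omega>) \<omega>) \<le> G' * \<delta> n" .
      qed
    qed
    have "(\<lambda>n. Y n \<omega> - J g (t n (j n \<omega>)) \<omega>) \<longlonglongrightarrow> 0"
    proof (rule LIMSEQ_I)
      fix \<epsilon> :: real assume \<epsilon>: "0 < \<epsilon>"
      \<comment> \<open>If the derivatives oscillate by at most \<open>\<epsilon>'\<close> on a
        cell, the error there is at most \<open>\<epsilon>' * (B + 1) * \<delta> n\<close>. The
        active cells have total length at most \<open>T\<close>, which leaves
        \<open>\<epsilon> / 2\<close>.\<close>
      define \<epsilon>' where "\<epsilon>' = \<epsilon> / (2 * T * (B + 1))"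
      have \<epsilon>': "0 < \<epsilon>'" using \<epsilon> T B_nonneg by (simp add: \<epsilon>'_def)
      have "uniformly_continuous_on {0..T} (\<lambda>s. \<phi>' (R s \<omega>))" "uniformly_continuous_on {0..T} (\<lambda>s. \<phi>'' (R s \<omega>))"
        by (rule compact_uniformly_continuous[OF continuous_on_subset[OF continuous_on_gR[OF c\<phi>(2) \<omega>]]]
                 compact_uniformly_continuous[OF continuous_on_subset[OF continuous_on_gR[OF c\<phi>(3) \<omega>]]]; simp)+
      then obtain d1 d2 where dd: "0 < d1" "0 < d2"
        "\<And>s u. s \<in> {0..T} \<Longrightarrow> u \<in> {0..T} \<Longrightarrow> dist u s < d1 \<Longrightarrow> dist (\<phi>' (R u \<omega>)) (\<phi>' (R s \<omega>)) < \<epsilon>'"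
        "\<And>s u. s \<in> {0..T} \<Longrightarrow> u \<in> {0..T} \<Longrightarrow> dist u s < d2 \<Longrightarrow> dist (\<phi>'' (R u \<omega>)) (\<phi>'' (R s \<omega>)) < \<epsilon>'"
        unfolding uniformly_continuous_on_def using \<epsilon>' by metis
      obtain N where N: "\<And>n. N \<le> n \<Longrightarrow> \<delta> n < min d1 d2"
        using order_tendstoD(2)[OF \<delta>0, of "min d1 d2"] dd(1,2) by (auto simp: eventually_sequentially)
      have "norm (Y n \<omega> - J g (t n (j n \<omega>)) \<omega> - 0) < \<epsilon>" if n: "N \<le> n" for n
      proof -
        have e: "\<bar>(\<phi>' (R (t n i) \<omega>) * (J b (t n (Suc i)) \<omega> - J b (t n i) \<omega>) + \<phi>'' (R (t n i) \<omega>) / 2 * \<delta> n) - (J g (t n (Suc i)) \<omega> - J g (t n i) \<omega>)\<bar>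
            \<le> (\<epsilon>' * (B + 1)) * \<delta> n" if i: "i < j n \<omega>" for i
        proof -
          let ?I = "{t n i..t n (Suc i)}"
          have le: "t n i \<le> t n (Suc i)" using \<delta>[of n] by (simp add: t_Suc)
          have leT: "t n (Suc i) \<le> T"
          proof -
            have "t n (Suc i) \<le> t n (Suc n)" using i jn[OF \<omega>, of n] T unfolding t_def by (intro divide_right_mono mult_right_mono) auto
            then show ?thesis by (simp add: tn)
          qed
          note [simp] = gR_integrable[OF b_cont \<omega> t_nn] gR_integrable[OF cg \<omega> t_nn]
          define c1 c2 where "c1 = \<phi>' (R (t n i) \<omega>)" and "c2 = \<phi>'' (R (t n i) \<omega>) / 2"
          have sc: "set_integrable lborel ?I (\<lambda>u. c2)" by (intro borel_integrable_atLeastAtMost' continuous_on_const)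
          have "(c1 * (J b (t n (Suc i)) \<omega> - J b (t n i) \<omega>) + c2 * \<delta> n) - (J g (t n (Suc i)) \<omega> - J g (t n i) \<omega>)
            = (LBINT u:?I. c1 * b (R u \<omega>) + c2 - g (R u \<omega>))"
            unfolding J_diff[OF b_cont \<omega> t_nn le] J_diff[OF cg \<omega> t_nn le]
            using le sc by (simp add: set_integral_diff set_integral_add set_integral_const t_Suc)
          also have "\<bar>\<dots>\<bar> \<le> (\<epsilon>' * (B + 1)) * (t n (Suc i) - t n i)"
          proof (rule set_integral_le_const)
            show "set_integrable lborel ?I (\<lambda>u. c1 * b (R u \<omega>) + c2 - g (R u \<omega>))"
              using sc by (intro set_integral_diff set_integral_add set_integrable_mult_right) auto
            fix u assume u: "u \<in> ?I"
            have du: "dist (t n i) u < min d1 d2" using u N[OF n] by (auto simp: dist_real_def t_Suc)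
            have uT: "u \<in> {0..T}" "t n i \<in> {0..T}" using u t_nn[of n i] leT by auto
            have 1: "\<bar>c1 - \<phi>' (R u \<omega>)\<bar> \<le> \<epsilon>'" "\<bar>\<phi>'' (R (t n i) \<omega>) - \<phi>'' (R u \<omega>)\<bar> \<le> \<epsilon>'"
              using dd(3)[OF uT] dd(4)[OF uT] du by (auto simp: dist_real_def c1_def)
            have "\<bar>(c1 - \<phi>' (R u \<omega>)) * b (R u \<omega>)\<bar> \<le> \<epsilon>' * B"
              unfolding abs_mult using 1 b_bound[of "R u \<omega>"] \<epsilon>' by (intro mult_mono) auto
            moreover have "\<bar>c2 - \<phi>'' (R u \<omega>) / 2\<bar> \<le> \<epsilon>'" using 1(2) \<epsilon>' unfolding c2_def by linarith
            moreover have "c1 * b (R u \<omega>) + c2 - g (R u \<omega>) = (c1 - \<phi>' (R u \<omega>)) * b (R u \<omega>) + (c2 - \<phi>'' (R u \<omega>) / 2)"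
              by (simp add: g_def algebra_simps)
            ultimately show "\<bar>c1 * b (R u \<omega>) + c2 - g (R u \<omega>)\<bar> \<le> \<epsilon>' * (B + 1)" by (simp add: distrib_left)
          qed (rule le)
          finally show ?thesis by (simp add: c1_def c2_def t_Suc)
        qed
        have Ysum: "Y n \<omega> = (\<Sum>i<j n \<omega>. \<phi>' (R (t n i) \<omega>) * (J b (t n (Suc i)) \<omega> - J b (t n i) \<omega>) + \<phi>'' (R (t n i) \<omega>) / 2 * \<delta> n)"
          unfolding Y_def E_def t_Suc using jn[OF \<omega>, of n] Aj[OF \<omega>]
          by (intro sum.mono_neutral_cong_right) (auto simp: indicator_def)
        have Jsum: "J g (t n (j n \<omega>)) \<omega> = (\<Sum>i<j n \<omega>. J g (t n (Suc i)) \<omega> - J g (t n i) \<omega>)"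
          unfolding sum_lessThan_telescope[of "\<lambda>i. J g (t n i) \<omega>"] by (simp add: t0 J_0[OF \<omega>])
        have "\<bar>Y n \<omega> - J g (t n (j n \<omega>)) \<omega>\<bar> \<le> (\<Sum>i<j n \<omega>. (\<epsilon>' * (B + 1)) * \<delta> n)"
          unfolding Ysum Jsum sum_subtractf[symmetric] by (rule order_trans[OF sum_abs sum_mono]) (use e in auto)
        also have "\<dots> = (\<epsilon>' * (B + 1)) * (real (j n \<omega>) * \<delta> n)" by simp
        also have "\<dots> \<le> (\<epsilon>' * (B + 1)) * T"
          using tj(3)[OF \<omega>, of n] \<epsilon>' B_nonneg by (intro mult_left_mono) (auto simp: t_def \<delta>_def)
        also have "\<dots> = \<epsilon> / 2" using T B_nonneg by (simp add: \<epsilon>'_def)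
        also have "\<dots> < \<epsilon>" using \<epsilon> by simp
        finally show ?thesis by simp
      qed
      then show "\<exists>N. \<forall>n\<ge>N. norm (Y n \<omega> - J g (t n (j n \<omega>)) \<omega> - 0) < \<epsilon>" by blast
    qed
    from tendsto_add[OF this Jlim] show ?thesis by simp
  qed
  show m1: "(\<lambda>\<omega>. \<phi> (R (\<eta> \<omega>) \<omega>)) \<in> borel_measurable M"
    by (rule borel_measurable_LIMSEQ_real[OF Xlim]) measurable
  have m2: "(\<lambda>\<omega>. J g (\<eta> \<omega>) \<omega>) \<in> borel_measurable M"
    by (rule borel_measurable_LIMSEQ_real[OF Ylim]) measurable
  then show "(\<lambda>\<omega>. J (\<lambda>y. \<phi>'' y / 2 + b y * \<phi>' y) (\<eta> \<omega>) \<omega>) \<in> borel_measurable M" by (simp add: g_def[abs_def])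
  have iY: "integrable M (Y n)" for n by (rule integrable_const_bound[where B="G' * T"]) (use Yb in auto)
  have EY: "(\<lambda>n. expectation (Y n)) \<longlonglongrightarrow> expectation (\<lambda>\<omega>. J g (\<eta> \<omega>) \<omega>)"
    by (rule integral_dominated_convergence[where w="\<lambda>_. G' * T"]) (use Ylim Yb m2 in auto)
  have iX: "integrable M (X n)" for n
    unfolding X_def[abs_def]
    by (rule Bochner_Integration.integrable_add[OF Bochner_Integration.integrable_add iY[of n, unfolded Y_def[abs_def]]])
      (simp_all add: D(1))
  \<comment> \<open>There are \<open>n + 1\<close> steps of length \<open>T / (n + 1)\<close>, each
    contributing at most \<open>\<delta> n * err n\<close>. Hence it is enough that
    \<open>err\<close> tends to 0.\<close>
  have ED: "(\<lambda>n. expectation (\<lambda>\<omega>. \<Sum>i<Suc n. D n i \<omega>)) \<longlonglongrightarrow> 0"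
  proof (rule Lim_null_comparison)
    have "err \<longlonglongrightarrow> C * B * sqrt 0 + C * B\<^sup>2 * 0 + 8 * L * sqrt 0 + 4 * L * B^3 * 0\<^sup>2"
      unfolding err_def by (intro tendsto_intros \<delta>0)
    then show "(\<lambda>n. T * err n) \<longlonglongrightarrow> 0" using tendsto_mult_right_zero[of err sequentially T] by simp
    show "\<forall>\<^sub>F n in sequentially. norm (expectation (\<lambda>\<omega>. \<Sum>i<Suc n. D n i \<omega>)) \<le> T * err n"
    proof (rule always_eventually, rule allI)
      fix n
      have "expectation (\<lambda>\<omega>. \<Sum>i<Suc n. D n i \<omega>) = (\<Sum>i<Suc n. expectation (D n i))"
        by (rule Bochner_Integration.integral_sum) (rule D(1))
      also have "norm \<dots> \<le> (\<Sum>i<Suc n. \<delta> n * err n)"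
        unfolding real_norm_def by (rule order_trans[OF sum_abs sum_mono]) (rule D(2))
      also have "\<dots> = T * err n" by (simp add: \<delta>_def field_simps)
      finally show "norm (expectation (\<lambda>\<omega>. \<Sum>i<Suc n. D n i \<omega>)) \<le> T * err n" .
    qed
  qed
  have EX: "expectation (X n) = \<phi> x + expectation (\<lambda>\<omega>. \<Sum>i<Suc n. D n i \<omega>) + expectation (Y n)" for n
  proof -
    have "expectation (X n) = expectation (\<lambda>\<omega>. \<phi> x + (\<Sum>i<Suc n. D n i \<omega>) + Y n \<omega>)" by (simp add: X_def[abs_def] Y_def)
    also have "\<dots> = \<phi> x + expectation (\<lambda>\<omega>. \<Sum>i<Suc n. D n i \<omega>) + expectation (Y n)"
      using D(1) iY by (simp add: prob_space del: sum.lessThan_Suc)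
    finally show ?thesis .
  qed
  have EXlim: "(\<lambda>n. expectation (X n)) \<longlonglongrightarrow> \<phi> x + expectation (\<lambda>\<omega>. J g (\<eta> \<omega>) \<omega>)"
    unfolding EX using tendsto_add[OF tendsto_add[OF tendsto_const ED] EY] by simp
  have low: "0 \<le> \<phi> z + C0" for z using lower[of z] by linarith
  have Xlow: "0 \<le> X n \<omega> + C0" if "\<omega> \<in> space M" for n \<omega> using low by (simp add: X[OF that])
  have b\<phi>: "bounded (\<phi> ` {lo..hi})"
    using c\<phi> by (auto intro!: compact_imp_bounded compact_continuous_image intro: continuous_on_subset)
  then obtain C3 where C3: "\<And>y. y \<in> {lo..hi} \<Longrightarrow> \<bar>\<phi> y\<bar> \<le> C3" unfolding bounded_iff real_norm_def by blast
  have i\<phi>: "integrable M (\<lambda>\<omega>. \<phi> (R (\<eta> \<omega>) \<omega>))"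
    by (rule integrable_const_bound[where B=C3]) (use C3 R_range \<eta> m1 in auto)
  \<comment> \<open>Between \<open>\<eta>\<close> and the next grid point \<open>Z\<close> may leave
    \<open>{lo..hi}\<close>, and there \<open>\<phi>\<close> has no upper bound. The shift by
    \<open>C0\<close> makes the variables nonnegative, so that Fatou's lemma can replace dominated
    convergence.\<close>
  have "ennreal (expectation (\<lambda>\<omega>. \<phi> (R (\<eta> \<omega>) \<omega>) + C0)) = (\<integral>\<^sup>+ \<omega>. ennreal (\<phi> (R (\<eta> \<omega>) \<omega>) + C0) \<partial>M)"
    by (rule nn_integral_eq_integral[symmetric]) (use i\<phi> low in auto)
  also have "\<dots> = (\<integral>\<^sup>+ \<omega>. liminf (\<lambda>n. ennreal (X n \<omega> + C0)) \<partial>M)"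
  proof (rule nn_integral_cong)
    fix \<omega> assume \<omega>: "\<omega> \<in> space M"
    have "(\<lambda>n. ennreal (X n \<omega> + C0)) \<longlonglongrightarrow> ennreal (\<phi> (R (\<eta> \<omega>) \<omega>) + C0)"
      by (intro tendsto_ennrealI tendsto_add Xlim[OF \<omega>] tendsto_const)
    from lim_imp_Liminf[OF _ this] show "ennreal (\<phi> (R (\<eta> \<omega>) \<omega>) + C0) = liminf (\<lambda>n. ennreal (X n \<omega> + C0))" by simp
  qed
  also have "\<dots> \<le> liminf (\<lambda>n. \<integral>\<^sup>+ \<omega>. ennreal (X n \<omega> + C0) \<partial>M)" by (rule nn_integral_liminf) measurable
  also have "(\<lambda>n. \<integral>\<^sup>+ \<omega>. ennreal (X n \<omega> + C0) \<partial>M) = (\<lambda>n. ennreal (expectation (X n) + C0))"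
  proof
    fix n
    have "(\<integral>\<^sup>+ \<omega>. ennreal (X n \<omega> + C0) \<partial>M) = ennreal (expectation (\<lambda>\<omega>. X n \<omega> + C0))"
    proof (rule nn_integral_eq_integral)
      show "AE \<omega> in M. 0 \<le> X n \<omega> + C0" using Xlow by (intro AE_I2)
    qed (use iX in auto)
    then show "(\<integral>\<^sup>+ \<omega>. ennreal (X n \<omega> + C0) \<partial>M) = ennreal (expectation (X n) + C0)" using iX by (simp add: prob_space)
  qed
  also have "liminf \<dots> = ennreal (\<phi> x + expectation (\<lambda>\<omega>. J g (\<eta> \<omega>) \<omega>) + C0)"
    by (rule lim_imp_Liminf) (auto intro!: tendsto_ennrealI tendsto_add EXlim)
  finally have *: "ennreal (expectation (\<lambda>\<omega>. \<phi> (R (\<eta> \<omega>) \<omega>) + C0)) \<le> ennreal (\<phi> x + expectation (\<lambda>\<omega>. J g (\<eta> \<omega>) \<omega>) + C0)" .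
  \<comment> \<open>\<open>ennreal\<close> sends negative numbers to 0. The inequality returns to
    the reals only once its right side is known to be nonnegative.\<close>
  have "0 \<le> \<phi> x + expectation (\<lambda>\<omega>. J g (\<eta> \<omega>) \<omega>) + C0"
  proof (rule LIMSEQ_le_const)
    show "(\<lambda>n. expectation (X n) + C0) \<longlonglongrightarrow> \<phi> x + expectation (\<lambda>\<omega>. J g (\<eta> \<omega>) \<omega>) + C0"
      by (intro tendsto_add EXlim tendsto_const)
    have "0 \<le> expectation (\<lambda>\<omega>. X n \<omega> + C0)" for n
      by (rule integral_nonneg_AE) (use Xlow in auto)
    then show "\<exists>N. \<forall>n\<ge>N. 0 \<le> expectation (X n) + C0" using iX by (simp add: prob_space)
  qed
  with * have "expectation (\<lambda>\<omega>. \<phi> (R (\<eta> \<omega>) \<omega>) + C0) \<le> \<phi> x + expectation (\<lambda>\<omega>. J g (\<eta> \<omega>) \<omega>) + C0"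
    by (simp add: ennreal_le_iff)
  then show "expectation (\<lambda>\<omega>. \<phi> (R (\<eta> \<omega>) \<omega>)) \<le> \<phi> x + expectation (\<lambda>\<omega>. J (\<lambda>y. \<phi>'' y / 2 + b y * \<phi>' y) (\<eta> \<omega>) \<omega>)"
    using i\<phi> by (simp add: prob_space g_def[abs_def])
qed

end


subsection \<open>Lyapunov functions and Gronwall's lemma\<close>

definition clamp_to :: "real \<Rightarrow> real \<Rightarrow> real \<Rightarrow> real" where
  "clamp_to lo hi z = max lo (min hi z)"

lemma clamp_to_in: "lo \<le> hi \<Longrightarrow> clamp_to lo hi z \<in> {lo..hi}"
  by (simp add: clamp_to_def)

lemma clamp_to_id: "z \<in> {lo..hi} \<Longrightarrow> clamp_to lo hi z = z"
  by (simp add: clamp_to_def)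

lemma clamp_to_dist: "\<bar>clamp_to lo hi u - clamp_to lo hi v\<bar> \<le> \<bar>u - v\<bar>"
  by (auto simp: clamp_to_def max_def min_def)

lemma continuous_on_clamp_to: "continuous_on A (clamp_to lo hi)"
  unfolding clamp_to_def by (intro continuous_intros)

lemma continuous_on_compose_clamp:
  assumes "lo \<le> hi" "continuous_on {lo..hi} f"
  shows "continuous_on UNIV (\<lambda>z. f (clamp_to lo hi z))"
  by (rule continuous_on_compose2[OF assms(2) continuous_on_clamp_to]) (use clamp_to_in[OF assms(1)] in auto)

lemma antiderivative_UNIV:
  fixes f :: "real \<Rightarrow> real"
  assumes "continuous_on UNIV f"
  obtains F where "\<And>z. (F has_real_derivative f z) (at z)"
proof -
  have "\<exists>F. \<forall>x. -\<infinity> < ereal x \<longrightarrow> ereal x < \<infinity> \<longrightarrow> (F has_vector_derivative f x) (at x)"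
    by (rule einterval_antiderivative) (use assms in \<open>auto simp: continuous_on_eq_continuous_at\<close>)
  then show ?thesis using that by (auto simp: has_real_derivative_iff_has_vector_derivative)
qed

lemma eq_of_derivatives_eq:
  fixes f g :: "real \<Rightarrow> real"
  assumes "\<And>z. z \<in> {lo..hi} \<Longrightarrow> (f has_real_derivative f' z) (at z)"
    "\<And>z. z \<in> {lo..hi} \<Longrightarrow> (g has_real_derivative f' z) (at z)" "f lo = g lo" "z \<in> {lo..hi}"
  shows "f z = g z"
proof (cases "z = lo")
  case False
  have "(\<lambda>y. f y - g y) z = (\<lambda>y. f y - g y) lo"
  proof (rule DERIV_isconst2[of lo z])
    show d: "((\<lambda>y. f y - g y) has_real_derivative 0) (at y)" if "lo < y" "y < z" for y
      using DERIV_diff[OF assms(1,2)[of y]] that assms(4) by auto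
    show "continuous_on {lo..z} (\<lambda>y. f y - g y)"
    proof (rule continuous_on_diff)
      show "continuous_on {lo..z} f"
        by (rule DERIV_continuous_on, rule has_field_derivative_at_within, rule assms(1)) (use assms(4) in auto)
      show "continuous_on {lo..z} g"
        by (rule DERIV_continuous_on, rule has_field_derivative_at_within, rule assms(2)) (use assms(4) in auto)
    qed
  qed (use False assms in auto)
  then show ?thesis using assms(3) by simp
qed (use assms in simp)

text \<open>The extension is convex far away from \<open>[lo,hi]\<close>, hence bounded below.\<close>

lemma C2_extension:
  fixes \<phi> \<phi>' \<phi>'' :: "real \<Rightarrow> real"
  assumes lohi: "lo \<le> hi"
    and d1: "\<And>z. z \<in> {lo..hi} \<Longrightarrow> (\<phi> has_real_derivative \<phi>' z) (at z)"
    and d2: "\<And>z. z \<in> {lo..hi} \<Longrightarrow> (\<phi>' has_real_derivative \<phi>'' z) (at z)"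
    and lip: "L-lipschitz_on {lo..hi} \<phi>''"
  obtains \<psi> \<psi>' \<psi>'' L' C0 where
    "\<And>z. (\<psi> has_real_derivative \<psi>' z) (at z)" "\<And>z. (\<psi>' has_real_derivative \<psi>'' z) (at z)"
    "L'-lipschitz_on UNIV \<psi>''" "\<And>z. - C0 \<le> \<psi> z"
    "\<And>z. z \<in> {lo..hi} \<Longrightarrow> \<psi> z = \<phi> z" "\<And>z. z \<in> {lo..hi} \<Longrightarrow> \<psi>' z = \<phi>' z"
    "\<And>z. z \<in> {lo..hi} \<Longrightarrow> \<psi>'' z = \<phi>'' z"
proof -
  let ?k = "clamp_to lo hi"
  have L: "0 \<le> L" using lip by (rule lipschitz_on_nonneg)
  \<comment> \<open>Continuing \<open>\<phi>''\<close> by constants could leave it negative for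
    ever. The added distance to the interval vanishes inside, is Lipschitz, and eventually
    dominates.\<close>
  define \<psi>'' where "\<psi>'' z = \<phi>'' (?k z) + \<bar>z - ?k z\<bar>" for z
  have lip'': "(L + 2)-lipschitz_on UNIV \<psi>''"
  proof (rule lipschitz_onI)
    fix u v :: real
    have "\<bar>\<phi>'' (?k u) - \<phi>'' (?k v)\<bar> \<le> L * \<bar>?k u - ?k v\<bar>"
      using lipschitz_onD[OF lip clamp_to_in[OF lohi] clamp_to_in[OF lohi], of u v] by (simp add: dist_real_def)
    also have "\<dots> \<le> L * \<bar>u - v\<bar>" by (intro mult_left_mono clamp_to_dist L)
    finally have *: "\<bar>\<phi>'' (?k u) - \<phi>'' (?k v)\<bar> \<le> L * \<bar>u - v\<bar>" .
    have "\<bar>\<psi>'' u - \<psi>'' v\<bar> \<le> L * \<bar>u - v\<bar> + 2 * \<bar>u - v\<bar>"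
    proof -
      have "\<bar>\<psi>'' u - \<psi>'' v\<bar> \<le> \<bar>\<phi>'' (?k u) - \<phi>'' (?k v)\<bar> + \<bar>(u - ?k u) - (v - ?k v)\<bar>"
        unfolding \<psi>''_def by linarith
      moreover have "\<bar>(u - ?k u) - (v - ?k v)\<bar> \<le> \<bar>u - v\<bar> + \<bar>?k u - ?k v\<bar>" by linarith
      ultimately show ?thesis using clamp_to_dist[of lo hi u v] * by linarith
    qed
    then show "dist (\<psi>'' u) (\<psi>'' v) \<le> (L + 2) * dist u v" by (simp add: dist_real_def algebra_simps)
  qed (use L in simp)
  obtain F1 where F1: "\<And>z. (F1 has_real_derivative \<psi>'' z) (at z)"
    using antiderivative_UNIV[OF lipschitz_on_continuous_on[OF lip'']] by blast
  define \<psi>' where "\<psi>' z = F1 z - F1 lo + \<phi>' lo" for z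
  have \<psi>': "(\<psi>' has_real_derivative \<psi>'' z) (at z)" for z
    unfolding \<psi>'_def[abs_def] by (auto intro!: derivative_eq_intros F1)
  obtain F2 where F2: "\<And>z. (F2 has_real_derivative \<psi>' z) (at z)"
    using antiderivative_UNIV[OF DERIV_continuous_on[OF has_field_derivative_at_within[OF \<psi>']]] by blast
  define \<psi> where "\<psi> z = F2 z - F2 lo + \<phi> lo" for z
  have \<psi>: "(\<psi> has_real_derivative \<psi>' z) (at z)" for z
    unfolding \<psi>_def[abs_def] by (auto intro!: derivative_eq_intros F2)
  have e2: "\<psi>'' z = \<phi>'' z" if "z \<in> {lo..hi}" for z using clamp_to_id[OF that] by (simp add: \<psi>''_def)
  have e1: "\<psi>' z = \<phi>' z" if "z \<in> {lo..hi}" for z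
  proof (rule eq_of_derivatives_eq[OF _ d2 _ that])
    show "(\<psi>' has_real_derivative \<phi>'' y) (at y)" if "y \<in> {lo..hi}" for y using \<psi>'[of y] e2[OF that] by simp
    show "\<psi>' lo = \<phi>' lo" unfolding \<psi>'_def by simp
  qed
  have e0: "\<psi> z = \<phi> z" if "z \<in> {lo..hi}" for z
  proof (rule eq_of_derivatives_eq[OF _ d1 _ that])
    show "(\<psi> has_real_derivative \<phi>' y) (at y)" if "y \<in> {lo..hi}" for y using \<psi>[of y] e1[OF that] by simp
    show "\<psi> lo = \<phi> lo" unfolding \<psi>_def by simp
  qed
  have "bounded (\<phi>'' ` {lo..hi})"
    by (intro compact_imp_bounded compact_continuous_image lipschitz_on_continuous_on[OF lip]) simp
  then obtain C where "\<And>y. y \<in> {lo..hi} \<Longrightarrow> \<bar>\<phi>'' y\<bar> \<le> C" unfolding bounded_iff real_norm_def by blast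
  then have C: "\<bar>\<phi>'' (?k z)\<bar> \<le> C" for z using clamp_to_in[OF lohi] by blast
  \<comment> \<open>Beyond \<open>hi + C + 1\<close> the distance term exceeds \<open>C\<close> by
    at least 1, so \<open>\<psi>''\<close> is at least 1. From there \<open>\<psi>'\<close> gains at
    least unit slope and is nonnegative after a further length \<bar>\<psi>' b1\<bar>. The left side
    is symmetric.\<close>
  define b1 b2 where "b1 = hi + C + 1" and "b2 = b1 + \<bar>\<psi>' b1\<bar>"
  define a1 a2 where "a1 = lo - C - 1" and "a2 = a1 - \<bar>\<psi>' a1\<bar>"
  have C_nn: "0 \<le> C" using C[of 0] by simp
  have b: "1 \<le> \<psi>'' z" if "b1 \<le> z" for z
    using C[of z] that C_nn lohi by (simp add: \<psi>''_def b1_def clamp_to_def)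
  have a: "1 \<le> \<psi>'' z" if "z \<le> a1" for z
    using C[of z] that C_nn lohi by (simp add: \<psi>''_def a1_def clamp_to_def max_def min_def split: if_splits)
  have b': "0 \<le> \<psi>' z" if "b2 \<le> z" for z
  proof -
    have "\<psi>' b1 - b1 \<le> \<psi>' z - z"
    proof (rule DERIV_nonneg_imp_nondecreasing[where f="\<lambda>z. \<psi>' z - z"])
      show "b1 \<le> z" using that by (simp add: b2_def)
      show "\<exists>y. ((\<lambda>z. \<psi>' z - z) has_real_derivative y) (at u) \<and> 0 \<le> y" if "b1 \<le> u" for u
        using b[OF that] by (intro exI[of _ "\<psi>'' u - 1"]) (auto intro!: derivative_eq_intros \<psi>')
    qed
    then show ?thesis using that unfolding b2_def by linarith
  qed
  have a': "\<psi>' z \<le> 0" if "z \<le> a2" for z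
  proof -
    have "\<psi>' z - z \<le> \<psi>' a1 - a1"
    proof (rule DERIV_nonneg_imp_nondecreasing[where f="\<lambda>z. \<psi>' z - z"])
      show "z \<le> a1" using that by (simp add: a2_def)
      show "\<exists>y. ((\<lambda>z. \<psi>' z - z) has_real_derivative y) (at u) \<and> 0 \<le> y" if "u \<le> a1" for u
        using a[OF that] by (intro exI[of _ "\<psi>'' u - 1"]) (auto intro!: derivative_eq_intros \<psi>')
    qed
    then show ?thesis using that unfolding a2_def by linarith
  qed
  have "bounded (\<psi> ` {a2..b2})"
    by (intro compact_imp_bounded compact_continuous_image DERIV_continuous_on[OF has_field_derivative_at_within[OF \<psi>]]) simp
  then obtain C0 where C0: "\<And>y. y \<in> {a2..b2} \<Longrightarrow> \<bar>\<psi> y\<bar> \<le> C0" unfolding bounded_iff real_norm_def by blast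
  have ab: "a2 \<le> b2" using C_nn lohi by (simp add: a2_def b2_def a1_def b1_def)
  have "- C0 \<le> \<psi> z" for z
  proof -
    consider "z \<in> {a2..b2}" | "b2 \<le> z" | "z \<le> a2" by fastforce
    then show ?thesis
    proof cases
      case 1 then show ?thesis using C0 by fastforce
    next
      case 2
      have "\<psi> b2 \<le> \<psi> z" by (rule DERIV_nonneg_imp_nondecreasing[OF 2]) (use \<psi> b' in blast)
      then show ?thesis using C0[of b2] ab by simp
    next
      case 3
      have "\<psi> a2 \<le> \<psi> z" by (rule DERIV_nonpos_imp_nonincreasing[OF 3]) (use \<psi> a' in blast)
      then show ?thesis using C0[of a2] ab by simp
    qed
  qed
  from that[OF \<psi> \<psi>' lip'' this e0 e1 e2] show ?thesis .
qed

section \<open>The Gronwall estimate for the stopped process\<close>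

context drifted_brownian
begin

text \<open>Joint measurability of the stopped path is what Fubini's theorem needs when the mean of
  a time integral is rewritten as the time integral of means.\<close>

lemma R_stop_joint:
  assumes \<eta>: "\<eta> \<in> borel_measurable M"
  shows "(\<lambda>(s, \<omega>). R (max 0 (min s (\<eta> \<omega>))) \<omega>) \<in> borel_measurable (borel \<Otimes>\<^sub>M M)"
proof -
  have [measurable]: "\<eta> \<in> borel_measurable M" by fact
  have "(\<lambda>p. (case (min (fst p) (\<eta> (snd p)), snd p) of (t, \<omega>) \<Rightarrow> R (max 0 t) \<omega>)) \<in> borel_measurable (borel \<Otimes>\<^sub>M M)"
    by (rule measurable_compose[OF _ R_joint]) measurable
  then show ?thesis by (simp add: case_prod_beta')
qed

lemma J_stop_measurable:
  assumes g: "continuous_on UNIV g" and \<eta>: "\<eta> \<in> borel_measurable M" and nn: "\<And>\<omega>. \<omega> \<in> space M \<Longrightarrow> 0 \<le> \<eta> \<omega>"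
  shows "(\<lambda>\<omega>. J g (\<eta> \<omega>) \<omega>) \<in> borel_measurable M"
proof -
  have [measurable]: "\<eta> \<in> borel_measurable M" by fact
  have "bounded (g ` {lo..hi})"
    using g by (auto intro!: compact_imp_bounded compact_continuous_image intro: continuous_on_subset)
  then obtain C where C: "\<And>y. y \<in> {lo..hi} \<Longrightarrow> \<bar>g y\<bar> \<le> C" unfolding bounded_iff real_norm_def by blast
  have "(\<lambda>(t, \<omega>). J g (max 0 t) \<omega>) \<in> borel_measurable (borel \<Otimes>\<^sub>M M)"
  proof (rule borel_measurable_continuous_paths)
    fix \<omega> assume \<omega>: "\<omega> \<in> space M"
    have "C-lipschitz_on {0..} (\<lambda>t. J g t \<omega>)"
    proof (rule lipschitz_onI)
      fix s t :: real assume st: "s \<in> {0..}" "t \<in> {0..}"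
      show "dist (J g s \<omega>) (J g t \<omega>) \<le> C * dist s t"
        using J_lipschitz[OF g C \<omega>, of s t] J_lipschitz[OF g C \<omega>, of t s] st
        by (cases "s \<le> t") (auto simp: dist_real_def abs_minus_commute)
    next
      show "0 \<le> C" using C[OF R_range[OF order_refl \<omega>]] by linarith
    qed
    then have "continuous_on {0..} (\<lambda>t. J g t \<omega>)" by (rule lipschitz_on_continuous_on)
    then show "continuous_on UNIV (\<lambda>t. J g (max 0 t) \<omega>)"
      by (rule continuous_on_compose2) (auto intro!: continuous_intros)
  qed (rule J_measurable[OF g])
  then have "(\<lambda>\<omega>. case (\<eta> \<omega>, \<omega>) of (t, \<omega>) \<Rightarrow> J g (max 0 t) \<omega>) \<in> borel_measurable M"
    by (rule measurable_compose[rotated]) measurable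
  then show ?thesis using nn by (subst measurable_cong[where g="\<lambda>\<omega>. J g (max 0 (\<eta> \<omega>)) \<omega>"]) auto
qed

lemma J_mono:
  assumes "continuous_on UNIV f" "continuous_on UNIV g" "\<And>y. y \<in> {lo..hi} \<Longrightarrow> f y \<le> g y"
    and \<omega>: "\<omega> \<in> space M"
  shows "J f t \<omega> \<le> J g t \<omega>"
  unfolding J_def by (rule set_integral_mono) (use assms gR_integrable R_range in auto)

lemma J_nonneg:
  assumes "\<And>y. y \<in> {lo..hi} \<Longrightarrow> 0 \<le> g y" and \<omega>: "\<omega> \<in> space M"
  shows "0 \<le> J g t \<omega>"
  unfolding J_def set_lebesgue_integral_def
  by (rule Bochner_Integration.integral_nonneg) (use assms(1) R_range[OF _ \<omega>] in \<open>auto simp: indicator_def\<close>)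

text \<open>Gronwall's lemma is replaced by the maximal value \<open>N\<close> of \<open>exp (- 2 * K * t) * m t\<close>, which
  satisfies \<open>N \<le> \<phi> x + N / 2\<close>.\<close>

lemma lyapunov:
  fixes \<phi> \<phi>' \<phi>'' \<theta> :: "real \<Rightarrow> real" and \<eta> :: "'a \<Rightarrow> real"
  assumes T: "0 < T"
    and \<eta>: "\<And>\<omega>. \<omega> \<in> space M \<Longrightarrow> \<eta> \<omega> \<in> {0..T}"
    and \<eta>_stop: "\<And>t. 0 \<le> t \<Longrightarrow> {\<omega> \<in> space M. t < \<eta> \<omega>} \<in> sets (G t)"
    and ZR: "\<And>t \<omega>. \<omega> \<in> space M \<Longrightarrow> 0 \<le> t \<Longrightarrow> t \<le> \<eta> \<omega> \<Longrightarrow> Z t \<omega> = R t \<omega>"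
    and d1: "\<And>z. z \<in> {lo..hi} \<Longrightarrow> (\<phi> has_real_derivative \<phi>' z) (at z)"
    and d2: "\<And>z. z \<in> {lo..hi} \<Longrightarrow> (\<phi>' has_real_derivative \<phi>'' z) (at z)"
    and lip: "L-lipschitz_on {lo..hi} \<phi>''"
    and \<phi>_nn: "\<And>z. z \<in> {lo..hi} \<Longrightarrow> 0 \<le> \<phi> z"
    and \<theta>: "continuous_on UNIV \<theta>" "\<And>z. z \<in> {lo..hi} \<Longrightarrow> 0 \<le> \<theta> z"
    and K: "0 < K" and gen: "\<And>y. y \<in> {lo..hi} \<Longrightarrow> \<phi>'' y / 2 + b y * \<phi>' y \<le> K * \<phi> y - \<theta> y"
  shows "(\<lambda>\<omega>. \<phi> (R (\<eta> \<omega>) \<omega>) + J \<theta> (\<eta> \<omega>) \<omega>) \<in> borel_measurable M"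
    "(\<integral>\<^sup>+ \<omega>. ennreal (\<phi> (R (\<eta> \<omega>) \<omega>) + J \<theta> (\<eta> \<omega>) \<omega>) \<partial>M) \<le> ennreal (exp (2 * K * T) * \<phi> x)"
proof -
  obtain \<omega>0 where \<omega>0: "\<omega>0 \<in> space M" using not_empty by blast
  have x: "x \<in> {lo..hi}" using R_range[OF order_refl \<omega>0] R_0[OF \<omega>0] by simp
  then have lohi: "lo \<le> hi" by simp
  \<comment> \<open>Dynkin's formula was proved for functions on the whole line with a lower bound.
    \<open>R\<close> stays in \<open>{lo..hi}\<close>, so the replacement of \<open>\<phi>\<close>
    by its extension is invisible in the result.\<close>
  obtain \<psi> \<psi>' \<psi>'' L' C0 where \<psi>: "\<And>z. (\<psi> has_real_derivative \<psi>' z) (at z)" "\<And>z. (\<psi>' has_real_derivative \<psi>'' z) (at z)"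
    "L'-lipschitz_on UNIV \<psi>''" "\<And>z. - C0 \<le> \<psi> z"
    "\<And>z. z \<in> {lo..hi} \<Longrightarrow> \<psi> z = \<phi> z" "\<And>z. z \<in> {lo..hi} \<Longrightarrow> \<psi>' z = \<phi>' z"
    "\<And>z. z \<in> {lo..hi} \<Longrightarrow> \<psi>'' z = \<phi>'' z"
    using C2_extension[OF lohi d1 d2 lip] by metis
  define g where "g y = \<psi>'' y / 2 + b y * \<psi>' y" for y
  have c\<psi>: "continuous_on UNIV \<psi>" "continuous_on UNIV \<psi>'" "continuous_on UNIV \<psi>''"
    using \<psi>(1,2) lipschitz_on_continuous_on[OF \<psi>(3)] by (blast intro: DERIV_continuous_on has_field_derivative_at_within)+
  have cg: "continuous_on UNIV g" unfolding g_def by (intro continuous_intros c\<psi> b_cont) simp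
  have \<eta>M[measurable]: "\<eta> \<in> borel_measurable M"
  proof (rule borel_measurable_iff_greater[THEN iffD2], rule allI)
    fix a show "{\<omega> \<in> space M. a < \<eta> \<omega>} \<in> sets M"
    proof (cases "0 \<le> a")
      case True then show ?thesis using \<eta>_stop[OF True] sub[OF True] by (auto simp: subalgebra_def)
    next
      case False
      then have "{\<omega> \<in> space M. a < \<eta> \<omega>} = space M" using \<eta> by force
      then show ?thesis by simp
    qed
  qed
  \<comment> \<open>Stopping additionally at a deterministic \<open>t\<close> gives a function of
    \<open>t\<close> to which a Gronwall argument can be applied.\<close>
  define \<eta>t where "\<eta>t t \<omega> = min t (\<eta> \<omega>)" for t \<omega>
  have \<eta>t: "\<eta>t t \<omega> \<in> {0..t}" if "0 \<le> t" "\<omega> \<in> space M" for t \<omega> using \<eta>[OF that(2)] that(1) by (simp add: \<eta>t_def)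
  have \<eta>tM[measurable]: "\<eta>t t \<in> borel_measurable M" for t unfolding \<eta>t_def[abs_def] by measurable
  have \<eta>tM': "(\<lambda>\<omega>. \<eta>t t \<omega>) \<in> borel_measurable M" for t by measurable
  have Rt: "R (\<eta>t t \<omega>) \<omega> \<in> {lo..hi}" if "0 \<le> t" "\<omega> \<in> space M" for t \<omega> using R_range[OF _ that(2)] \<eta>t[OF that] by simp
  have JM: "(\<lambda>\<omega>. J f (\<eta>t t \<omega>) \<omega>) \<in> borel_measurable M" if "continuous_on UNIV f" "0 \<le> t" for f t
    using J_stop_measurable[OF that(1) \<eta>tM'] \<eta>t[OF that(2)] by auto
  have JI: "integrable M (\<lambda>\<omega>. J f (\<eta>t t \<omega>) \<omega>)" if f: "continuous_on UNIV f" and t: "0 \<le> t" for f t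
  proof -
    have "bounded (f ` {lo..hi})"
      using f by (auto intro!: compact_imp_bounded compact_continuous_image intro: continuous_on_subset)
    then obtain C where C: "\<And>y. y \<in> {lo..hi} \<Longrightarrow> \<bar>f y\<bar> \<le> C" unfolding bounded_iff real_norm_def by blast
    have "\<bar>J f (\<eta>t t \<omega>) \<omega>\<bar> \<le> C * t" if \<omega>: "\<omega> \<in> space M" for \<omega>
    proof -
      have "\<bar>J f (\<eta>t t \<omega>) \<omega>\<bar> \<le> C * \<eta>t t \<omega>"
        using J_lipschitz[OF f C \<omega>, of 0 "\<eta>t t \<omega>"] \<eta>t[OF t \<omega>] by (simp add: J_0[OF \<omega>])
      also have "\<dots> \<le> C * t" using \<eta>t[OF t \<omega>] C[OF x] by (intro mult_left_mono) auto
      finally show ?thesis .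
    qed
    then show ?thesis by (intro integrable_const_bound[where B="C * t"] JM f t) auto
  qed
  define m where "m t = expectation (\<lambda>\<omega>. \<psi> (R (\<eta>t t \<omega>) \<omega>))" for t
  have b\<psi>: "bounded (\<psi> ` {lo..hi})"
    using c\<psi> by (auto intro!: compact_imp_bounded compact_continuous_image intro: continuous_on_subset)
  then obtain C3 where C3: "\<And>y. y \<in> {lo..hi} \<Longrightarrow> \<bar>\<psi> y\<bar> \<le> C3" unfolding bounded_iff real_norm_def by blast
  have \<psi>nn: "0 \<le> \<psi> y" if "y \<in> {lo..hi}" for y using \<psi>(5) \<phi>_nn that by simp
  have [measurable]: "\<psi> \<in> borel_measurable borel" using c\<psi>(1) by (rule borel_measurable_continuous_onI)
  have Rjoint: "(\<lambda>p. R (max 0 (min (fst p) (\<eta> (snd p)))) (snd p)) \<in> borel_measurable (borel \<Otimes>\<^sub>M M)"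
    using R_stop_joint[OF \<eta>M] by (simp add: case_prod_beta')
  have \<psi>RM: "(\<lambda>\<omega>. \<psi> (R (\<eta>t t \<omega>) \<omega>)) \<in> borel_measurable M" if "0 \<le> t" for t
  proof -
    have "(\<lambda>\<omega>. R (max 0 (min (fst (t, \<omega>)) (\<eta> (snd (t, \<omega>))))) (snd (t, \<omega>))) \<in> borel_measurable M"
      by (rule measurable_compose[OF _ Rjoint]) measurable
    then have "(\<lambda>\<omega>. \<psi> (R (max 0 (min t (\<eta> \<omega>))) \<omega>)) \<in> borel_measurable M" by simp
    then show ?thesis
      by (subst measurable_cong[where g="\<lambda>\<omega>. \<psi> (R (max 0 (min t (\<eta> \<omega>))) \<omega>)"])
        (use \<eta>t[OF that] in \<open>auto simp: \<eta>t_def max_def\<close>)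
  qed
  have i\<psi>: "integrable M (\<lambda>\<omega>. \<psi> (R (\<eta>t t \<omega>) \<omega>))" if "0 \<le> t" for t
    by (rule integrable_const_bound[where B=C3]) (use C3 Rt[OF that] \<psi>RM[OF that] in auto)
  have m_nn: "0 \<le> m t" if "0 \<le> t" for t unfolding m_def by (rule integral_nonneg_AE) (use \<psi>nn Rt[OF that] in auto)
  have m_le: "m t \<le> C3" if "0 \<le> t" for t
    unfolding m_def by (rule integral_le_const[OF i\<psi>[OF that]]) (use C3 Rt[OF that] in \<open>auto simp: abs_le_iff\<close>)
  have m0: "m 0 = \<psi> x"
  proof -
    have "m 0 = expectation (\<lambda>\<omega>. \<psi> x)"
      unfolding m_def by (rule Bochner_Integration.integral_cong) (use \<eta> R_0 in \<open>auto simp: \<eta>t_def min_def\<close>)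
    then show ?thesis by (simp add: prob_space)
  qed
  have dyn: "m t + expectation (\<lambda>\<omega>. J \<theta> (\<eta>t t \<omega>) \<omega>) \<le> \<psi> x + K * expectation (\<lambda>\<omega>. J \<psi> (\<eta>t t \<omega>) \<omega>)" if t: "0 < t" for t
  proof -
    have t': "0 \<le> t" using t by simp
    have e1: "m t \<le> \<psi> x + expectation (\<lambda>\<omega>. J g (\<eta>t t \<omega>) \<omega>)"
      unfolding m_def g_def
    proof (rule dynkin(3)[OF t _ _ _ \<psi>(1,2,3,4)])
      show "\<eta>t t \<omega> \<in> {0..t}" if "\<omega> \<in> space M" for \<omega> using \<eta>t[OF t' that] .
      show "Z s \<omega> = R s \<omega>" if "\<omega> \<in> space M" "0 \<le> s" "s \<le> \<eta>t t \<omega>" for s \<omega> using ZR that by (simp add: \<eta>t_def)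
      fix s :: real assume s: "0 \<le> s"
      show "{\<omega> \<in> space M. s < \<eta>t t \<omega>} \<in> sets (G s)"
      proof (cases "s < t")
        case True
        then show ?thesis using \<eta>_stop[OF s] by (simp add: \<eta>t_def)
      qed (simp add: \<eta>t_def)
    qed
    have e2: "expectation (\<lambda>\<omega>. J g (\<eta>t t \<omega>) \<omega>) \<le> expectation (\<lambda>\<omega>. K * J \<psi> (\<eta>t t \<omega>) \<omega> - J \<theta> (\<eta>t t \<omega>) \<omega>)"
    proof (rule integral_mono)
      fix \<omega> assume \<omega>: "\<omega> \<in> space M"
      have c: "continuous_on UNIV (\<lambda>y. K * \<psi> y - \<theta> y)" by (intro continuous_intros c\<psi> \<theta>)
      have "J g (\<eta>t t \<omega>) \<omega> \<le> J (\<lambda>y. K * \<psi> y - \<theta> y) (\<eta>t t \<omega>) \<omega>"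
        by (rule J_mono[OF cg c _ \<omega>]) (use gen \<psi>(5,6,7) in \<open>auto simp: g_def\<close>)
      also have "\<dots> = K * J \<psi> (\<eta>t t \<omega>) \<omega> - J \<theta> (\<eta>t t \<omega>) \<omega>"
        unfolding J_def using gR_integrable[OF c\<psi>(1) \<omega>] gR_integrable[OF \<theta>(1) \<omega>] by (subst set_integral_diff) auto
      finally show "J g (\<eta>t t \<omega>) \<omega> \<le> K * J \<psi> (\<eta>t t \<omega>) \<omega> - J \<theta> (\<eta>t t \<omega>) \<omega>" .
    qed (use JI[OF cg t'] JI[OF c\<psi>(1) t'] JI[OF \<theta>(1) t'] in auto)
    have e3: "expectation (\<lambda>\<omega>. K * J \<psi> (\<eta>t t \<omega>) \<omega> - J \<theta> (\<eta>t t \<omega>) \<omega>)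
        = K * expectation (\<lambda>\<omega>. J \<psi> (\<eta>t t \<omega>) \<omega>) - expectation (\<lambda>\<omega>. J \<theta> (\<eta>t t \<omega>) \<omega>)"
      using JI[OF c\<psi>(1) t'] JI[OF \<theta>(1) t'] by simp
    show ?thesis using e1 e2 unfolding e3 by linarith
  qed
  define N where "N = (SUP t\<in>{0..T}. exp (- 2 * K * t) * m t)"
  \<comment> \<open>The supremum is finite because \<open>\<psi>\<close> is bounded on
    \<open>{lo..hi}\<close>. Without finiteness the term \<open>N / 2\<close> could not be
    absorbed.\<close>
  have bdd: "bdd_above ((\<lambda>t. exp (- 2 * K * t) * m t) ` {0..T})"
  proof (rule bdd_aboveI2)
    fix t assume t: "t \<in> {0..T}"
    have "exp (- 2 * K * t) * m t \<le> 1 * C3" using t K m_le m_nn by (intro mult_mono) auto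
    then show "exp (- 2 * K * t) * m t \<le> C3" by simp
  qed
  have N: "m t \<le> N * exp (2 * K * t)" if "t \<in> {0..T}" for t
  proof -
    have "exp (- 2 * K * t) * m t \<le> N" unfolding N_def by (rule cSUP_upper[OF that bdd])
    then have "(exp (- 2 * K * t) * m t) * exp (2 * K * t) \<le> N * exp (2 * K * t)" by (intro mult_right_mono) auto
    moreover have "(exp (- 2 * K * t) * m t) * exp (2 * K * t) = m t"
      by (simp add: exp_minus field_simps)
    ultimately show ?thesis by (simp only:)
  qed
  have N_nn: "0 \<le> N" using N[of 0] m_nn[of 0] T by simp
  \<comment> \<open>By Fubini the mean is at most the integral of \<open>m\<close> over
    \<open>{0..t}\<close>: up to \<open>\<eta>\<close> the stopped path is the path itself, and
    afterwards it adds a nonnegative amount. Integrating \<open>N * exp (2 * K * s)\<close> divides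
    by \<open>2 * K\<close>, so the factor \<open>K\<close> leaves \<open>N / 2\<close>. The rate
    \<open>2 * K\<close>, rather than \<open>K\<close>, makes this coefficient smaller than
    1.\<close>
  have EJ: "K * expectation (\<lambda>\<omega>. J \<psi> (\<eta>t t \<omega>) \<omega>) \<le> N / 2 * (exp (2 * K * t) - 1)" if t: "t \<in> {0..T}" for t
  proof -
    have t': "0 \<le> t" using t by simp
    define F where "F p = ennreal (\<psi> (R (max 0 (min (fst p) (\<eta> (snd p)))) (snd p))) * indicator {0..t} (fst p)" for p
    have [measurable]: "F \<in> borel_measurable (lborel \<Otimes>\<^sub>M M)"
    proof -
      have [measurable]: "(\<lambda>p. R (max 0 (min (fst p) (\<eta> (snd p)))) (snd p)) \<in> borel_measurable (lborel \<Otimes>\<^sub>M M)"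
        using Rjoint by (simp cong: measurable_cong_sets)
      show ?thesis unfolding F_def[abs_def] by measurable
    qed
    interpret P: pair_sigma_finite lborel M ..
    have J\<psi>: "0 \<le> J \<psi> (\<eta>t t \<omega>) \<omega>" if "\<omega> \<in> space M" for \<omega>
      by (rule J_nonneg[OF \<psi>nn that])
    have "ennreal (expectation (\<lambda>\<omega>. J \<psi> (\<eta>t t \<omega>) \<omega>)) = (\<integral>\<^sup>+ \<omega>. ennreal (J \<psi> (\<eta>t t \<omega>) \<omega>) \<partial>M)"
      by (rule nn_integral_eq_integral[symmetric]) (use JI[OF c\<psi>(1) t'] J\<psi> in auto)
    also have "\<dots> \<le> (\<integral>\<^sup>+ \<omega>. \<integral>\<^sup>+ s. F (s, \<omega>) \<partial>lborel \<partial>M)"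
    proof (rule nn_integral_mono)
      fix \<omega> assume \<omega>: "\<omega> \<in> space M"
      have "ennreal (J \<psi> (\<eta>t t \<omega>) \<omega>) = (\<integral>\<^sup>+ s. ennreal (indicator {0..\<eta>t t \<omega>} s *\<^sub>R \<psi> (R s \<omega>)) \<partial>lborel)"
        unfolding J_def set_lebesgue_integral_def
        by (rule nn_integral_eq_integral[symmetric])
          (use gR_integrable[OF c\<psi>(1) \<omega>, of 0 "\<eta>t t \<omega>"] \<psi>nn R_range[OF _ \<omega>] in \<open>auto simp: set_integrable_def indicator_def\<close>)
      also have "\<dots> \<le> (\<integral>\<^sup>+ s. F (s, \<omega>) \<partial>lborel)"
      proof (rule nn_integral_mono)
        fix s
        show "ennreal (indicator {0..\<eta>t t \<omega>} s *\<^sub>R \<psi> (R s \<omega>)) \<le> F (s, \<omega>)"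
        proof (cases "s \<in> {0..\<eta>t t \<omega>}")
          case True
          then have "0 \<le> s" "s \<le> t" "min s (\<eta> \<omega>) = s" by (auto simp: \<eta>t_def)
          with True show ?thesis by (simp add: F_def)
        qed simp
      qed
      finally show "ennreal (J \<psi> (\<eta>t t \<omega>) \<omega>) \<le> (\<integral>\<^sup>+ s. F (s, \<omega>) \<partial>lborel)" .
    qed
    also have "\<dots> = (\<integral>\<^sup>+ s. \<integral>\<^sup>+ \<omega>. F (s, \<omega>) \<partial>M \<partial>lborel)"
      by (rule P.Fubini') (simp add: case_prod_beta')
    also have "\<dots> \<le> (\<integral>\<^sup>+ s. ennreal (N * exp (2 * K * s)) * indicator {0..t} s \<partial>lborel)"
    proof (rule nn_integral_mono)
      fix s
      show "(\<integral>\<^sup>+ \<omega>. F (s, \<omega>) \<partial>M) \<le> ennreal (N * exp (2 * K * s)) * indicator {0..t} s"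
      proof (cases "s \<in> {0..t}")
        case True
        then have s: "0 \<le> s" "s \<in> {0..T}" using t by auto
        have "(\<integral>\<^sup>+ \<omega>. F (s, \<omega>) \<partial>M) = (\<integral>\<^sup>+ \<omega>. ennreal (\<psi> (R (\<eta>t s \<omega>) \<omega>)) \<partial>M)"
          by (rule nn_integral_cong) (use True \<eta> in \<open>auto simp: F_def \<eta>t_def max_def\<close>)
        also have "\<dots> = ennreal (m s)"
          unfolding m_def by (rule nn_integral_eq_integral[OF i\<psi>[OF s(1)]]) (use \<psi>nn Rt[OF s(1)] in auto)
        also have "\<dots> \<le> ennreal (N * exp (2 * K * s))" by (intro ennreal_leI N s)
        finally show ?thesis using True by simp
      qed (auto simp: F_def)
    qed
    also have "\<dots> = ennreal (N * exp (2 * K * t) / (2 * K) - N * exp (2 * K * 0) / (2 * K))"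
      by (rule nn_integral_FTC_Icc) (use t K N_nn in \<open>auto intro!: derivative_eq_intros\<close>)
    finally have "ennreal (expectation (\<lambda>\<omega>. J \<psi> (\<eta>t t \<omega>) \<omega>)) \<le> ennreal (N * exp (2 * K * t) / (2 * K) - N * exp (2 * K * 0) / (2 * K))" .
    moreover have "N * exp (2 * K * t) / (2 * K) - N * exp (2 * K * 0) / (2 * K) = N / (2 * K) * (exp (2 * K * t) - 1)"
      using K by (simp add: field_simps)
    moreover have "0 \<le> N / (2 * K) * (exp (2 * K * t) - 1)" using N_nn K t by simp
    ultimately have "expectation (\<lambda>\<omega>. J \<psi> (\<eta>t t \<omega>) \<omega>) \<le> N / (2 * K) * (exp (2 * K * t) - 1)"
      by (simp only: ennreal_le_iff)
    then have "K * expectation (\<lambda>\<omega>. J \<psi> (\<eta>t t \<omega>) \<omega>) \<le> K * (N / (2 * K) * (exp (2 * K * t) - 1))"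
      using K by (intro mult_left_mono) auto
    then show ?thesis using K by simp
  qed
  have J\<theta>: "0 \<le> J \<theta> (\<eta>t t \<omega>) \<omega>" if "\<omega> \<in> space M" for \<omega> t
    by (rule J_nonneg[OF \<theta>(2) that])
  have bound: "m t + expectation (\<lambda>\<omega>. J \<theta> (\<eta>t t \<omega>) \<omega>) \<le> \<psi> x + N / 2 * (exp (2 * K * t) - 1)" if "0 < t" "t \<le> T" for t
    using dyn[of t] EJ[of t] that by simp
  have "N \<le> \<psi> x + N / 2"
    unfolding N_def
  proof (rule cSUP_least, fold N_def)
    fix t assume t: "t \<in> {0..T}"
    have px: "0 \<le> \<psi> x" using \<psi>nn[OF x] .
    show "exp (- 2 * K * t) * m t \<le> \<psi> x + N / 2"
    proof (cases "t = 0")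
      case True then show ?thesis using N_nn by (simp add: m0)
    next
      case False
      have "0 \<le> expectation (\<lambda>\<omega>. J \<theta> (\<eta>t t \<omega>) \<omega>)" by (rule integral_nonneg_AE) (use J\<theta> in auto)
      then have "m t \<le> \<psi> x + N / 2 * (exp (2 * K * t) - 1)" using bound[of t] t False by simp
      also have "\<dots> \<le> (\<psi> x + N / 2) * exp (2 * K * t)"
      proof -
        have "\<psi> x * 1 \<le> \<psi> x * exp (2 * K * t)" using px t K by (intro mult_left_mono) auto
        then show ?thesis using N_nn by (simp add: algebra_simps)
      qed
      finally have "exp (- 2 * K * t) * m t \<le> exp (- 2 * K * t) * ((\<psi> x + N / 2) * exp (2 * K * t))"
        by (intro mult_left_mono) auto
      also have "\<dots> = (\<psi> x + N / 2) * exp (- 2 * K * t + 2 * K * t)" by (simp only: exp_add mult_ac)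
      finally show ?thesis by simp
    qed
  qed (use T in auto)
  then have N2: "N \<le> 2 * \<psi> x" by simp
  have \<eta>T: "\<eta>t T \<omega> = \<eta> \<omega>" if "\<omega> \<in> space M" for \<omega> using \<eta>[OF that] by (simp add: \<eta>t_def)
  have T0: "0 \<le> T" using T by simp
  have eq: "\<phi> (R (\<eta> \<omega>) \<omega>) + J \<theta> (\<eta> \<omega>) \<omega> = \<psi> (R (\<eta>t T \<omega>) \<omega>) + J \<theta> (\<eta>t T \<omega>) \<omega>" if "\<omega> \<in> space M" for \<omega>
    using \<psi>(5) Rt[OF T0 that] by (simp add: \<eta>T[OF that])
  show "(\<lambda>\<omega>. \<phi> (R (\<eta> \<omega>) \<omega>) + J \<theta> (\<eta> \<omega>) \<omega>) \<in> borel_measurable M"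
    by (subst measurable_cong[OF eq]) (use \<psi>RM[OF T0] JM[OF \<theta>(1) T0] in auto)
  have "(\<integral>\<^sup>+ \<omega>. ennreal (\<phi> (R (\<eta> \<omega>) \<omega>) + J \<theta> (\<eta> \<omega>) \<omega>) \<partial>M) = (\<integral>\<^sup>+ \<omega>. ennreal (\<psi> (R (\<eta>t T \<omega>) \<omega>) + J \<theta> (\<eta>t T \<omega>) \<omega>) \<partial>M)"
    by (rule nn_integral_cong) (simp add: eq)
  also have "\<dots> = ennreal (expectation (\<lambda>\<omega>. \<psi> (R (\<eta>t T \<omega>) \<omega>) + J \<theta> (\<eta>t T \<omega>) \<omega>))"
    by (rule nn_integral_eq_integral) (use i\<psi>[OF T0] JI[OF \<theta>(1) T0] \<psi>nn Rt[OF T0] J\<theta> in auto)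
  also have "expectation (\<lambda>\<omega>. \<psi> (R (\<eta>t T \<omega>) \<omega>) + J \<theta> (\<eta>t T \<omega>) \<omega>) = m T + expectation (\<lambda>\<omega>. J \<theta> (\<eta>t T \<omega>) \<omega>)"
    unfolding m_def using i\<psi>[OF T0] JI[OF \<theta>(1) T0] by simp
  also have "ennreal \<dots> \<le> ennreal (exp (2 * K * T) * \<phi> x)"
  proof (rule ennreal_leI)
    have "m T + expectation (\<lambda>\<omega>. J \<theta> (\<eta>t T \<omega>) \<omega>) \<le> \<psi> x + N / 2 * (exp (2 * K * T) - 1)" using bound[of T] T by simp
    also have "\<dots> \<le> \<psi> x + \<psi> x * (exp (2 * K * T) - 1)" using N2 K T by (intro add_left_mono mult_right_mono) auto
    also have "\<dots> = exp (2 * K * T) * \<phi> x" using \<psi>(5)[OF x] by (simp add: algebra_simps)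
    finally show "m T + expectation (\<lambda>\<omega>. J \<theta> (\<eta>t T \<omega>) \<omega>) \<le> exp (2 * K * T) * \<phi> x" .
  qed
  finally show "(\<integral>\<^sup>+ \<omega>. ennreal (\<phi> (R (\<eta> \<omega>) \<omega>) + J \<theta> (\<eta> \<omega>) \<omega>) \<partial>M) \<le> ennreal (exp (2 * K * T) * \<phi> x)" .
qed

end


subsection \<open>Application to the drifted process\<close>

text \<open>Completing the filtration makes it possible to modify paths on a null set.\<close>

definition augment :: "'a measure \<Rightarrow> 'a measure \<Rightarrow> 'a measure" where
  "augment M N = sigma (space M) {A \<in> sets M. \<exists>B\<in>sets N. AE \<omega> in M. \<omega> \<in> A \<longleftrightarrow> \<omega> \<in> B}"

text \<open>Countably many null sets can be discarded at once, so the generating family is closed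
  under countable unions and is already a sigma-algebra.\<close>

lemma sets_augment:
  assumes "subalgebra M N"
  shows "sets (augment M N) = {A \<in> sets M. \<exists>B\<in>sets N. AE \<omega> in M. \<omega> \<in> A \<longleftrightarrow> \<omega> \<in> B}" (is "_ = ?S")
proof -
  have sp: "space N = space M" using assms by (simp add: subalgebra_def)
  have "sigma_algebra (space M) ?S"
    unfolding sigma_algebra_iff2
  proof (intro conjI ballI allI impI)
    show "?S \<subseteq> Pow (space M)" using sets.space_closed by blast
    show "{} \<in> ?S" by (auto intro!: bexI[of _ "{}"])
  next
    fix A assume "A \<in> ?S"
    then obtain B where A: "A \<in> sets M" and B: "B \<in> sets N" "AE \<omega> in M. \<omega> \<in> A \<longleftrightarrow> \<omega> \<in> B" by blast
    have "AE \<omega> in M. \<omega> \<in> space M - A \<longleftrightarrow> \<omega> \<in> space N - B" using B(2) by (auto simp: sp)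
    then show "space M - A \<in> ?S" using A B(1) by blast
  next
    fix A :: "nat \<Rightarrow> 'a set" assume "range A \<subseteq> ?S"
    then have "\<forall>i. A i \<in> sets M \<and> (\<exists>B. B \<in> sets N \<and> (AE \<omega> in M. \<omega> \<in> A i \<longleftrightarrow> \<omega> \<in> B))" by blast
    then obtain B where A: "\<And>i. A i \<in> sets M" and B: "\<And>i. B i \<in> sets N" "\<And>i. AE \<omega> in M. \<omega> \<in> A i \<longleftrightarrow> \<omega> \<in> B i"
      by metis
    have "AE \<omega> in M. \<forall>i. \<omega> \<in> A i \<longleftrightarrow> \<omega> \<in> B i" using B(2) by (simp add: AE_all_countable)
    then have "AE \<omega> in M. \<omega> \<in> (\<Union>i. A i) \<longleftrightarrow> \<omega> \<in> (\<Union>i. B i)" by eventually_elim blast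
    moreover have "(\<Union>i. A i) \<in> sets M" "(\<Union>i. B i) \<in> sets N" using A B(1) by auto
    ultimately show "(\<Union>i. A i) \<in> ?S" by blast
  qed
  then show ?thesis unfolding augment_def by (rule sigma_algebra.sets_measure_of_eq)
qed

lemma space_augment: "space (augment M N) = space M"
  unfolding augment_def by (rule space_measure_of) (use sets.space_closed in blast)

lemma subalgebra_augment: "subalgebra M N \<Longrightarrow> subalgebra M (augment M N)"
  by (auto simp: subalgebra_def space_augment sets_augment)

text \<open>The augmentation contains only events of \<open>M\<close>, not arbitrary subsets of null
  sets. Measurability of \<open>g\<close> with respect to \<open>M\<close> is therefore a separate
  assumption.\<close>

lemma measurable_augment:
  assumes sub: "subalgebra M N" and f: "f \<in> borel_measurable N" and g: "g \<in> borel_measurable M"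
    and ae: "AE \<omega> in M. g \<omega> = f \<omega>"
  shows "g \<in> borel_measurable (augment M N)"
proof (rule measurableI)
  fix A :: "'b set" assume A: "A \<in> sets borel"
  have sp: "space N = space M" using sub by (simp add: subalgebra_def)
  have "AE \<omega> in M. \<omega> \<in> g -` A \<inter> space M \<longleftrightarrow> \<omega> \<in> f -` A \<inter> space N" using ae by eventually_elim (simp add: sp)
  then show "g -` A \<inter> space (augment M N) \<in> sets (augment M N)"
    unfolding sets_augment[OF sub] space_augment using measurable_sets[OF f A] measurable_sets[OF g A] by blast
qed simp

context prob_space
begin

text \<open>Independence is a statement about probabilities, and these do not change when events are
  altered on null sets. So \<open>W\<close> remains a Brownian motion for the larger
  filtration.\<close>

lemma indep_set_augment:
  assumes sub: "subalgebra M N"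
    and ind: "indep_set (sets N) {w -` A \<inter> space M | A. A \<in> sets borel}"
    and w': "w' \<in> borel_measurable M" and ae: "AE \<omega> in M. w' \<omega> = w \<omega>"
  shows "indep_set (sets (augment M N)) {w' -` A \<inter> space M | A. A \<in> sets borel}"
proof (rule indep_setI)
  show "sets (augment M N) \<subseteq> events" unfolding sets_augment[OF sub] by blast
  show "{w' -` A \<inter> space M | A. A \<in> sets borel} \<subseteq> events" using measurable_sets[OF w'] by blast
  fix a b assume "a \<in> sets (augment M N)" "b \<in> {w' -` A \<inter> space M | A. A \<in> sets borel}"
  then obtain B C where a: "a \<in> events" "B \<in> sets N" "AE \<omega> in M. \<omega> \<in> a \<longleftrightarrow> \<omega> \<in> B"
    and b: "b = w' -` C \<inter> space M" "C \<in> sets borel" unfolding sets_augment[OF sub] by blast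
  let ?c = "w -` C \<inter> space M"
  have bM: "b \<in> events" using measurable_sets[OF w' b(2)] b(1) by simp
  have cM: "?c \<in> events" and BM: "B \<in> events" using ind a(2) b(2) unfolding indep_sets2_eq by blast+
  have ae': "AE \<omega> in M. \<omega> \<in> b \<longleftrightarrow> \<omega> \<in> ?c" using ae by eventually_elim (simp add: b(1))
  have "prob (a \<inter> b) = prob (B \<inter> ?c)"
    by (rule finite_measure_eq_AE) (use a(3) ae' a(1) bM cM BM in auto)
  also have "\<dots> = prob B * prob ?c" by (rule indep_setD[OF ind a(2)]) (use b(2) in blast)
  also have "prob B = prob a" by (rule finite_measure_eq_AE) (use a BM in auto)
  also have "prob ?c = prob b" by (rule finite_measure_eq_AE) (use ae' bM cM in auto)
  finally show "prob (a \<inter> b) = prob a * prob b" .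
qed

end

lemma distributed_cong_AE:
  assumes d: "distributed M N X f" and Y: "Y \<in> measurable M N" and ae: "AE \<omega> in M. Y \<omega> = X \<omega>"
  shows "distributed M N Y f"
  using d Y distr_cong_AE[OF refl refl ae, of N] unfolding distributed_def by auto

section \<open>Exit times of continuous paths\<close>

lemma exit_time_gt_iff:
  fixes Y :: "real \<Rightarrow> 'a \<Rightarrow> ereal"
  assumes cont: "continuous_on {0..} (\<lambda>t. Y t \<omega>)" and A: "open A" and t: "0 \<le> t"
  shows "ereal t < exit_time A Y \<omega> \<longleftrightarrow> (\<forall>s\<in>{0..t}. Y s \<omega> \<in> A)"
proof
  assume lt: "ereal t < exit_time A Y \<omega>"
  show "\<forall>s\<in>{0..t}. Y s \<omega> \<in> A"
  proof (rule ballI, rule ccontr)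
    fix s assume s: "s \<in> {0..t}" "Y s \<omega> \<notin> A"
    then have "exit_time A Y \<omega> \<le> ereal s" unfolding exit_time_def by (intro INF_lower) auto
    also have "\<dots> \<le> ereal t" using s(1) by simp
    finally show False using lt by simp
  qed
next
  assume *: "\<forall>s\<in>{0..t}. Y s \<omega> \<in> A"
  have "\<forall>\<^sub>F s in at t within {0..}. Y s \<omega> \<in> A"
    using cont t * A by (intro topological_tendstoD[of "\<lambda>s. Y s \<omega>"]) (auto simp: continuous_on_def)
  then obtain d where d: "0 < d" "\<And>s. 0 \<le> s \<Longrightarrow> s \<noteq> t \<Longrightarrow> dist s t < d \<Longrightarrow> Y s \<omega> \<in> A"
    unfolding eventually_at by auto
  \<comment> \<open>Since \<open>A\<close> is open, the path remains in \<open>A\<close> for a while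
    after \<open>t\<close>. This margin \<open>d\<close> makes the inequality strict although the
    exit time is an infimum.\<close>
  have "ereal (t + d) \<le> exit_time A Y \<omega>"
    unfolding exit_time_def
  proof (rule INF_greatest)
    fix s assume s: "s \<in> {s. 0 \<le> s \<and> Y s \<omega> \<notin> A}"
    have "t + d \<le> s"
    proof (rule ccontr)
      assume "\<not> t + d \<le> s"
      then have "Y s \<omega> \<in> A" using * d(2)[of s] s by (cases "s \<le> t") (auto simp: dist_real_def)
      with s show False by simp
    qed
    then show "ereal (t + d) \<le> ereal s" by simp
  qed
  then show "ereal t < exit_time A Y \<omega>" using d(1) less_le_trans[of "ereal t" "ereal (t + d)"] by simp
qed

lemma exit_time_nonneg: "0 \<le> exit_time A Y \<omega>"
  unfolding exit_time_def by (rule INF_greatest) auto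

text \<open>At the exit time itself the path may have reached the boundary of \<open>A\<close>, so
  only membership in a closed superset can hold up to and including that time. Just before
  \<open>t\<close> the path is still in \<open>A\<close>, and continuity does the rest.\<close>

lemma exit_time_closed:
  fixes Y :: "real \<Rightarrow> 'a \<Rightarrow> ereal"
  assumes cont: "continuous_on {0..} (\<lambda>t. Y t \<omega>)" and C: "closed C" "A \<subseteq> C" "Y 0 \<omega> \<in> C" and A: "open A"
    and t: "0 \<le> t" "ereal t \<le> exit_time A Y \<omega>"
  shows "Y t \<omega> \<in> C"
proof (rule ccontr)
  assume n: "Y t \<omega> \<notin> C"
  then have t0: "0 < t" using C(3) t(1) by (cases "t = 0") auto
  have "\<forall>\<^sub>F s in at t within {0..}. Y s \<omega> \<in> - C"
    using cont t n C(1) by (intro topological_tendstoD[of "\<lambda>s. Y s \<omega>"]) (auto simp: continuous_on_def)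
  then obtain d where d: "0 < d" "\<And>s. 0 \<le> s \<Longrightarrow> s \<noteq> t \<Longrightarrow> dist s t < d \<Longrightarrow> Y s \<omega> \<notin> C"
    unfolding eventually_at by auto
  define s where "s = max (t / 2) (t - d / 2)"
  have s: "0 \<le> s" "s < t" "dist s t < d" using t0 d(1) by (auto simp: s_def dist_real_def)
  have "ereal s < exit_time A Y \<omega>" using s(2) t(2) less_le_trans[of "ereal s" "ereal t"] by simp
  then have "Y s \<omega> \<in> A" using exit_time_gt_iff[of Y \<omega> A s, OF cont A s(1)] s(1) by auto
  then show False using d(2)[of s] s C(2) by auto
qed

text \<open>This reduces survival up to \<open>t\<close> to countably many coordinates, as
  measurability requires. A path on the compact time interval keeps some distance
  \<open>1 / (k + 1)\<close> from both ends, and closed conditions pass from a dense set of times to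
  all. The times \<open>t * q\<close> with rational \<open>q\<close> contain \<open>t\<close>
  itself, which need not be rational.\<close>

lemma path_in_interval_iff:
  fixes Z :: "real \<Rightarrow> ereal"
  assumes cont: "continuous_on {0..} Z" and t: "0 \<le> t"
  shows "(\<forall>s\<in>{0..t}. Z s \<in> {ereal lo<..<ereal hi}) \<longleftrightarrow>
    (\<exists>k::nat. \<forall>q\<in>{0..1} \<inter> \<rat>. Z (t * q) \<in> {ereal (lo + 1 / real (Suc k))..ereal (hi - 1 / real (Suc k))})"
    (is "?L \<longleftrightarrow> ?R")
proof
  assume L: ?L
  have c: "continuous_on {0..t} Z" using cont by (rule continuous_on_subset) auto
  obtain s1 where s1: "s1 \<in> {0..t}" "\<And>s. s \<in> {0..t} \<Longrightarrow> Z s \<le> Z s1"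
    using continuous_attains_sup[OF _ _ c] t by (auto simp: ball_simps)
  obtain s2 where s2: "s2 \<in> {0..t}" "\<And>s. s \<in> {0..t} \<Longrightarrow> Z s2 \<le> Z s"
    using continuous_attains_inf[OF _ _ c] t by (auto simp: ball_simps)
  obtain u v where u: "Z s1 = ereal u" "u < hi" and v: "Z s2 = ereal v" "lo < v"
    using L s1(1) s2(1) by (cases "Z s1"; cases "Z s2") fastforce+
  have "0 < min (hi - u) (v - lo)" using u v by simp
  then obtain k where k: "inverse (real (Suc k)) < min (hi - u) (v - lo)" using reals_Archimedean by blast
  show ?R
  proof (intro exI ballI)
    fix q assume q: "q \<in> {0..1::real} \<inter> \<rat>"
    have "t * q \<in> {0..t}" using q t mult_left_mono[of q 1 t] by auto
    then have "ereal v \<le> Z (t * q)" "Z (t * q) \<le> ereal u" using s1(2) s2(2) u v by auto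
    moreover have "lo + 1 / real (Suc k) \<le> v" "u \<le> hi - 1 / real (Suc k)" using k by (auto simp: inverse_eq_divide)
    ultimately show "Z (t * q) \<in> {ereal (lo + 1 / real (Suc k))..ereal (hi - 1 / real (Suc k))}"
      using order_trans[of "ereal (lo + 1 / real (Suc k))" "ereal v" "Z (t * q)"]
        order_trans[of "Z (t * q)" "ereal u" "ereal (hi - 1 / real (Suc k))"] by simp
  qed
next
  assume ?R
  then obtain k :: nat where k: "\<And>q. q \<in> {0..1} \<Longrightarrow> q \<in> \<rat> \<Longrightarrow> Z (t * q) \<in> {ereal (lo + 1 / real (Suc k))..ereal (hi - 1 / real (Suc k))}"
    by blast
  let ?C = "{ereal (lo + 1 / real (Suc k))..ereal (hi - 1 / real (Suc k))}"
  have C: "?C \<subseteq> {ereal lo<..<ereal hi}"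
  proof
    fix z assume z: "z \<in> ?C"
    have "ereal lo < ereal (lo + 1 / real (Suc k))" "ereal (hi - 1 / real (Suc k)) < ereal hi" by auto
    with z show "z \<in> {ereal lo<..<ereal hi}"
      using less_le_trans[of "ereal lo" "ereal (lo + 1 / real (Suc k))" z]
        le_less_trans[of z "ereal (hi - 1 / real (Suc k))" "ereal hi"] by simp
  qed
  show ?L
  proof (rule ballI, rule ccontr)
    fix s assume s: "s \<in> {0..t}" "Z s \<notin> {ereal lo<..<ereal hi}"
    have n: "Z s \<notin> ?C" using s(2) C by blast
    have "(Z \<longlongrightarrow> Z s) (at s within {0..})" using cont s(1) by (auto simp: continuous_on_def)
    then have "\<forall>\<^sub>F u in at s within {0..}. Z u \<in> - ?C"
      by (rule topological_tendstoD) (use n in auto)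
    then obtain d where d: "0 < d" "\<And>u. 0 \<le> u \<Longrightarrow> u \<noteq> s \<Longrightarrow> dist u s < d \<Longrightarrow> Z u \<notin> ?C"
      unfolding eventually_at by auto
    have "\<exists>q\<in>{0..1}. q \<in> \<rat> \<and> dist (t * q) s < d"
    proof (cases "s = t")
      case True then show ?thesis using d(1) by (intro bexI[of _ 1]) auto
    next
      case False
      then have st: "0 < t" "s < t" using s(1) by auto
      then have "s / t < min 1 ((s + d) / t)" using d(1) by (auto simp: divide_strict_right_mono)
      then obtain q where q: "q \<in> \<rat>" "s / t < q" "q < min 1 ((s + d) / t)" using Rats_dense_in_real by blast
      then have "s < t * q" "t * q < s + d" "q \<le> 1" using st by (auto simp: field_simps)
      moreover have "0 \<le> q" using q(2) s(1) st by (meson atLeastAtMost_iff divide_nonneg_pos less_imp_le order_trans)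
      ultimately show ?thesis using q(1) by (intro bexI[of _ q]) (auto simp: dist_real_def)
    qed
    then obtain q where q: "q \<in> {0..1}" "q \<in> \<rat>" "dist (t * q) s < d" by blast
    have "Z (t * q) \<in> ?C" by (rule k[OF q(1,2)])
    then show False using d(2)[of "t * q"] q t n by (cases "t * q = s") auto
  qed
qed

text \<open>The real horizon \<open>T\<close> makes the minimum finite even when neither
  \<open>S\<close> nor the exit occurs, so the conversion to a real number loses nothing.\<close>

definition exit_upto :: "ereal set \<Rightarrow> real \<Rightarrow> ('a \<Rightarrow> ennreal) \<Rightarrow> (real \<Rightarrow> 'a \<Rightarrow> ereal) \<Rightarrow> 'a \<Rightarrow> real" where
  "exit_upto A T S Y \<omega> = real_of_ereal (min (ereal T) (min (enn2ereal (S \<omega>)) (exit_time A Y \<omega>)))"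

lemma ereal_exit_upto:
  assumes "0 \<le> T"
  shows "ereal (exit_upto A T S Y \<omega>) = min (ereal T) (min (enn2ereal (S \<omega>)) (exit_time A Y \<omega>))"
proof -
  have "0 \<le> min (ereal T) (min (enn2ereal (S \<omega>)) (exit_time A Y \<omega>))" using assms by (simp add: exit_time_nonneg)
  moreover have "min (ereal T) (min (enn2ereal (S \<omega>)) (exit_time A Y \<omega>)) \<le> ereal T" by simp
  ultimately show ?thesis unfolding exit_upto_def
    by (cases "min (ereal T) (min (enn2ereal (S \<omega>)) (exit_time A Y \<omega>))") auto
qed

lemma exit_upto_range:
  assumes "0 \<le> T"
  shows "exit_upto A T S Y \<omega> \<in> {0..T}"
proof -
  have "ereal 0 \<le> ereal (exit_upto A T S Y \<omega>)" "ereal (exit_upto A T S Y \<omega>) \<le> ereal T"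
    unfolding ereal_exit_upto[OF assms] using assms by (auto simp: exit_time_nonneg zero_ereal_def[symmetric])
  then show ?thesis by simp
qed

text \<open>The expression of interest evaluates the unmodified \<open>Y\<close> at a random time
  and is not claimed to be measurable. A measurable majorant \<open>D\<close> with the same bound is
  provided instead, because the later use of Fatou's lemma needs measurable functions.\<close>

lemma drifted_process_lyapunov:
  fixes \<phi> \<phi>' \<phi>'' \<theta> h :: "real \<Rightarrow> real" and Y :: "real \<Rightarrow> 'a \<Rightarrow> ereal" and r :: ereal
  assumes fps: "filtered_prob_space Q F" and bm: "brownian_motion Q F W"
    and dp: "drifted_process Q F r h c x W Y"
    and lo: "0 < lo" "lo < x" and hi: "x < hi" "ereal hi < r"
    and T: "0 < T" and S: "stopping_time F S"
    and b_cont: "continuous_on {lo..hi} (\<lambda>y. deriv h y / h y + c)"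
    and d1: "\<And>z. z \<in> {lo..hi} \<Longrightarrow> (\<phi> has_real_derivative \<phi>' z) (at z)"
    and d2: "\<And>z. z \<in> {lo..hi} \<Longrightarrow> (\<phi>' has_real_derivative \<phi>'' z) (at z)"
    and lip: "L-lipschitz_on {lo..hi} \<phi>''"
    and \<phi>_nn: "\<And>z. z \<in> {lo..hi} \<Longrightarrow> 0 \<le> \<phi> z"
    and \<theta>: "continuous_on {lo..hi} \<theta>" "\<And>z. z \<in> {lo..hi} \<Longrightarrow> 0 \<le> \<theta> z"
    and K: "0 < K"
    and gen: "\<And>y. y \<in> {lo..hi} \<Longrightarrow> \<phi>'' y / 2 + (deriv h y / h y + c) * \<phi>' y \<le> K * \<phi> y - \<theta> y"
  shows "\<exists>D\<in>borel_measurable Q. (\<integral>\<^sup>+ \<omega>. D \<omega> \<partial>Q) \<le> ennreal (exp (2 * K * T) * \<phi> x) \<and>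
    (AE \<omega> in Q. let u = exit_upto {ereal lo<..<ereal hi} T S Y \<omega> in
      ennreal (\<phi> (real_of_ereal (Y u \<omega>))) + (\<integral>\<^sup>+ s\<in>{0..u}. ennreal (\<theta> (real_of_ereal (Y s \<omega>))) \<partial>lborel) \<le> D \<omega>)"
proof -
  interpret Q: prob_space Q using fps by (simp add: filtered_prob_space_def)
  interpret filtration "space Q" F using fps by (simp add: filtered_prob_space_def)
  have sub: "subalgebra Q (F t)" for t using fps by (simp add: filtered_prob_space_def)
  have setsF: "A \<in> sets Q" if "A \<in> sets (F t)" for A t using sub[of t] that by (auto simp: subalgebra_def)
  let ?A = "{ereal lo<..<ereal hi}"
  have lohi: "lo \<le> hi" using lo hi by simp
  have W_ad: "\<And>t. 0 \<le> t \<Longrightarrow> W t \<in> borel_measurable (F (ennreal t))"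
    and W_ae: "AE \<omega> in Q. W 0 \<omega> = 0 \<and> continuous_on {0..} (\<lambda>t. W t \<omega>)"
    and W_inc: "\<And>s t. 0 \<le> s \<Longrightarrow> s < t \<Longrightarrow> distributed Q lborel (\<lambda>\<omega>. W t \<omega> - W s \<omega>) (normal_density 0 (sqrt (t - s)))"
    and W_ind: "\<And>s t. 0 \<le> s \<Longrightarrow> s < t \<Longrightarrow> Q.indep_set (sets (F (ennreal s))) {(\<lambda>\<omega>. W t \<omega> - W s \<omega>) -` A \<inter> space Q | A. A \<in> sets borel}"
    using bm by (auto simp: brownian_motion_def adapted_def)
  have Y_ad: "\<And>t. 0 \<le> t \<Longrightarrow> Y t \<in> borel_measurable (F (ennreal t))"
    and Y_ae: "AE \<omega> in Q. continuous_on {0..} (\<lambda>t. Y t \<omega>) \<and> (\<forall>t\<ge>0. Y t \<omega> \<in> {0..r}) \<and> Y 0 \<omega> = ereal x \<and>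
        (\<forall>t\<ge>0. ereal t < lifetime r Y \<omega> \<longrightarrow> real_of_ereal (Y t \<omega>) = x + W t \<omega> +
             (LBINT s:{0..t}. (deriv h (real_of_ereal (Y s \<omega>)) / h (real_of_ereal (Y s \<omega>)) + c)))"
    using dp by (auto simp: drifted_process_def adapted_def)
  have "\<exists>N\<in>null_sets Q. \<forall>\<omega>\<in>space Q - N. P \<omega>" if "AE \<omega> in Q. P \<omega>" for P
    using AE_E3[OF that] by metis
  note null = this
  define good where "good \<omega> \<longleftrightarrow> (W 0 \<omega> = 0 \<and> continuous_on {0..} (\<lambda>t. W t \<omega>)) \<and>
      (continuous_on {0..} (\<lambda>t. Y t \<omega>) \<and> (\<forall>t\<ge>0. Y t \<omega> \<in> {0..r}) \<and> Y 0 \<omega> = ereal x \<and>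
        (\<forall>t\<ge>0. ereal t < lifetime r Y \<omega> \<longrightarrow> real_of_ereal (Y t \<omega>) = x + W t \<omega> +
             (LBINT s:{0..t}. (deriv h (real_of_ereal (Y s \<omega>)) / h (real_of_ereal (Y s \<omega>)) + c))))" for \<omega>
  have "AE \<omega> in Q. good \<omega>" unfolding good_def by (rule AE_conjI[OF W_ae Y_ae])
  from null[OF this] obtain N where N: "N \<in> null_sets Q" and "\<And>\<omega>. \<omega> \<in> space Q - N \<Longrightarrow> good \<omega>" by blast
  note good = this(2)[unfolded good_def]
  have NQ[measurable]: "N \<in> sets Q" using N by auto
  have AEN: "AE \<omega> in Q. \<omega> \<notin> N" using N by (rule AE_not_in)
  \<comment> \<open>On the exceptional null set \<open>N\<close> the paths are replaced by trivial
    ones (\<open>W' = 0\<close>, \<open>R = x\<close>, \<open>\<eta> = 0\<close>), so the pathwise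
    assumptions hold for every \<open>\<omega>\<close>; the augmented filtration absorbs the change.
    Clamping happens before the conversion to reals, so infinite values of \<open>Y\<close> do no
    harm.\<close>
  define W' where "W' t \<omega> = (if \<omega> \<in> N then 0 else W t \<omega>)" for t \<omega>
  define R0 where "R0 t \<omega> = real_of_ereal (max (ereal lo) (min (ereal hi) (Y t \<omega>)))" for t \<omega>
  define R where "R t \<omega> = (if \<omega> \<in> N then x else R0 t \<omega>)" for t \<omega>
  define b where "b y = (\<lambda>y. deriv h y / h y + c) (clamp_to lo hi y)" for y
  define \<theta>' where "\<theta>' y = \<theta> (clamp_to lo hi y)" for y
  define \<eta> where "\<eta> \<omega> = (if \<omega> \<in> N then 0 else exit_upto ?A T S Y \<omega>)" for \<omega>
  have bc: "continuous_on UNIV b" unfolding b_def by (rule continuous_on_compose_clamp[OF lohi b_cont])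
  have \<theta>c: "continuous_on UNIV \<theta>'" unfolding \<theta>'_def by (rule continuous_on_compose_clamp[OF lohi \<theta>(1)])
  have "bounded ((\<lambda>y. deriv h y / h y + c) ` {lo..hi})"
    by (intro compact_imp_bounded compact_continuous_image b_cont) simp
  then obtain B where "\<And>y. y \<in> {lo..hi} \<Longrightarrow> \<bar>deriv h y / h y + c\<bar> \<le> B" unfolding bounded_iff real_norm_def by blast
  then have B: "\<bar>b y\<bar> \<le> B" for y unfolding b_def using clamp_to_in[OF lohi] by blast
  have WQ: "W t \<in> borel_measurable Q" if "0 \<le> t" for t using measurable_from_subalg[OF sub W_ad[OF that]] .
  have W'Q: "W' t \<in> borel_measurable Q" if "0 \<le> t" for t
    unfolding W'_def[abs_def] using WQ[OF that] by measurable
  have AEW: "AE \<omega> in Q. W' t \<omega> - W' s \<omega> = W t \<omega> - W s \<omega>" for s t using AEN by eventually_elim (simp add: W'_def)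
  have R0F: "R0 t \<in> borel_measurable (F (ennreal t))" if "0 \<le> t" for t
    unfolding R0_def[abs_def] using Y_ad[OF that] by measurable
  have R0Q: "R0 t \<in> borel_measurable Q" if "0 \<le> t" for t using measurable_from_subalg[OF sub R0F[OF that]] .
  have RQ: "R t \<in> borel_measurable Q" if "0 \<le> t" for t
    unfolding R_def[abs_def] using R0Q[OF that] by measurable
  have R0_Y: "R0 t \<omega> = real_of_ereal (Y t \<omega>)" if "Y t \<omega> \<in> {ereal lo..ereal hi}" for t \<omega>
    using that by (auto simp: R0_def)
  have R0r: "R0 t \<omega> \<in> {lo..hi}" for t \<omega>
  proof -
    have "ereal lo \<le> max (ereal lo) (min (ereal hi) (Y t \<omega>))" "max (ereal lo) (min (ereal hi) (Y t \<omega>)) \<le> ereal hi"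
      using lohi by auto
    then show ?thesis unfolding R0_def by (cases "max (ereal lo) (min (ereal hi) (Y t \<omega>))") auto
  qed
  have R0c: "continuous_on {0..} (\<lambda>t. R0 t \<omega>)" if "\<omega> \<in> space Q - N" for \<omega>
  proof -
    have c: "continuous_on {0..} (\<lambda>t. max (ereal lo) (min (ereal hi) (Y t \<omega>)))"
      using good[OF that] by (intro continuous_intros) auto
    have fin: "max (ereal lo) (min (ereal hi) (Y t \<omega>)) \<in> UNIV - {\<infinity>, -\<infinity>}" for t
      using lohi by (cases "Y t \<omega>") (auto simp: max_def min_def)
    show ?thesis unfolding R0_def
      by (rule continuous_on_compose2[OF continuous_on_real c]) (rule image_subsetI, rule fin)
  qed
  have \<eta>lt: "t < \<eta> \<omega> \<longleftrightarrow> t < T \<and> ennreal t < S \<omega> \<and> (\<forall>s\<in>{0..t}. Y s \<omega> \<in> ?A)"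
    if \<omega>: "\<omega> \<in> space Q - N" and t: "0 \<le> t" for t \<omega>
  proof -
    have T0: "0 \<le> T" using T by simp
    have "t < \<eta> \<omega> \<longleftrightarrow> ereal t < ereal (exit_upto ?A T S Y \<omega>)" using \<omega> by (simp add: \<eta>_def)
    also have "\<dots> \<longleftrightarrow> ereal t < ereal T \<and> ereal t < enn2ereal (S \<omega>) \<and> ereal t < exit_time ?A Y \<omega>"
      unfolding ereal_exit_upto[OF T0] by auto
    also have "ereal t < enn2ereal (S \<omega>) \<longleftrightarrow> ennreal t < S \<omega>" using t by (simp add: less_ennreal.rep_eq enn2ereal_ennreal)
    also have "ereal t < exit_time ?A Y \<omega> \<longleftrightarrow> (\<forall>s\<in>{0..t}. Y s \<omega> \<in> ?A)"
      by (rule exit_time_gt_iff) (use good[OF \<omega>] t in auto)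
    finally show ?thesis by simp
  qed
  have before: "Y s \<omega> \<in> {ereal lo..ereal hi}" if \<omega>: "\<omega> \<in> space Q - N" and s: "0 \<le> s" "s \<le> \<eta> \<omega>" for s \<omega>
  proof (rule exit_time_closed[where A="?A" and Y=Y and t=s])
    show "ereal s \<le> exit_time ?A Y \<omega>"
    proof -
      have "ereal s \<le> ereal (exit_upto ?A T S Y \<omega>)" using s \<omega> by (simp add: \<eta>_def)
      also have "\<dots> \<le> exit_time ?A Y \<omega>" using T by (simp add: ereal_exit_upto min.coboundedI2)
      finally show ?thesis .
    qed
  qed (use good[OF \<omega>] lo hi s in auto)
  have RY: "R s \<omega> = real_of_ereal (Y s \<omega>)" if \<omega>: "\<omega> \<in> space Q - N" and s: "0 \<le> s" "s \<le> \<eta> \<omega>" for s \<omega>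
    using R0_Y[OF before[OF that]] \<omega> by (simp add: R_def)
  interpret D: drifted_brownian Q "\<lambda>t. augment Q (F (ennreal t))" W' R b lo hi B x
  proof unfold_locales
    fix s t :: real and \<omega>
    show "0 \<le> t \<Longrightarrow> subalgebra Q (augment Q (F (ennreal t)))" by (rule subalgebra_augment[OF sub])
    show "W' 0 \<omega> = 0" if "\<omega> \<in> space Q"
    proof (cases "\<omega> \<in> N")
      case False
      then have "W 0 \<omega> = 0" using good[of \<omega>] that by blast
      then show ?thesis by (simp add: W'_def)
    qed (simp add: W'_def)
    show "continuous_on {0..} (\<lambda>t. W' t \<omega>)" if "\<omega> \<in> space Q"
    proof (cases "\<omega> \<in> N")
      case False
      then have "continuous_on {0..} (\<lambda>t. W t \<omega>)" using good[of \<omega>] that by blast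
      then show ?thesis using False by (simp add: W'_def)
    qed (simp add: W'_def)
    show "distributed Q lborel (\<lambda>\<omega>. W' t \<omega> - W' s \<omega>) (\<lambda>x. ennreal (normal_density 0 (sqrt (t - s)) x))" if "0 \<le> s" "s < t"
      by (rule distributed_cong_AE[OF W_inc[OF that] _ AEW]) (use W'Q[of s] W'Q[of t] that in simp)
    show "Q.indep_set (sets (augment Q (F (ennreal s)))) {(\<lambda>\<omega>. W' t \<omega> - W' s \<omega>) -` A \<inter> space Q | A. A \<in> sets borel}" if "0 \<le> s" "s < t"
      by (rule Q.indep_set_augment[OF sub W_ind[OF that] _ AEW]) (use W'Q[of s] W'Q[of t] that in simp)
    show "R t \<in> borel_measurable (augment Q (F (ennreal t)))" if "0 \<le> t"
      by (rule measurable_augment[OF sub R0F[OF that] RQ[OF that]]) (use AEN in eventually_elim, simp add: R_def)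
    show "\<omega> \<in> space Q \<Longrightarrow> continuous_on {0..} (\<lambda>t. R t \<omega>)" using R0c[of \<omega>] by (cases "\<omega> \<in> N") (auto simp: R_def)
    show "R t \<omega> \<in> {lo..hi}" using R0r[of t \<omega>] lo hi by (simp add: R_def)
    show "R 0 \<omega> = x" if \<omega>: "\<omega> \<in> space Q"
    proof (cases "\<omega> \<in> N")
      case False
      then have "Y 0 \<omega> = ereal x" using good[of \<omega>] \<omega> by blast
      then show ?thesis using False lo hi by (simp add: R_def R0_Y)
    qed (simp add: R_def)
    show "continuous_on UNIV b" by (rule bc)
    show "\<And>y. \<bar>b y\<bar> \<le> B" by (rule B)
  qed
  \<comment> \<open>The set \<open>E\<close> is built from coordinates at times
    \<open>t * q\<close>, all at most \<open>t\<close>, and thus lies in \<open>F t\<close>.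
    Removing \<open>N\<close> from it gives the exact event, which is why the augmentation is used
    here.\<close>
  have stop: "{\<omega> \<in> space Q. t < \<eta> \<omega>} \<in> sets (augment Q (F (ennreal t)))" if t: "0 \<le> t" for t
  proof -
    define P where "P k q = {\<omega> \<in> space Q. Y (t * q) \<omega> \<in> {ereal (lo + 1 / real (Suc k))..ereal (hi - 1 / real (Suc k))}}" for k :: nat and q
    have P: "P k q \<in> sets (F (ennreal t))" if q: "q \<in> {0..1}" for k q
    proof -
      have "Y (t * q) -` {ereal (lo + 1 / real (Suc k))..ereal (hi - 1 / real (Suc k))} \<inter> space (F (ennreal (t * q))) \<in> sets (F (ennreal (t * q)))"
        by (rule measurable_sets[OF Y_ad]) (use t q in auto)
      moreover have "sets (F (ennreal (t * q))) \<subseteq> sets (F (ennreal t))"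
        using t q mult_left_mono[of q 1 t] by (intro sets_F_mono ennreal_leI) auto
      moreover have "Y (t * q) -` {ereal (lo + 1 / real (Suc k))..ereal (hi - 1 / real (Suc k))} \<inter> space (F (ennreal (t * q))) = P k q"
        by (auto simp: P_def space_F)
      ultimately show ?thesis by (simp only: subset_iff)
    qed
    define E where "E = {\<omega> \<in> space Q. t < T \<and> ennreal t < S \<omega>} \<inter> (\<Union>k. \<Inter>q\<in>{0..1} \<inter> \<rat>. P k q)"
    have EF: "E \<in> sets (F (ennreal t))"
    proof -
      have "{\<omega> \<in> space Q. t < T \<and> ennreal t < S \<omega>} \<in> sets (F (ennreal t))"
      proof (cases "t < T")
        case True
        then show ?thesis using stopping_timeD2[OF S, of "ennreal t"] by (simp add: Measurable.pred_def space_F)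
      qed simp
      moreover have "(\<Inter>q\<in>{0..1} \<inter> \<rat>. P k q) \<in> sets (F (ennreal t))" for k
      proof (rule sets.countable_INT')
        have "(0::real) \<in> {0..1} \<inter> \<rat>" by simp
        then show "{0..1::real} \<inter> \<rat> \<noteq> {}" by blast
        show "countable ({0..1::real} \<inter> \<rat>)" by (rule countable_Int2[OF countable_rat])
      qed (use P in blast)
      then have "(\<Union>k. \<Inter>q\<in>{0..1} \<inter> \<rat>. P k q) \<in> sets (F (ennreal t))" by (intro sets.countable_UN) blast
      ultimately show ?thesis unfolding E_def by (rule sets.Int)
    qed
    have "{\<omega> \<in> space Q. t < \<eta> \<omega>} = E - N"
    proof (intro set_eqI)
      fix \<omega>
      show "\<omega> \<in> {\<omega> \<in> space Q. t < \<eta> \<omega>} \<longleftrightarrow> \<omega> \<in> E - N"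
      proof (cases "\<omega> \<in> space Q - N")
        case True
        have "(\<forall>s\<in>{0..t}. Y s \<omega> \<in> ?A) \<longleftrightarrow> \<omega> \<in> (\<Union>k. \<Inter>q\<in>{0..1} \<inter> \<rat>. P k q)"
          using path_in_interval_iff[of "\<lambda>s. Y s \<omega>" t lo hi] good[OF True] t True unfolding P_def by auto
        then show ?thesis using \<eta>lt[OF True t] True by (auto simp: E_def)
      next
        case False
        then show ?thesis using t by (auto simp: \<eta>_def E_def)
      qed
    qed
    moreover have "E - N \<in> sets (augment Q (F (ennreal t)))"
    proof -
      have "AE \<omega> in Q. \<omega> \<in> E - N \<longleftrightarrow> \<omega> \<in> E" using AEN by eventually_elim simp
      then show ?thesis using EF setsF[OF EF] NQ unfolding sets_augment[OF sub] by blast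
    qed
    ultimately show ?thesis by simp
  qed
  have \<eta>r: "\<eta> \<omega> \<in> {0..T}" for \<omega> using exit_upto_range[of T ?A S Y \<omega>] T by (simp add: \<eta>_def)
  have ZR: "D.Z t \<omega> = R t \<omega>" if \<omega>: "\<omega> \<in> space Q" and t: "0 \<le> t" "t \<le> \<eta> \<omega>" for t \<omega>
  proof (cases "\<omega> \<in> N")
    case True
    then have "t = 0" using t by (simp add: \<eta>_def)
    then show ?thesis using D.Z_0[OF \<omega>] D.R_0[OF \<omega>] by simp
  next
    case False
    then have g: "\<omega> \<in> space Q - N" using \<omega> by simp
    \<comment> \<open>Up to \<open>\<eta>\<close> the path stays in the closed interval
      \<open>[lo,hi]\<close> inside \<open>(0,r)\<close>. The lifetime is strictly later, and the
      integral equation is available at \<open>t\<close> even if \<open>t\<close> is the exit time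
      itself.\<close>
    have "ereal t < lifetime r Y \<omega>"
      unfolding lifetime_def
    proof (subst exit_time_gt_iff)
      show "\<forall>s\<in>{0..t}. Y s \<omega> \<in> {0<..<r}"
      proof
        fix s assume "s \<in> {0..t}"
        then have "Y s \<omega> \<in> {ereal lo..ereal hi}" using before[OF g, of s] t by simp
        moreover have "0 < ereal lo" using lo by simp
        ultimately show "Y s \<omega> \<in> {0<..<r}"
          using hi(2) less_le_trans[of 0 "ereal lo" "Y s \<omega>"] le_less_trans[of "Y s \<omega>" "ereal hi" r] by simp
      qed
    qed (use good[OF g] t in auto)
    then have "real_of_ereal (Y t \<omega>) = x + W t \<omega> + (LBINT s:{0..t}. (deriv h (real_of_ereal (Y s \<omega>)) / h (real_of_ereal (Y s \<omega>)) + c))"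
      using good[OF g] t(1) by blast
    also have "(LBINT s:{0..t}. (deriv h (real_of_ereal (Y s \<omega>)) / h (real_of_ereal (Y s \<omega>)) + c)) = D.J b t \<omega>"
      unfolding D.J_def
    proof (rule set_lebesgue_integral_cong)
      show "\<forall>s. s \<in> {0..t} \<longrightarrow> deriv h (real_of_ereal (Y s \<omega>)) / h (real_of_ereal (Y s \<omega>)) + c = b (R s \<omega>)"
      proof (intro allI impI)
        fix s assume "s \<in> {0..t}"
        then have "real_of_ereal (Y s \<omega>) = R s \<omega>" using RY[OF g, of s] t by simp
        then show "deriv h (real_of_ereal (Y s \<omega>)) / h (real_of_ereal (Y s \<omega>)) + c = b (R s \<omega>)"
          using clamp_to_id[OF D.R_range[OF _ \<omega>, of s]] \<open>s \<in> {0..t}\<close> by (simp add: b_def)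
      qed
    qed simp
    finally show ?thesis using RY[OF g t] False by (simp add: D.Z_def W'_def)
  qed
  have gen': "\<phi>'' y / 2 + b y * \<phi>' y \<le> K * \<phi> y - \<theta>' y" if "y \<in> {lo..hi}" for y
    using gen[OF that] clamp_to_id[OF that] by (simp add: b_def \<theta>'_def)
  have \<theta>nn: "0 \<le> \<theta>' y" for y unfolding \<theta>'_def using \<theta>(2) clamp_to_in[OF lohi] by blast
  note Lyap = D.lyapunov[OF T \<eta>r stop ZR d1 d2 lip \<phi>_nn \<theta>c \<theta>nn K gen']
  show ?thesis
  proof (intro bexI conjI)
    show "(\<lambda>\<omega>. ennreal (\<phi> (R (\<eta> \<omega>) \<omega>) + D.J \<theta>' (\<eta> \<omega>) \<omega>)) \<in> borel_measurable Q" using Lyap(1) by measurable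
    show "(\<integral>\<^sup>+ \<omega>. ennreal (\<phi> (R (\<eta> \<omega>) \<omega>) + D.J \<theta>' (\<eta> \<omega>) \<omega>) \<partial>Q) \<le> ennreal (exp (2 * K * T) * \<phi> x)" by (rule Lyap(2))
    have "\<omega> \<in> space Q - N \<Longrightarrow> let u = exit_upto ?A T S Y \<omega> in
      ennreal (\<phi> (real_of_ereal (Y u \<omega>))) + (\<integral>\<^sup>+ s\<in>{0..u}. ennreal (\<theta> (real_of_ereal (Y s \<omega>))) \<partial>lborel)
        \<le> ennreal (\<phi> (R (\<eta> \<omega>) \<omega>) + D.J \<theta>' (\<eta> \<omega>) \<omega>)" for \<omega>
    proof -
      assume g: "\<omega> \<in> space Q - N"
      have \<omega>: "\<omega> \<in> space Q" using g by simp
      have e: "exit_upto ?A T S Y \<omega> = \<eta> \<omega>" using g by (simp add: \<eta>_def)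
      have nn: "0 \<le> \<eta> \<omega>" using \<eta>r[of \<omega>] by simp
      have 1: "real_of_ereal (Y (\<eta> \<omega>) \<omega>) = R (\<eta> \<omega>) \<omega>" using RY[OF g nn] by simp
      have "(\<integral>\<^sup>+ s\<in>{0..\<eta> \<omega>}. ennreal (\<theta> (real_of_ereal (Y s \<omega>))) \<partial>lborel) = (\<integral>\<^sup>+ s. ennreal (indicator {0..\<eta> \<omega>} s *\<^sub>R \<theta>' (R s \<omega>)) \<partial>lborel)"
      proof (rule nn_integral_cong)
        fix s
        show "ennreal (\<theta> (real_of_ereal (Y s \<omega>))) * indicator {0..\<eta> \<omega>} s = ennreal (indicator {0..\<eta> \<omega>} s *\<^sub>R \<theta>' (R s \<omega>))"
          using RY[OF g, of s] clamp_to_id[OF D.R_range[OF _ \<omega>, of s]] by (auto simp: indicator_def \<theta>'_def)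
      qed
      also have "\<dots> = ennreal (D.J \<theta>' (\<eta> \<omega>) \<omega>)"
        unfolding D.J_def set_lebesgue_integral_def
        by (rule nn_integral_eq_integral)
          (use D.gR_integrable[OF \<theta>c \<omega>, of 0 "\<eta> \<omega>"] \<theta>nn in \<open>auto simp: set_integrable_def indicator_def\<close>)
      finally have 2: "(\<integral>\<^sup>+ s\<in>{0..\<eta> \<omega>}. ennreal (\<theta> (real_of_ereal (Y s \<omega>))) \<partial>lborel) = ennreal (D.J \<theta>' (\<eta> \<omega>) \<omega>)" .
      have 3: "0 \<le> \<phi> (R (\<eta> \<omega>) \<omega>)" by (rule \<phi>_nn[OF D.R_range[OF nn \<omega>]])
      have 4: "0 \<le> D.J \<theta>' (\<eta> \<omega>) \<omega>" by (rule D.J_nonneg[OF \<theta>nn \<omega>])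
      show ?thesis unfolding e Let_def 1 2 using 3 4 by (simp add: ennreal_plus)
    qed
    then show "AE \<omega> in Q. let u = exit_upto ?A T S Y \<omega> in
      ennreal (\<phi> (real_of_ereal (Y u \<omega>))) + (\<integral>\<^sup>+ s\<in>{0..u}. ennreal (\<theta> (real_of_ereal (Y s \<omega>))) \<partial>lborel)
        \<le> ennreal (\<phi> (R (\<eta> \<omega>) \<omega>) + D.J \<theta>' (\<eta> \<omega>) \<omega>)"
      using AEN AE_space[of Q] by (auto elim!: eventually_elim2)
  qed
qed


subsection \<open>The functions in \<open>\<H>\<^sub>0\<close>\<close>

text \<open>The convention \<open>1 / \<infinity> = 0\<close> merges the two cases of the potential
  density into one formula.\<close>

definition inv_endpoint :: "ereal \<Rightarrow> real" where
  "inv_endpoint r = (if r = \<infinity> then 0 else 1 / real_of_ereal r)"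

lemma inv_endpoint_nonneg: "0 < r \<Longrightarrow> 0 \<le> inv_endpoint r"
  by (cases r) (auto simp: inv_endpoint_def)

lemma state_spaceD:
  assumes "x \<in> state_space r"
  shows "0 < x" "inv_endpoint r * x < 1"
  using assms by (cases r; auto simp: state_space_def inv_endpoint_def)+

lemma potential_density_eq: "potential_density r x y = min x y * (1 - inv_endpoint r * max x y)"
  by (simp add: potential_density_def inv_endpoint_def)

lemma open_state_space: "open (state_space r)"
proof -
  have "state_space r = {0<..} \<inter> ereal -` {..<r}" by (auto simp: state_space_def)
  then show ?thesis by (simp only: open_Int open_greaterThan open_lessThan open_vimage continuous_on_ereal continuous_on_id)
qed

lemma state_space_between:
  assumes "x \<in> state_space r" "y \<in> state_space r" "x \<le> z" "z \<le> y"
  shows "z \<in> state_space r"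
proof -
  have "ereal z \<le> ereal y" "ereal y < r" "0 < x" using assms by (simp_all add: state_space_def)
  then have "ereal z < r" "0 < z" using assms(3) le_less_trans[of "ereal z" "ereal y" r] less_le_trans[of 0 x z] by blast+
  then show ?thesis unfolding state_space_def by blast
qed

lemma state_space_nonempty:
  assumes "0 < r"
  obtains m where "m \<in> state_space r"
  using ereal_dense2[OF assms] that by (auto simp: state_space_def)

text \<open>Only local continuity is assumed, because the integrands may be unbounded near the
  boundary. The integral is split at \<open>a\<close> into a constant and an ordinary integral over
  a region of continuity.\<close>

lemma has_real_derivative_cumulative:
  fixes F :: "real \<Rightarrow> real"
  assumes F: "integrable lborel F" and ab: "a < x" "x < b" and c: "continuous_on {a..b} F"
  shows "((\<lambda>z. \<integral>y. indicator {..z} y * F y \<partial>lborel) has_real_derivative F x) (at x)"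
proof -
  have si: "set_integrable lborel A F" if "A \<in> sets borel" for A
    unfolding set_integrable_def using integrable_mult_indicator[OF _ F, of A] that by simp
  have eq: "(\<integral>y. indicator {..z} y * F y \<partial>lborel) = (LBINT y:{..a}. F y) + integral {a..z} F" if z: "a \<le> z" for z
  proof -
    have "(\<integral>y. indicator {..z} y * F y \<partial>lborel) = (LBINT y:{..a} \<union> {a..z}. F y)"
      unfolding set_lebesgue_integral_def using z by (simp add: ivl_disj_un_two_touch)
        (auto intro!: Bochner_Integration.integral_cong simp: indicator_def)
    also have "\<dots> = (LBINT y:{..a}. F y) + (LBINT y:{a..z}. F y)"
    proof (rule set_integral_Un_AE)
      show "AE y in lborel. \<not> (y \<in> {..a} \<and> y \<in> {a..z})" using AE_lborel_singleton[of a] by eventually_elim auto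
    qed (auto intro: si)
    also have "(LBINT y:{a..z}. F y) = integral {a..z} F" by (rule set_borel_integral_eq_integral(2)[OF si]) simp
    finally show ?thesis .
  qed
  have "((\<lambda>z. integral {a..z} F) has_real_derivative F x) (at x within {a..b})"
    by (rule integral_has_real_derivative[OF c]) (use ab in auto)
  then have "((\<lambda>z. integral {a..z} F) has_real_derivative F x) (at x)"
    using ab by (simp add: at_within_Icc_at)
  then have "((\<lambda>z. (LBINT y:{..a}. F y) + integral {a..z} F) has_real_derivative F x) (at x)"
    by (auto intro!: derivative_eq_intros)
  then show ?thesis
    by (rule has_field_derivative_transform_within_open[where S="{a<..}"]) (use ab eq in auto)
qed

lemma integral_pos_of_pos_on_open:
  fixes F :: "real \<Rightarrow> real"
  assumes F: "integrable lborel F" and nn: "\<And>y. 0 \<le> F y" and pos: "\<And>y. a < y \<Longrightarrow> y < b \<Longrightarrow> 0 < F y" and ab: "a < b"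
  shows "0 < (\<integral>y. F y \<partial>lborel)"
proof (rule ccontr)
  assume "\<not> ?thesis"
  moreover have "0 \<le> (\<integral>y. F y \<partial>lborel)" using nn by simp
  ultimately have "(\<integral>y. F y \<partial>lborel) = 0" by simp
  then have "AE y in lborel. F y = 0" using integral_nonneg_eq_0_iff_AE[OF F] nn by simp
  then have "AE y in lborel. y \<notin> {a<..<b}" by eventually_elim (use pos in force)
  then have "{a<..<b} \<in> null_sets lborel" by (subst AE_iff_null_sets) auto
  then show False using ab by (auto simp: null_sets_def)
qed

text \<open>Here \<open>G = h''\<close>, and \<open>m\<close> is an arbitrary point that separates the two boundaries. For \<open>r = \<infinity>\<close>
  the factor \<open>1 - inv_endpoint r * x\<close> is \<open>1\<close>.\<close>

locale H0_profile =
  fixes r :: ereal and h h' G :: "real \<Rightarrow> real" and m \<kappa> H :: real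
  assumes r: "0 < r"
    and dh: "\<And>x. x \<in> state_space r \<Longrightarrow> (h has_real_derivative h' x) (at x)"
    and dh': "\<And>x. x \<in> state_space r \<Longrightarrow> (h' has_real_derivative G x) (at x)"
    and cG: "continuous_on (state_space r) G" and m: "m \<in> state_space r" and \<kappa>: "0 < \<kappa>" and H: "0 < H"
    and low1: "\<And>x. x \<in> state_space r \<Longrightarrow> x \<le> m \<Longrightarrow> \<kappa> * x \<le> h x"
    and low2: "\<And>x. x \<in> state_space r \<Longrightarrow> m \<le> x \<Longrightarrow> \<kappa> * (1 - inv_endpoint r * x) \<le> h x"
    and up1: "\<And>x. x \<in> state_space r \<Longrightarrow> h x \<le> H * x"
    and up2: "\<And>x. x \<in> state_space r \<Longrightarrow> h x \<le> H * (1 - inv_endpoint r * x)"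
    and h'b: "\<And>x. x \<in> state_space r \<Longrightarrow> \<bar>h' x\<bar> \<le> H"
    and xh: "\<And>x. x \<in> state_space r \<Longrightarrow> r = \<infinity> \<Longrightarrow> x * h' x \<le> h x"

text \<open>The upper and lower bounds for \<open>h\<close> come from comparing the potential
  density with a product of a function of \<open>x\<close> and a weight in \<open>y\<close> that
  does not depend on \<open>x\<close>. Integrating the weight gives the constant: it is finite by
  the two integrability conditions on \<open>f\<close>, and positive because \<open>f\<close>
  is.\<close>

lemma H0_profile_exists:
  fixes h \<sigma> :: "real \<Rightarrow> real" and r :: ereal
  assumes r: "0 < r" and sc: "standing_coefficient r \<sigma>" and h: "h \<in> H0 r \<sigma>"
  shows "\<exists>h' G m \<kappa> H. H0_profile r h h' G m \<kappa> H"
proof -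
  let ?I = "state_space r" and ?\<rho> = "inv_endpoint r"
  note \<rho>0 = inv_endpoint_nonneg[OF r]
  note I = state_spaceD[where r=r]
  have IM[measurable]: "?I \<in> sets borel" using open_state_space by (rule borel_open)
  from h obtain f where f: "\<And>y. y \<in> ?I \<Longrightarrow> 0 < f y" "continuous_on ?I f"
      "set_integrable (speed_measure r \<sigma>) ?I f" "set_integrable (speed_measure r \<sigma>) ?I (\<lambda>y. y * f y)"
      and hx: "\<And>x. x \<in> ?I \<Longrightarrow> h x = (LINT y:?I|speed_measure r \<sigma>. potential_density r x y * f y)"
    unfolding H0_def by blast
  have \<sigma>: "\<And>x. x \<in> ?I \<Longrightarrow> 0 < \<sigma> x" "continuous_on ?I \<sigma>"
    using sc C1_differentiable_imp_continuous_on unfolding standing_coefficient_def by blast+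
  define d where "d y = indicator ?I y * (2 / (\<sigma> y)\<^sup>2)" for y
  \<comment> \<open>The density of \<open>f dm\<close> with respect to Lebesgue measure. In this
    proof \<open>G = - h''\<close>; the sign is reversed when the result is assembled.\<close>
  define G where "G y = indicator ?I y * (2 / (\<sigma> y)\<^sup>2 * f y)" for y
  have cG: "continuous_on ?I (\<lambda>y. 2 / (\<sigma> y)\<^sup>2 * f y)"
    using \<sigma> f(2) by (intro continuous_intros) (auto dest!: \<sigma>(1))
  have dM[measurable]: "d \<in> borel_measurable borel"
    unfolding d_def[abs_def] using borel_measurable_continuous_on_indicator[OF IM, of "\<lambda>y. 2 / (\<sigma> y)\<^sup>2"] \<sigma>
    by (fastforce intro!: continuous_intros)
  have GM[measurable]: "G \<in> borel_measurable borel"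
    unfolding G_def[abs_def] using borel_measurable_continuous_on_indicator[OF IM cG] by simp
  have fM[measurable]: "(\<lambda>y. indicator ?I y * f y) \<in> borel_measurable borel"
    using borel_measurable_continuous_on_indicator[OF IM f(2)] by simp
  have sm: "speed_measure r \<sigma> = density lborel (\<lambda>y. ennreal (d y))"
    unfolding speed_measure_def d_def by (intro arg_cong2[where f=density] refl ext) (auto simp: indicator_def)
  have d_nn: "0 \<le> d y" for y by (simp add: d_def)
  have pM: "(\<lambda>y. indicator ?I y *\<^sub>R (p y * f y)) \<in> borel_measurable borel"
    and pd: "d y *\<^sub>R (indicator ?I y *\<^sub>R (p y * f y)) = p y * G y"
    if p[measurable]: "p \<in> borel_measurable borel" for p y
  proof -
    have "(\<lambda>y. p y * (indicator ?I y * f y)) \<in> borel_measurable borel" by measurable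
    also have "(\<lambda>y. p y * (indicator ?I y * f y)) = (\<lambda>y. indicator ?I y *\<^sub>R (p y * f y))"
      by (simp only: real_scaleR_def mult_ac)
    finally show "(\<lambda>y. indicator ?I y *\<^sub>R (p y * f y)) \<in> borel_measurable borel" .
    show "d y *\<^sub>R (indicator ?I y *\<^sub>R (p y * f y)) = p y * G y"
      by (cases "y \<in> ?I") (simp_all add: d_def G_def)
  qed
  have dM': "d \<in> borel_measurable lborel" using dM by simp
  have intS: "(LINT y:?I|speed_measure r \<sigma>. p y * f y) = (\<integral>y. p y * G y \<partial>lborel)"
    if p: "p \<in> borel_measurable borel" for p
  proof -
    have "(LINT y:?I|speed_measure r \<sigma>. p y * f y) = (\<integral>y. d y *\<^sub>R (indicator ?I y *\<^sub>R (p y * f y)) \<partial>lborel)"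
      unfolding set_lebesgue_integral_def sm by (rule integral_density) (use pM[OF p] d_nn in auto)
    then show ?thesis by (simp only: pd[OF p])
  qed
  have intG: "integrable lborel (\<lambda>y. p y * G y)" if p: "p \<in> borel_measurable borel"
    and si: "set_integrable (speed_measure r \<sigma>) ?I (\<lambda>y. p y * f y)" for p
  proof -
    have "integrable (density lborel (\<lambda>y. ennreal (d y))) (\<lambda>y. indicator ?I y *\<^sub>R (p y * f y))
        = integrable lborel (\<lambda>y. d y *\<^sub>R (indicator ?I y *\<^sub>R (p y * f y)))"
      by (rule integrable_density) (use pM[OF p] d_nn in auto)
    then show ?thesis using si unfolding set_integrable_def sm by (simp only: pd[OF p])
  qed
  have G0: "integrable lborel G" using intG[of "\<lambda>_. 1"] f(3) by simp
  have G1: "integrable lborel (\<lambda>y. y * G y)" using intG[of "\<lambda>y. y"] f(4) by simp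
  have G_pos: "0 < G y" if "y \<in> ?I" for y using that f(1)[OF that] \<sigma>(1)[OF that] by (simp add: G_def)
  have G_out: "G y = 0" if "y \<notin> ?I" for y using that by (simp add: G_def)
  have G_nn: "0 \<le> G y" for y using G_pos[of y] G_out[of y] by (cases "y \<in> ?I") auto
  have cG': "continuous_on ?I G"
    by (rule continuous_on_eq[OF cG]) (simp add: G_def)
  have GP: "integrable lborel (\<lambda>y. p y * G y)" if [measurable]: "p \<in> borel_measurable borel" and b: "\<And>y. y \<in> ?I \<Longrightarrow> \<bar>p y\<bar> \<le> C" for p C
  proof (rule Bochner_Integration.integrable_bound[where f="\<lambda>y. C * G y"])
    show "AE y in lborel. norm (p y * G y) \<le> norm (C * G y)"
    proof (rule AE_I2)
      fix y show "norm (p y * G y) \<le> norm (C * G y)"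
        using b[of y] G_nn[of y] G_out[of y] by (cases "y \<in> ?I") (auto simp: abs_mult intro!: mult_right_mono)
    qed
  qed (use G0 in auto)
  obtain m where m: "m \<in> ?I" using state_space_nonempty[OF r] .
  have posI: "0 < (\<integral>y. p y * G y \<partial>lborel)" if "integrable lborel (\<lambda>y. p y * G y)" "\<And>y. y \<in> ?I \<Longrightarrow> 0 < p y" for p
  proof (rule integral_pos_of_pos_on_open[OF that(1), where a="m/2" and b=m])
    show "0 \<le> p y * G y" for y using that(2)[of y] G_nn[of y] G_out[of y] by (cases "y \<in> ?I") auto
    show "0 < p y * G y" if "m / 2 < y" "y < m" for y
    proof -
      have "m / 2 \<in> ?I" using m I(1)[OF m] unfolding state_space_def
        by (auto intro: le_less_trans[of "ereal (m / 2)" "ereal m"])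
      then have "y \<in> ?I" using state_space_between[OF _ m, of "m / 2" y] that by simp
      then show ?thesis using \<open>\<And>y. y \<in> ?I \<Longrightarrow> 0 < p y\<close> G_pos by simp
    qed
  qed (use I(1)[OF m] in auto)
  define m0 where "m0 = (\<integral>y. G y \<partial>lborel)"
  define m1 where "m1 = (\<integral>y. y * G y \<partial>lborel)"
  have m0: "0 < m0" using posI[of "\<lambda>_. 1"] G0 by (simp add: m0_def)
  have m1: "0 < m1" using posI[of "\<lambda>y. y"] G1 I(1) by (simp add: m1_def)
  \<comment> \<open>Cutting the potential at \<open>y = x\<close> gives
    \<open>h = (1 - ?\<rho> * x) * A + x * B\<close>. The derivatives of \<open>A\<close> and
    \<open>B\<close> cancel in \<open>h'\<close>, leaving \<open>B - ?\<rho> * A\<close>.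
    \<open>B\<close> is written as total minus left part, so that one differentiation lemma for
    integrals from the left serves both.\<close>
  define A where "A x = (\<integral>y. indicator {..x} y * (y * G y) \<partial>lborel)" for x
  define B0 where "B0 x = (\<integral>y. indicator {..x} y * ((1 - ?\<rho> * y) * G y) \<partial>lborel)" for x
  define tot where "tot = (\<integral>y. (1 - ?\<rho> * y) * G y \<partial>lborel)"
  define B where "B x = tot - B0 x" for x
  have F2: "integrable lborel (\<lambda>y. (1 - ?\<rho> * y) * G y)"
  proof -
    have "integrable lborel (\<lambda>y. G y - ?\<rho> * (y * G y))" using G0 G1 by simp
    then show ?thesis by (simp add: algebra_simps)
  qed
  have ind: "integrable lborel (\<lambda>y. indicator S y * (F y :: real))" if "integrable lborel F" "S \<in> sets borel" for F S
    using integrable_mult_indicator[OF _ that(1), of S] that(2) by simp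
  have B_eq: "B x = (\<integral>y. indicator {x<..} y * ((1 - ?\<rho> * y) * G y) \<partial>lborel)" for x
    unfolding B_def tot_def B0_def
    by (subst Bochner_Integration.integral_diff[symmetric, OF F2 ind[OF F2]])
      (auto intro!: Bochner_Integration.integral_cong simp: indicator_def)
  have nbhd: "\<exists>a b. a < x \<and> x < b \<and> {a..b} \<subseteq> ?I" if x: "x \<in> ?I" for x
  proof -
    obtain e where e: "0 < e" "cball x e \<subseteq> ?I" using open_contains_cball[of ?I] open_state_space x by blast
    then have "{x - e..x + e} \<subseteq> ?I" by (simp add: cball_eq_atLeastAtMost)
    then show ?thesis using e(1) by (intro exI[of _ "x - e"] exI[of _ "x + e"]) auto
  qed
  have dA: "(A has_real_derivative x * G x) (at x)" if x: "x \<in> ?I" for x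
  proof -
    obtain a b where ab: "a < x" "x < b" "{a..b} \<subseteq> ?I" using nbhd[OF x] by blast
    show ?thesis unfolding A_def[abs_def]
      by (rule has_real_derivative_cumulative[OF G1 ab(1,2)])
        (intro continuous_intros continuous_on_subset[OF cG' ab(3)])
  qed
  have dB: "(B has_real_derivative - ((1 - ?\<rho> * x) * G x)) (at x)" if x: "x \<in> ?I" for x
  proof -
    obtain a b where ab: "a < x" "x < b" "{a..b} \<subseteq> ?I" using nbhd[OF x] by blast
    have "(B0 has_real_derivative (1 - ?\<rho> * x) * G x) (at x)" unfolding B0_def[abs_def]
      by (rule has_real_derivative_cumulative[OF F2 ab(1,2)])
        (intro continuous_intros continuous_on_subset[OF cG' ab(3)])
    then show ?thesis unfolding B_def[abs_def] by (auto intro!: derivative_eq_intros)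
  qed
  have h_int: "h x = (\<integral>y. (min x y * (1 - ?\<rho> * max x y)) * G y \<partial>lborel)" if x: "x \<in> ?I" for x
    unfolding hx[OF x] potential_density_eq by (rule intS) measurable
  have h_eq: "h x = (1 - ?\<rho> * x) * A x + x * B x" if x: "x \<in> ?I" for x
  proof -
    have "(1 - ?\<rho> * x) * A x + x * B x = (\<integral>y. (1 - ?\<rho> * x) * (indicator {..x} y * (y * G y)) + x * (indicator {x<..} y * ((1 - ?\<rho> * y) * G y)) \<partial>lborel)"
      unfolding A_def B_eq using ind[OF G1, of "{..x}"] ind[OF F2, of "{x<..}"] by simp
    also have "\<dots> = h x" unfolding h_int[OF x]
      by (rule Bochner_Integration.integral_cong) (auto simp: indicator_def min_def max_def)
    finally show ?thesis by simp
  qed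
  have u_int: "integrable lborel (\<lambda>y. (min x y * (1 - ?\<rho> * max x y)) * G y)" if x: "x \<in> ?I" for x
  proof (rule GP[where C=x])
    show "\<bar>min x y * (1 - ?\<rho> * max x y)\<bar> \<le> x" if y: "y \<in> ?I" for y
    proof -
      have *: "0 \<le> 1 - ?\<rho> * max x y" "1 - ?\<rho> * max x y \<le> 1"
        using I[OF x] I[OF y] \<rho>0 by (auto simp: max_def)
      have "min x y * (1 - ?\<rho> * max x y) \<le> x * 1" using * I[OF x] by (intro mult_mono) auto
      moreover have "0 \<le> min x y * (1 - ?\<rho> * max x y)" using * I[OF x] I[OF y] by simp
      ultimately show ?thesis by simp
    qed
  qed measurable
  have h_le: "h x \<le> C * (\<integral>y. p y * G y \<partial>lborel)" if x: "x \<in> ?I" and p: "integrable lborel (\<lambda>y. p y * G y)"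
    and le: "\<And>y. y \<in> ?I \<Longrightarrow> min x y * (1 - ?\<rho> * max x y) \<le> C * p y" for x p C
  proof -
    have "h x \<le> (\<integral>y. C * (p y * G y) \<partial>lborel)" unfolding h_int[OF x]
    proof (rule integral_mono[OF u_int[OF x]])
      show "(min x y * (1 - ?\<rho> * max x y)) * G y \<le> C * (p y * G y)" for y
        using mult_right_mono[OF le G_nn, of y] G_out[of y] by (cases "y \<in> ?I") (auto simp: mult.assoc)
    qed (use p in simp)
    then show ?thesis by simp
  qed
  have h_ge: "C * (\<integral>y. p y * G y \<partial>lborel) \<le> h x" if x: "x \<in> ?I" and p: "integrable lborel (\<lambda>y. p y * G y)"
    and le: "\<And>y. y \<in> ?I \<Longrightarrow> C * p y \<le> min x y * (1 - ?\<rho> * max x y)" for x p C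
  proof -
    have "(\<integral>y. C * (p y * G y) \<partial>lborel) \<le> h x" unfolding h_int[OF x]
    proof (rule integral_mono[OF _ u_int[OF x]])
      show "C * (p y * G y) \<le> (min x y * (1 - ?\<rho> * max x y)) * G y" for y
        using mult_right_mono[OF le G_nn, of y] G_out[of y] by (cases "y \<in> ?I") (auto simp: mult.assoc)
    qed (use p in simp)
    then show ?thesis by simp
  qed
  \<comment> \<open>\<open>m0\<close> belongs to the bound \<open>x\<close> of the potential density
    and \<open>m1\<close> to the bound \<open>(1 - ?\<rho> * x) * y\<close>. Moreover
    \<open>B\<close> and \<open>?\<rho> * A\<close> both lie between 0 and \<open>m0\<close>, which
    bounds their difference \<open>h'\<close>.\<close>
  define H where "H = max m0 m1"
  have hx1: "h x \<le> H * x" if x: "x \<in> ?I" for x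
  proof -
    have "h x \<le> x * (\<integral>y. 1 * G y \<partial>lborel)"
    proof (rule h_le[OF x])
      fix y assume y: "y \<in> ?I"
      have *: "0 \<le> 1 - ?\<rho> * max x y" "1 - ?\<rho> * max x y \<le> 1"
        using I[OF x] I[OF y] \<rho>0 by (auto simp: max_def)
      show "min x y * (1 - ?\<rho> * max x y) \<le> x * 1" using * I[OF x] by (intro mult_mono) auto
    qed (use G0 in simp)
    also have "\<dots> = m0 * x" by (simp add: m0_def)
    also have "\<dots> \<le> H * x" using I[OF x] by (simp add: H_def)
    finally show ?thesis .
  qed
  have hx2: "h x \<le> H * (1 - ?\<rho> * x)" if x: "x \<in> ?I" for x
  proof -
    have "h x \<le> (1 - ?\<rho> * x) * (\<integral>y. y * G y \<partial>lborel)"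
    proof (rule h_le[OF x G1])
      fix y assume y: "y \<in> ?I"
      have "min x y * (1 - ?\<rho> * max x y) \<le> y * (1 - ?\<rho> * x)"
        using I[OF x] I[OF y] \<rho>0 by (intro mult_mono) (auto simp: max_def mult_left_mono)
      then show "min x y * (1 - ?\<rho> * max x y) \<le> (1 - ?\<rho> * x) * y" by (simp add: mult.commute)
    qed
    also have "\<dots> \<le> H * (1 - ?\<rho> * x)" using I[OF x] by (simp add: H_def m1_def mult.commute mult_left_mono)
    finally show ?thesis .
  qed
  \<comment> \<open>The weights come from minorising the potential density: by
    \<open>x * min 1 (y / m) * (1 - ?\<rho> * max m y)\<close> for x \<le> m, and by
    \<open>(1 - ?\<rho> * x) * min m y * (1 - ?\<rho> * y)\<close> for m \<le> x.\<close>
  define \<kappa>1 where "\<kappa>1 = (\<integral>y. (min 1 (y / m) * (1 - ?\<rho> * max m y)) * G y \<partial>lborel)"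
  define \<kappa>2 where "\<kappa>2 = (\<integral>y. (min m y * (1 - ?\<rho> * y)) * G y \<partial>lborel)"
  have i1: "integrable lborel (\<lambda>y. (min 1 (y / m) * (1 - ?\<rho> * max m y)) * G y)"
  proof (rule GP[where C=1])
    fix y assume y: "y \<in> ?I"
    have *: "0 \<le> 1 - ?\<rho> * max m y" "1 - ?\<rho> * max m y \<le> 1"
      using I[OF m] I[OF y] \<rho>0 by (auto simp: max_def)
    have "min 1 (y / m) * (1 - ?\<rho> * max m y) \<le> 1 * 1" using * by (intro mult_mono) auto
    moreover have "0 \<le> min 1 (y / m) * (1 - ?\<rho> * max m y)" using * I[OF m] I[OF y] by simp
    ultimately show "\<bar>min 1 (y / m) * (1 - ?\<rho> * max m y)\<bar> \<le> 1" by simp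
  qed measurable
  have i2: "integrable lborel (\<lambda>y. (min m y * (1 - ?\<rho> * y)) * G y)"
  proof (rule GP[where C=m])
    fix y assume y: "y \<in> ?I"
    have *: "0 \<le> 1 - ?\<rho> * y" "1 - ?\<rho> * y \<le> 1" using I[OF y] \<rho>0 by auto
    have "min m y * (1 - ?\<rho> * y) \<le> m * 1" using * I[OF m] by (intro mult_mono) auto
    moreover have "0 \<le> min m y * (1 - ?\<rho> * y)" using * I[OF m] I[OF y] by simp
    ultimately show "\<bar>min m y * (1 - ?\<rho> * y)\<bar> \<le> m" by simp
  qed measurable
  have \<kappa>1: "0 < \<kappa>1" unfolding \<kappa>1_def
    by (rule posI[OF i1]) (use I[OF m] I in \<open>auto simp: max_def\<close>)
  have \<kappa>2: "0 < \<kappa>2" unfolding \<kappa>2_def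
    by (rule posI[OF i2]) (use I[OF m] I in auto)
  define \<kappa> where "\<kappa> = min \<kappa>1 \<kappa>2"
  have low1: "\<kappa> * x \<le> h x" if x: "x \<in> ?I" and xm: "x \<le> m" for x
  proof -
    have "x * \<kappa>1 \<le> h x" unfolding \<kappa>1_def
    proof (rule h_ge[OF x i1])
      fix y assume y: "y \<in> ?I"
      have 1: "x * min 1 (y / m) \<le> min x y"
      proof -
        have "x * (y / m) \<le> y" using xm I[OF x] I[OF y] I[OF m] by (simp add: pos_divide_le_eq mult.commute mult_left_mono)
        moreover have "x * min 1 (y / m) \<le> x * 1" "x * min 1 (y / m) \<le> x * (y / m)"
          using I[OF x] by (intro mult_left_mono; simp)+
        ultimately show ?thesis by simp
      qed
      have 2: "0 \<le> 1 - ?\<rho> * max m y" "1 - ?\<rho> * max m y \<le> 1 - ?\<rho> * max x y"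
        using I[OF m] I[OF y] \<rho>0 xm by (auto simp: max_def intro!: mult_left_mono)
      have "(x * min 1 (y / m)) * (1 - ?\<rho> * max m y) \<le> min x y * (1 - ?\<rho> * max x y)"
        using 1 2 I[OF x] I[OF y] I[OF m] by (intro mult_mono) auto
      then show "x * (min 1 (y / m) * (1 - ?\<rho> * max m y)) \<le> min x y * (1 - ?\<rho> * max x y)" by (simp add: mult.assoc)
    qed
    moreover have "\<kappa> * x \<le> x * \<kappa>1" using I[OF x] by (simp add: \<kappa>_def mult.commute mult_left_mono)
    ultimately show ?thesis by simp
  qed
  have low2: "\<kappa> * (1 - ?\<rho> * x) \<le> h x" if x: "x \<in> ?I" and xm: "m \<le> x" for x
  proof -
    have "(1 - ?\<rho> * x) * \<kappa>2 \<le> h x" unfolding \<kappa>2_def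
    proof (rule h_ge[OF x i2])
      fix y assume y: "y \<in> ?I"
      have 1: "(1 - ?\<rho> * x) * (1 - ?\<rho> * y) \<le> 1 - ?\<rho> * max x y"
      proof (cases "x \<le> y")
        case True
        have "(1 - ?\<rho> * x) * (1 - ?\<rho> * y) \<le> 1 * (1 - ?\<rho> * y)" using I[OF x] I[OF y] \<rho>0 by (intro mult_right_mono) auto
        then show ?thesis using True by (simp add: max_def)
      next
        case False
        have "(1 - ?\<rho> * x) * (1 - ?\<rho> * y) \<le> (1 - ?\<rho> * x) * 1" using I[OF x] I[OF y] \<rho>0 by (intro mult_left_mono) auto
        then show ?thesis using False by (simp add: max_def)
      qed
      have "min m y * ((1 - ?\<rho> * x) * (1 - ?\<rho> * y)) \<le> min x y * (1 - ?\<rho> * max x y)"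
        using 1 xm I[OF x] I[OF y] I[OF m] by (intro mult_mono) auto
      then show "(1 - ?\<rho> * x) * (min m y * (1 - ?\<rho> * y)) \<le> min x y * (1 - ?\<rho> * max x y)" by (simp add: mult_ac)
    qed
    moreover have "\<kappa> * (1 - ?\<rho> * x) \<le> (1 - ?\<rho> * x) * \<kappa>2" using I[OF x] by (simp add: \<kappa>_def mult.commute mult_left_mono)
    ultimately show ?thesis by simp
  qed
  define h' where "h' x = B x - ?\<rho> * A x" for x
  have dh: "(h has_real_derivative h' x) (at x)" if x: "x \<in> ?I" for x
  proof -
    have "((\<lambda>x. (1 - ?\<rho> * x) * A x + x * B x) has_real_derivative h' x) (at x)"
      by (rule derivative_eq_intros dA dB x refl)+ (simp add: h'_def algebra_simps)
    then show ?thesis by (rule has_field_derivative_transform_within_open[OF _ open_state_space x]) (simp add: h_eq)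
  qed
  have dh': "(h' has_real_derivative - G x) (at x)" if x: "x \<in> ?I" for x
    unfolding h'_def[abs_def] by (rule derivative_eq_intros dA dB x refl)+ (simp add: algebra_simps)
  have A_nn: "0 \<le> A x" for x unfolding A_def
  proof (rule Bochner_Integration.integral_nonneg)
    fix y show "0 \<le> indicator {..x} y * (y * G y)"
      using G_nn[of y] G_out[of y] I(1)[of y] by (cases "y \<in> ?I") auto
  qed
  have hb: "\<bar>h' x\<bar> \<le> H" for x
  proof -
    have "0 \<le> B x" unfolding B_eq
    proof (rule Bochner_Integration.integral_nonneg)
      fix y show "0 \<le> indicator {x<..} y * ((1 - ?\<rho> * y) * G y)"
        using G_nn[of y] G_out[of y] I(2)[of y] by (cases "y \<in> ?I") auto
    qed
    moreover have "B x \<le> m0" unfolding B_eq m0_def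
    proof (rule integral_mono[OF ind[OF F2] G0])
      fix y
      have "(1 - ?\<rho> * y) * G y \<le> 1 * G y" if "y \<in> ?I" using I(1)[OF that] \<rho>0 by (intro mult_right_mono G_nn) auto
      then show "indicator {x<..} y * ((1 - ?\<rho> * y) * G y) \<le> G y"
        using G_nn[of y] G_out[of y] by (cases "y \<in> ?I") (auto simp: indicator_def)
    qed simp
    moreover have "?\<rho> * A x \<le> m0"
    proof -
      have "?\<rho> * A x = (\<integral>y. ?\<rho> * (indicator {..x} y * (y * G y)) \<partial>lborel)" by (simp add: A_def)
      also have "\<dots> \<le> m0" unfolding m0_def
      proof (rule integral_mono[OF _ G0])
        fix y
        have "(?\<rho> * y) * G y \<le> 1 * G y" if "y \<in> ?I" using I(2)[OF that] by (intro mult_right_mono G_nn) auto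
        then show "?\<rho> * (indicator {..x} y * (y * G y)) \<le> G y"
          using G_nn[of y] G_out[of y] by (cases "y \<in> ?I") (auto simp: indicator_def mult.assoc)
      qed (use ind[OF G1, of "{..x}"] in simp)
      finally show ?thesis .
    qed
    moreover have "0 \<le> ?\<rho> * A x" using A_nn \<rho>0 by simp
    ultimately show ?thesis unfolding h'_def H_def by linarith
  qed
  \<comment> \<open>With \<open>?\<rho> = 0\<close> the difference \<open>h x - x * h' x\<close> is
    \<open>A x\<close>, which is nonnegative. It is the height at 0 of the tangent to the concave
    function \<open>h\<close>.\<close>
  have xh: "x * h' x \<le> h x" if x: "x \<in> ?I" and "r = \<infinity>" for x
    unfolding h_eq[OF x] h'_def using A_nn[of x] \<open>r = \<infinity>\<close> by (simp add: inv_endpoint_def)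
  have "H0_profile r h h' (\<lambda>x. - G x) m \<kappa> H"
    by unfold_locales
      (use r dh dh' cG' m \<kappa>1 \<kappa>2 m0 low1 low2 hx1 hx2 hb xh in \<open>auto simp: \<kappa>_def H_def intro: continuous_on_minus\<close>)
  then show ?thesis by blast
qed


subsection \<open>A Lyapunov function comparable to \<open>1 / h\<close>\<close>

lemma lipschitz_Icc_of_C1:
  fixes f f' :: "real \<Rightarrow> real"
  assumes "\<And>z. z \<in> {a..b} \<Longrightarrow> (f has_real_derivative f' z) (at z)" "continuous_on {a..b} f'"
  shows "\<exists>L. L-lipschitz_on {a..b} f"
proof -
  have "bounded (f' ` {a..b})" by (intro compact_imp_bounded compact_continuous_image assms(2)) simp
  then obtain C where C: "\<And>z. z \<in> {a..b} \<Longrightarrow> \<bar>f' z\<bar> \<le> C" unfolding bounded_iff real_norm_def by blast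
  have "(max 0 C)-lipschitz_on {a..b} f"
  proof (rule lipschitz_onI)
    fix u v assume uv: "u \<in> {a..b}" "v \<in> {a..b}"
    have "norm (f u - f v) \<le> max 0 C * norm (u - v)"
    proof (rule field_differentiable_bound[where S="{a..b}" and f'=f'])
      show "(f has_real_derivative f' z) (at z within {a..b})" if "z \<in> {a..b}" for z
        using assms(1)[OF that] by (rule has_field_derivative_at_within)
      show "norm (f' z) \<le> max 0 C" if "z \<in> {a..b}" for z using C[OF that] by simp
    qed (use uv in auto)
    then show "dist (f u) (f v) \<le> max 0 C * dist u v" by (simp add: dist_norm)
  qed simp
  then show ?thesis by blast
qed

lemma lipschitz_Icc_mult:
  fixes f g :: "real \<Rightarrow> real"
  assumes "\<exists>L. L-lipschitz_on {a..b} f" "\<exists>L. L-lipschitz_on {a..b} g"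
  shows "\<exists>L. L-lipschitz_on {a..b} (\<lambda>z. f z * g z)"
proof -
  obtain K L where K: "K-lipschitz_on {a..b} f" and L: "L-lipschitz_on {a..b} g" using assms by blast
  have "bounded (f ` {a..b})" "bounded (g ` {a..b})"
    by (intro compact_imp_bounded compact_continuous_image lipschitz_on_continuous_on[OF K] lipschitz_on_continuous_on[OF L]; simp)+
  then obtain C D where C: "\<And>z. z \<in> {a..b} \<Longrightarrow> \<bar>f z\<bar> \<le> C" and D: "\<And>z. z \<in> {a..b} \<Longrightarrow> \<bar>g z\<bar> \<le> D"
    unfolding bounded_iff real_norm_def by blast
  have "(max 0 C * L + max 0 D * K)-lipschitz_on {a..b} (\<lambda>z. f z * g z)"
  proof (rule lipschitz_onI)
    fix u v assume uv: "u \<in> {a..b}" "v \<in> {a..b}"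
    have "f u * g u - f v * g v = f u * (g u - g v) + g v * (f u - f v)" by (simp add: algebra_simps)
    also have "\<bar>\<dots>\<bar> \<le> \<bar>f u\<bar> * \<bar>g u - g v\<bar> + \<bar>g v\<bar> * \<bar>f u - f v\<bar>"
      by (rule order_trans[OF abs_triangle_ineq]) (simp add: abs_mult)
    also have "\<dots> \<le> max 0 C * (L * \<bar>u - v\<bar>) + max 0 D * (K * \<bar>u - v\<bar>)"
      using C[OF uv(1)] D[OF uv(2)] lipschitz_onD[OF K uv] lipschitz_onD[OF L uv]
      by (intro add_mono mult_mono) (auto simp: dist_real_def)
    finally show "dist (f u * g u) (f v * g v) \<le> (max 0 C * L + max 0 D * K) * dist u v"
      by (simp add: dist_real_def algebra_simps)
  qed (use lipschitz_on_nonneg[OF K] lipschitz_on_nonneg[OF L] in simp)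
  then show ?thesis by blast
qed

lemma lipschitz_Icc_add:
  fixes f g :: "real \<Rightarrow> real"
  assumes "\<exists>L. L-lipschitz_on {a..b} f" "\<exists>L. L-lipschitz_on {a..b} g"
  shows "\<exists>L. L-lipschitz_on {a..b} (\<lambda>z. f z + g z)"
  using assms lipschitz_on_add by blast

lemma lipschitz_Icc_cong:
  fixes f g :: "real \<Rightarrow> real"
  assumes "\<exists>L. L-lipschitz_on {a..b} f" "\<And>z. z \<in> {a..b} \<Longrightarrow> g z = f z"
  shows "\<exists>L. L-lipschitz_on {a..b} g"
  using assms by (simp add: lipschitz_on_def)

lemma lipschitz_Icc_const: "\<exists>L. L-lipschitz_on {a..b} (\<lambda>z::real. c::real)"
  using lipschitz_on_constant by blast

text \<open>\<open>V\<close> plays the role of \<open>1 / h\<close>, which itself need not satisfy the generator inequality since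
  \<open>h''\<close> can be unbounded at the boundary.\<close>

locale lyapunov_function =
  fixes r :: ereal and h :: "real \<Rightarrow> real" and c :: real and V V' V'' :: "real \<Rightarrow> real" and k :: real
  assumes r_pos: "0 < r" and k_pos: "0 < k"
    and h_pos: "\<And>y. y \<in> state_space r \<Longrightarrow> 0 < h y"
    and h_cont: "continuous_on (state_space r) h"
    and drift_cont: "continuous_on (state_space r) (\<lambda>y. deriv h y / h y + c)"
    and V_deriv: "\<And>y. y \<in> state_space r \<Longrightarrow> (V has_real_derivative V' y) (at y)"
    and V'_deriv: "\<And>y. y \<in> state_space r \<Longrightarrow> (V' has_real_derivative V'' y) (at y)"
    and V''_lip: "\<And>a b. {a..b} \<subseteq> state_space r \<Longrightarrow> \<exists>L. L-lipschitz_on {a..b} V''"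
    and V_le: "\<And>y. y \<in> state_space r \<Longrightarrow> V y \<le> k / h y"
    and V_ge: "\<And>y. y \<in> state_space r \<Longrightarrow> 1 / h y \<le> k * V y"
    and V_gen: "\<And>y. y \<in> state_space r \<Longrightarrow> V'' y / 2 + (deriv h y / h y + c) * V' y \<le> k * V y"
    and V_coercive: "\<And>y. y \<in> state_space r \<Longrightarrow> (1 / h y)^4 \<le> k * ((V' y)\<^sup>2 + (V y)\<^sup>2)"
    and h_le_left: "\<And>y. y \<in> state_space r \<Longrightarrow> h y \<le> k * y"
    and h_le_right: "\<And>y. y \<in> state_space r \<Longrightarrow> r \<noteq> \<infinity> \<Longrightarrow> h y \<le> k * (1 - inv_endpoint r * y)"
    and drift_infinite: "\<And>y. y \<in> state_space r \<Longrightarrow> r = \<infinity> \<Longrightarrow> y * (deriv h y / h y + c) \<le> 1"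

text \<open>For \<open>h(x) = x\<close> and \<open>c = 0\<close> the process is a three-dimensional
  Bessel process and \<open>1 / y\<close> is harmonic for its generator:
  \<open>1 / y^3 - (1 / y) * (1 / y^2) = 0\<close>. A drift \<open>c < 0\<close> would add
  \<open>- c / y^2\<close>, which no multiple of \<open>1 / y\<close> dominates near 0.\<close>

lemma lyapunov_function_identity:
  assumes r: "r = \<infinity>" and h: "\<And>x. x \<in> state_space r \<Longrightarrow> h x = x"
  shows "lyapunov_function r h 0 (\<lambda>y. 1 / y) (\<lambda>y. - 1 / y^2) (\<lambda>y. 2 / y^3) 1"
proof -
  have I: "y \<in> state_space r \<longleftrightarrow> 0 < y" "y \<in> state_space \<infinity> \<longleftrightarrow> 0 < y" for y using r by (simp_all add: state_space_def)
  have d: "deriv h y = 1" if "y \<in> state_space r" for y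
  proof (rule DERIV_imp_deriv)
    show "(h has_real_derivative 1) (at y)"
      by (rule has_field_derivative_transform_within_open[OF DERIV_ident open_state_space that]) (simp add: h)
  qed
  show ?thesis
  proof
    show "continuous_on (state_space r) h"
      by (rule continuous_on_eq[OF continuous_on_id]) (simp add: h)
    show "continuous_on (state_space r) (\<lambda>y. deriv h y / h y + 0)"
      by (rule continuous_on_eq[of _ "\<lambda>y. 1 / y"]) (auto simp: h d I intro!: continuous_intros)
    show "\<exists>L. L-lipschitz_on {a..b} (\<lambda>y. 2 / y ^ 3)" if "{a..b} \<subseteq> state_space r" for a b :: real
      by (rule lipschitz_Icc_of_C1[where f'="\<lambda>y. - 6 / y^4"])
        (use that in \<open>auto simp: subset_iff I power2_eq_square power3_eq_cube power4_eq_xxxx field_simps intro!: derivative_eq_intros continuous_intros\<close>)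
  qed (auto simp: r I h d power2_eq_square power3_eq_cube power4_eq_xxxx field_simps intro!: derivative_eq_intros)
qed

lemma mono_of_nonneg_derivative:
  fixes f f' :: "real \<Rightarrow> real"
  assumes "a \<le> b" "\<And>z. a \<le> z \<Longrightarrow> z \<le> b \<Longrightarrow> (f has_real_derivative f' z) (at z)"
    "\<And>z. a \<le> z \<Longrightarrow> z \<le> b \<Longrightarrow> 0 \<le> f' z"
  shows "f a \<le> f b"
  using assms by (intro DERIV_nonneg_imp_nondecreasing[of a b f]) blast+

lemma DERIV_sqrt_one_plus_square:
  fixes s :: "real \<Rightarrow> real"
  assumes "(s has_real_derivative D) (at x)"
  shows "((\<lambda>x. sqrt (1 + (s x)\<^sup>2)) has_real_derivative s x * D / sqrt (1 + (s x)\<^sup>2)) (at x)"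
proof -
  have pos: "0 < 1 + (s x)\<^sup>2" by (simp add: add_pos_nonneg)
  have "((\<lambda>x. 1 + (s x)\<^sup>2) has_real_derivative 2 * s x * D) (at x)"
    using DERIV_add[OF DERIV_const[of 1] DERIV_power[OF assms, of 2]] by (simp add: mult_ac)
  then have "((\<lambda>x. sqrt (1 + (s x)\<^sup>2)) has_real_derivative inverse (sqrt (1 + (s x)\<^sup>2)) / 2 * (2 * s x * D)) (at x)"
    by (rule DERIV_chain2[where f=sqrt and g="\<lambda>x. 1 + (s x)\<^sup>2", OF DERIV_real_sqrt[OF pos]])
  then show ?thesis by (simp add: field_simps)
qed

text \<open>The choice of \<open>s\<close>: with \<open>s' = exp (- 2 * c * y) / h\<^sup>2\<close> it would be a scale function of \<open>Y\<close>; the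
  factor \<open>exp (- y\<^sup>2)\<close> keeps it bounded near \<open>r = \<infinity>\<close> and only costs the drift term \<open>- y * s'\<close>.\<close>

lemma (in H0_profile) lyapunov_function_exists:
  assumes c: "r = \<infinity> \<longrightarrow> c \<le> 0"
  shows "\<exists>V V' V'' k. lyapunov_function r h c V V' V'' k"
proof -
  let ?I = "state_space r" and ?\<rho> = "inv_endpoint r"
  note \<rho>0 = inv_endpoint_nonneg[OF r]
  note I = state_spaceD[where r=r]
  have m0: "0 < m" using I(1)[OF m] .
  have hpos: "0 < h x" if x: "x \<in> ?I" for x
  proof (cases "x \<le> m")
    case True
    have "0 < \<kappa> * x" using \<kappa> I(1)[OF x] by simp
    then show ?thesis using low1[OF x True] by linarith
  next
    case False
    have "0 < \<kappa> * (1 - ?\<rho> * x)" using \<kappa> I(2)[OF x] by simp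
    then show ?thesis using low2[OF x] False by linarith
  qed
  have hH: "h x \<le> H" if x: "x \<in> ?I" for x
  proof -
    have "H * (1 - ?\<rho> * x) \<le> H * 1" using H \<rho>0 I(1)[OF x] by (intro mult_left_mono) auto
    then show ?thesis using up2[OF x] by simp
  qed
  have deriv_h: "deriv h x = h' x" if "x \<in> ?I" for x using DERIV_imp_deriv[OF dh[OF that]] .
  have ch: "continuous_on ?I h" by (rule DERIV_continuous_on) (rule has_field_derivative_at_within[OF dh])
  have ch': "continuous_on ?I h'" by (rule DERIV_continuous_on) (rule has_field_derivative_at_within[OF dh'])
  have hne: "h x \<noteq> 0" if "x \<in> ?I" for x using hpos[OF that] by simp
  define E where "E y = exp (- 2 * c * y - y\<^sup>2)" for y
  have E_pos: "0 < E y" for y by (simp add: E_def)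
  \<comment> \<open>Completing the square bounds the exponent by \<open>2 * c^2 - y^2 / 2\<close>,
    and \<open>1 + y^2\<close> is at most \<open>2 * exp (y^2 / 2)\<close>; the product of the two
    bounds is \<open>M\<close>. The factor \<open>1 + y^2\<close> provides integrability at
    infinity.\<close>
  define M where "M = 2 * exp (2 * c\<^sup>2)"
  have M_pos: "0 < M" by (simp add: M_def)
  have E_le: "E y * (1 + y\<^sup>2) \<le> M" for y
  proof -
    have "0 \<le> (2 * c + y)\<^sup>2" by simp
    then have "- 2 * c * y - y\<^sup>2 \<le> 2 * c\<^sup>2 + - (y\<^sup>2 / 2)" by (simp add: power2_eq_square algebra_simps)
    then have "E y \<le> exp (2 * c\<^sup>2) * exp (- (y\<^sup>2 / 2))" unfolding E_def exp_add[symmetric] by simp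
    moreover have "1 + y\<^sup>2 \<le> 2 * exp (y\<^sup>2 / 2)" using exp_ge_add_one_self[of "y\<^sup>2 / 2"] by linarith
    ultimately have "E y * (1 + y\<^sup>2) \<le> (exp (2 * c\<^sup>2) * exp (- (y\<^sup>2 / 2))) * (2 * exp (y\<^sup>2 / 2))"
      by (intro mult_mono) auto
    also have "\<dots> = M" unfolding M_def by (simp add: exp_minus)
    finally show ?thesis .
  qed
  have E_M: "E y \<le> M" for y
  proof -
    have "E y * 1 \<le> E y * (1 + y\<^sup>2)" using E_pos[of y] by (intro mult_left_mono) auto
    then show ?thesis using E_le[of y] by simp
  qed
  define w where "w y = E y / (h y)\<^sup>2" for y
  have w_pos: "0 < w y" if "y \<in> ?I" for y using hpos[OF that] E_pos by (simp add: w_def)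
  have cE: "continuous_on A E" for A unfolding E_def by (intro continuous_intros)
  have cw: "continuous_on ?I w" unfolding w_def by (intro continuous_intros cE ch) (use hne in auto)
  have "\<exists>F. \<forall>x. 0 < ereal x \<longrightarrow> ereal x < r \<longrightarrow> (F has_vector_derivative w x) (at x)"
  proof (rule einterval_antiderivative[OF r])
    fix x assume "0 < ereal x" "ereal x < r"
    then have "x \<in> ?I" by (simp add: state_space_def)
    then show "isCont w x" using cw open_state_space by (simp add: continuous_on_eq_continuous_at)
  qed
  then obtain F where "\<And>x. x \<in> ?I \<Longrightarrow> (F has_real_derivative w x) (at x)"
    by (auto simp: has_real_derivative_iff_has_vector_derivative state_space_def)
  note F = this
  \<comment> \<open>Normalising at \<open>m\<close> makes \<open>s\<close> nonpositive to the left
    and nonnegative to the right. This sign decides later whether the extra drift term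
    helps.\<close>
  define s where "s x = F x - F m" for x
  have ds: "(s has_real_derivative w x) (at x)" if "x \<in> ?I" for x
    unfolding s_def[abs_def] using F[OF that] by (auto intro!: derivative_eq_intros)
  have sm: "s m = 0" by (simp add: s_def)
  have s_le: "s x \<le> 0" if x: "x \<in> ?I" "x \<le> m" for x
  proof -
    have "s x \<le> s m" by (rule mono_of_nonneg_derivative[OF x(2) ds])
        (use state_space_between[OF x(1) m] w_pos in \<open>auto intro: less_imp_le\<close>)
    then show ?thesis by (simp add: sm)
  qed
  have s_ge: "0 \<le> s x" if x: "x \<in> ?I" "m \<le> x" for x
  proof -
    have "s m \<le> s x" by (rule mono_of_nonneg_derivative[OF x(2) ds])
        (use state_space_between[OF m x(1)] w_pos in \<open>auto intro: less_imp_le\<close>)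
    then show ?thesis by (simp add: sm)
  qed
  define C where "C = M / \<kappa>\<^sup>2"
  have C_pos: "0 < C" using M_pos \<kappa> by (simp add: C_def)
  have w_le: "w z \<le> E z / (\<kappa> * q)\<^sup>2" if "z \<in> ?I" "0 < q" "\<kappa> * q \<le> h z" for z q
    unfolding w_def using that \<kappa> E_pos[of z] hpos[OF that(1)]
    by (intro divide_left_mono power_mono mult_pos_pos) (auto simp: less_imp_le)
  \<comment> \<open>The lower bounds for \<open>h\<close> majorise \<open>s' = w\<close> by
    \<open>C / z^2\<close> near 0 and by \<open>C / (1 - ?\<rho> * z)^2\<close> near a finite
    \<open>r\<close>, both with explicit antiderivatives. The upper bounds for \<open>h\<close> then
    convert \<open>1 / x\<close> and \<open>1 / (1 - ?\<rho> * x)\<close> into multiples of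
    \<open>1 / h\<close>.\<close>
  have "\<exists>k1. 0 \<le> k1 \<and> (\<forall>x\<in>?I. \<bar>s x\<bar> \<le> k1 / h x)"
  proof -
    have left: "\<bar>s x\<bar> \<le> (C * H) / h x" if x: "x \<in> ?I" "x \<le> m" for x
    proof -
      have "- (s x + C / x) \<le> - (s m + C / m)"
      proof (rule mono_of_nonneg_derivative[OF x(2), where f="\<lambda>z. - (s z + C / z)" and f'="\<lambda>z. C / z\<^sup>2 - w z"])
        fix z assume z: "x \<le> z" "z \<le> m"
        have zI: "z \<in> ?I" using state_space_between[OF x(1) m z] .
        show "((\<lambda>z. - (s z + C / z)) has_real_derivative C / z\<^sup>2 - w z) (at z)"
          by (rule derivative_eq_intros ds zI refl)+ (use I(1)[OF zI] in \<open>auto simp: power2_eq_square\<close>)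
        have "w z \<le> E z / (\<kappa> * z)\<^sup>2" by (rule w_le[OF zI I(1)[OF zI] low1[OF zI z(2)]])
        also have "\<dots> \<le> M / (\<kappa> * z)\<^sup>2" using E_M by (intro divide_right_mono) auto
        also have "\<dots> = C / z\<^sup>2" by (simp add: C_def power_mult_distrib)
        finally show "0 \<le> C / z\<^sup>2 - w z" by simp
      qed
      then have "- s x \<le> C / x" using C_pos m0 by (simp add: sm) (smt (verit) divide_pos_pos)
      also have "C / x \<le> (C * H) / h x"
        using up1[OF x(1)] C_pos hpos[OF x(1)] I(1)[OF x(1)] by (simp add: field_simps mult_left_mono)
      finally show ?thesis using s_le[OF x] by simp
    qed
    have comb: "\<bar>s x\<bar> \<le> (C * H + D) / h x" if x: "x \<in> ?I" and D: "0 \<le> D" "m \<le> x \<Longrightarrow> \<bar>s x\<bar> \<le> D / h x" for x D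
    proof -
      have "0 \<le> C * H / h x" "0 \<le> D / h x" using C_pos H D(1) hpos[OF x] by simp_all
      then show ?thesis unfolding add_divide_distrib using left[OF x] D(2) by (cases "x \<le> m") auto
    qed
    show ?thesis
    proof (cases "r = \<infinity>")
      case True
      then have \<rho>: "?\<rho> = 0" by (simp add: inv_endpoint_def)
      \<comment> \<open>Near infinity \<open>h\<close> is merely bounded away from 0, and the decay
        of \<open>w\<close> comes from the Gaussian factor through \<open>E z\<close> \<le>
        \<open>M / z^2\<close>. So \<open>s\<close> stays below \<open>C / m\<close>, and a constant
        is a multiple of \<open>1 / h\<close> because h \<le> H.\<close>
      have right: "\<bar>s x\<bar> \<le> (C / m * H) / h x" if x: "x \<in> ?I" "m \<le> x" for x
      proof -
        have "- (s m + C / m) \<le> - (s x + C / x)"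
        proof (rule mono_of_nonneg_derivative[OF x(2), where f="\<lambda>z. - (s z + C / z)" and f'="\<lambda>z. C / z\<^sup>2 - w z"])
          fix z assume z: "m \<le> z" "z \<le> x"
          have zI: "z \<in> ?I" using state_space_between[OF m x(1) z] .
          show "((\<lambda>z. - (s z + C / z)) has_real_derivative C / z\<^sup>2 - w z) (at z)"
            by (rule derivative_eq_intros ds zI refl)+ (use I(1)[OF zI] in \<open>auto simp: power2_eq_square\<close>)
          have "w z \<le> E z / (\<kappa> * 1)\<^sup>2" by (rule w_le[OF zI]) (use low2[OF zI z(1)] \<rho> in auto)
          also have "E z \<le> M / z\<^sup>2"
          proof -
            have "E z * z\<^sup>2 \<le> E z * (1 + z\<^sup>2)" using E_pos[of z] by (intro mult_left_mono) auto
            then show ?thesis using E_le[of z] I(1)[OF zI] by (simp add: pos_le_divide_eq)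
          qed
          then have "E z / (\<kappa> * 1)\<^sup>2 \<le> (M / z\<^sup>2) / (\<kappa> * 1)\<^sup>2" by (intro divide_right_mono) auto
          also have "\<dots> = C / z\<^sup>2" by (simp add: C_def)
          finally show "0 \<le> C / z\<^sup>2 - w z" by simp
        qed
        then have "s x + C / x \<le> C / m" by (simp add: sm)
        moreover have "0 < C / x" using C_pos I(1)[OF x(1)] by simp
        ultimately have "s x \<le> C / m * 1" by simp
        also have "\<dots> \<le> C / m * (H / h x)"
          using hH[OF x(1)] hpos[OF x(1)] C_pos m0 by (intro mult_left_mono) auto
        finally show ?thesis using s_ge[OF x] by simp
      qed
      have "\<bar>s x\<bar> \<le> (C * H + C / m * H) / h x" if x: "x \<in> ?I" for x
        by (rule comb[OF x _ right[OF x]]) (use C_pos H m0 in auto)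
      then show ?thesis using C_pos H m0 by (intro exI[of _ "C * H + C / m * H"]) auto
    next
      case False
      then have \<rho>: "0 < ?\<rho>" using r by (cases r) (auto simp: inv_endpoint_def)
      have right: "\<bar>s x\<bar> \<le> (C / ?\<rho> * H) / h x" if x: "x \<in> ?I" "m \<le> x" for x
      proof -
        have "C / (?\<rho> * (1 - ?\<rho> * m)) - s m \<le> C / (?\<rho> * (1 - ?\<rho> * x)) - s x"
        proof (rule mono_of_nonneg_derivative[OF x(2), where f="\<lambda>z. C / (?\<rho> * (1 - ?\<rho> * z)) - s z" and f'="\<lambda>z. C / (1 - ?\<rho> * z)\<^sup>2 - w z"])
          fix z assume z: "m \<le> z" "z \<le> x"
          have zI: "z \<in> ?I" using state_space_between[OF m x(1) z] .
          show "((\<lambda>z. C / (?\<rho> * (1 - ?\<rho> * z)) - s z) has_real_derivative C / (1 - ?\<rho> * z)\<^sup>2 - w z) (at z)"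
          proof (rule DERIV_diff[OF _ ds[OF zI]])
            have "1 - ?\<rho> * z \<noteq> 0" "?\<rho> \<noteq> 0" using I(2)[OF zI] \<rho> by auto
            then show "((\<lambda>z. C / (?\<rho> * (1 - ?\<rho> * z))) has_real_derivative C / (1 - ?\<rho> * z)\<^sup>2) (at z)"
              by (auto intro!: derivative_eq_intros simp: power2_eq_square divide_simps)
          qed
          have "w z \<le> E z / (\<kappa> * (1 - ?\<rho> * z))\<^sup>2" by (rule w_le[OF zI]) (use low2[OF zI z(1)] I(2)[OF zI] in auto)
          also have "\<dots> \<le> M / (\<kappa> * (1 - ?\<rho> * z))\<^sup>2" using E_M by (intro divide_right_mono) auto
          also have "\<dots> = C / (1 - ?\<rho> * z)\<^sup>2" by (simp add: C_def power_mult_distrib)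
          finally show "0 \<le> C / (1 - ?\<rho> * z)\<^sup>2 - w z" by simp
        qed
        moreover have "0 < C / (?\<rho> * (1 - ?\<rho> * m))" using C_pos \<rho> I(2)[OF m] by simp
        ultimately have "s x \<le> C / (?\<rho> * (1 - ?\<rho> * x))" by (simp add: sm)
        also have "\<dots> \<le> (C / ?\<rho> * H) / h x"
        proof -
          have "1 / (1 - ?\<rho> * x) \<le> H / h x"
            using up2[OF x(1)] hpos[OF x(1)] I(2)[OF x(1)] by (simp add: field_simps)
          then have "C / ?\<rho> * (1 / (1 - ?\<rho> * x)) \<le> C / ?\<rho> * (H / h x)" using C_pos \<rho> by (intro mult_left_mono) auto
          then show ?thesis by simp
        qed
        finally show ?thesis using s_ge[OF x] by simp
      qed
      have "\<bar>s x\<bar> \<le> (C * H + C / ?\<rho> * H) / h x" if x: "x \<in> ?I" for x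
        by (rule comb[OF x _ right[OF x]]) (use C_pos H \<rho> in auto)
      then show ?thesis using C_pos H \<rho> by (intro exI[of _ "C * H + C / ?\<rho> * H"]) auto
    qed
  qed
  then obtain k1 where k1: "0 \<le> k1" "\<And>x. x \<in> ?I \<Longrightarrow> \<bar>s x\<bar> \<le> k1 / h x" by blast
  define V where "V x = sqrt (1 + (s x)\<^sup>2)" for x
  have V2: "(V x)\<^sup>2 = 1 + (s x)\<^sup>2" for x by (simp add: V_def)
  have V1: "1 \<le> V x" for x by (simp add: V_def)
  have Vs: "\<bar>s x\<bar> \<le> V x" for x unfolding V_def by (rule real_le_rsqrt) simp
  have Vpos: "0 < V x" for x using V1[of x] by linarith
  have V_le: "V x \<le> (H + k1) / h x" if x: "x \<in> ?I" for x
  proof -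
    have "(V x)\<^sup>2 \<le> (1 + \<bar>s x\<bar>)\<^sup>2" unfolding V2 by (simp add: power2_eq_square algebra_simps)
    then have "V x \<le> 1 + \<bar>s x\<bar>" by (rule power2_le_imp_le) simp
    also have "1 \<le> H / h x" using hH[OF x] hpos[OF x] by simp
    finally show ?thesis using k1(2)[OF x] by (simp add: add_divide_distrib)
  qed
  \<comment> \<open>\<open>e\<close> is a lower bound for \<open>E\<close> where the argument is at
    most \<open>b\<close>: everywhere if \<open>r\<close> is finite, but only to the left of
    \<open>m\<close> if \<open>r = \<infinity>\<close>, since \<open>E\<close> decays at
    infinity.\<close>
  define b where "b = (if r = \<infinity> then m else real_of_ereal r)"
  define e where "e = exp (- (2 * \<bar>c\<bar> * b) - b\<^sup>2)"
  have e_pos: "0 < e" by (simp add: e_def)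
  have eE: "e \<le> E x" if x: "x \<in> ?I" and reg: "x \<le> m \<or> r \<noteq> \<infinity>" for x
  proof -
    have "x \<le> b" using x reg r by (cases r) (auto simp: b_def state_space_def)
    then have "x\<^sup>2 \<le> b\<^sup>2" "c * x \<le> \<bar>c\<bar> * b" using I(1)[OF x] by (auto intro!: power_mono mult_mono)
    then show ?thesis unfolding e_def E_def by simp
  qed
  have w_ge: "H / (h x)\<^sup>2 \<le> H / e * w x" if x: "x \<in> ?I" and reg: "x \<le> m \<or> r \<noteq> \<infinity>" for x
  proof -
    have "1 \<le> E x / e" using eE[OF that] e_pos by simp
    then have "H / (h x)\<^sup>2 * 1 \<le> H / (h x)\<^sup>2 * (E x / e)" using H by (intro mult_left_mono) auto
    then show ?thesis by (simp add: w_def mult.commute)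
  qed
  have dinv: "((\<lambda>z. 1 / h z) has_real_derivative - h' z / (h z)\<^sup>2) (at z)" if "z \<in> ?I" for z
    by (rule derivative_eq_intros dh that hne refl)+ (simp add: power2_eq_square)
  have dinvb: "\<bar>- h' z / (h z)\<^sup>2\<bar> \<le> H / (h z)\<^sup>2" if "z \<in> ?I" for z
    using h'b[OF that] by (simp add: divide_right_mono)
  \<comment> \<open>The derivative of \<open>1 / h\<close> is at most \<open>H / h^2\<close>, hence
    at most \<open>H / e * w\<close> in absolute value; integrating from \<open>m\<close> gives the
    first two summands. The last one covers the right part for \<open>r = \<infinity>\<close>, where
    \<open>h\<close> is at least \<open>\<kappa>\<close>.\<close>
  define k2 where "k2 = 1 / h m + H / e + 1 / \<kappa>"
  have k2_pos: "0 < k2" using hpos[OF m] H e_pos \<kappa> by (simp add: k2_def add_pos_pos)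
  have V_ge: "1 / h x \<le> k2 * V x" if x: "x \<in> ?I" for x
  proof -
    consider "x \<le> m" | "m \<le> x" "r \<noteq> \<infinity>" | "m \<le> x" "r = \<infinity>" by linarith
    then have "1 / h x \<le> (1 / h m + H / e * \<bar>s x\<bar>) + 1 / \<kappa>"
    proof cases
      case 1
      have "1 / h x + H / e * s x \<le> 1 / h m + H / e * s m"
      proof (rule mono_of_nonneg_derivative[OF 1, where f="\<lambda>z. 1 / h z + H / e * s z" and f'="\<lambda>z. - h' z / (h z)\<^sup>2 + H / e * w z"])
        fix z assume z: "x \<le> z" "z \<le> m"
        have zI: "z \<in> ?I" using state_space_between[OF x m z] .
        show "((\<lambda>z. 1 / h z + H / e * s z) has_real_derivative - h' z / (h z)\<^sup>2 + H / e * w z) (at z)"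
          by (intro DERIV_add dinv DERIV_cmult ds zI)
        show "0 \<le> - h' z / (h z)\<^sup>2 + H / e * w z" using dinvb[OF zI] w_ge[OF zI] z by linarith
      qed
      moreover have "H / e * \<bar>s x\<bar> = - (H / e * s x)" using s_le[OF x 1] by simp
      moreover have "0 < 1 / \<kappa>" "H / e * s m = 0" using \<kappa> by (simp_all add: sm)
      ultimately show ?thesis by linarith
    next
      case 2
      have "H / e * s m - 1 / h m \<le> H / e * s x - 1 / h x"
      proof (rule mono_of_nonneg_derivative[OF 2(1), where f="\<lambda>z. H / e * s z - 1 / h z" and f'="\<lambda>z. H / e * w z - (- h' z / (h z)\<^sup>2)"])
        fix z assume z: "m \<le> z" "z \<le> x"
        have zI: "z \<in> ?I" using state_space_between[OF m x z] .
        show "((\<lambda>z. H / e * s z - 1 / h z) has_real_derivative H / e * w z - (- h' z / (h z)\<^sup>2)) (at z)"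
          by (intro DERIV_diff dinv DERIV_cmult ds zI)
        show "0 \<le> H / e * w z - (- h' z / (h z)\<^sup>2)" using dinvb[OF zI] w_ge[OF zI] 2 by linarith
      qed
      moreover have "H / e * \<bar>s x\<bar> = H / e * s x" using s_ge[OF x 2(1)] by simp
      moreover have "0 < 1 / \<kappa>" "H / e * s m = 0" using \<kappa> by (simp_all add: sm)
      ultimately show ?thesis by linarith
    next
      case 3
      have "\<kappa> \<le> h x" using low2[OF x 3(1)] 3(2) by (simp add: inv_endpoint_def)
      then have "1 / h x \<le> 1 / \<kappa>" using \<kappa> by (simp add: frac_le)
      moreover have "0 \<le> 1 / h m + H / e * \<bar>s x\<bar>" using hpos[OF m] H e_pos by simp
      ultimately show ?thesis by linarith
    qed
    also have "\<dots> \<le> (1 / h m * V x + H / e * V x) + 1 / \<kappa> * V x"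
    proof (intro add_mono)
      show "1 / h m \<le> 1 / h m * V x" using mult_left_mono[OF V1[of x], of "1 / h m"] hpos[OF m] by simp
      show "H / e * \<bar>s x\<bar> \<le> H / e * V x" using Vs H e_pos by (intro mult_left_mono) auto
      show "1 / \<kappa> \<le> 1 / \<kappa> * V x" using mult_left_mono[OF V1[of x], of "1 / \<kappa>"] \<kappa> by simp
    qed
    also have "\<dots> = k2 * V x" by (simp add: k2_def algebra_simps)
    finally show ?thesis .
  qed
  \<comment> \<open>The logarithmic derivative of \<open>w\<close>. It contains \<open>h'\<close>
    but not \<open>h''\<close>, and \<open>q / 2 + h' / h + c = - y\<close>.\<close>
  define q where "q y = - 2 * h' y / h y - 2 * c - 2 * y" for y
  have dw: "(w has_real_derivative w y * q y) (at y)" if y: "y \<in> ?I" for y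
  proof -
    have dE: "(E has_real_derivative E y * (- 2 * c - 2 * y)) (at y)"
      unfolding E_def[abs_def] by (auto intro!: derivative_eq_intros)
    have "((\<lambda>y. E y / (h y)\<^sup>2) has_real_derivative (E y * (- 2 * c - 2 * y) * (h y)\<^sup>2 - E y * (2 * h y * h' y)) / ((h y)\<^sup>2 * (h y)\<^sup>2)) (at y)"
      by (rule derivative_eq_intros dE dh y refl)+ (use hne[OF y] in \<open>auto simp: algebra_simps\<close>)
    moreover have "(E y * (- 2 * c - 2 * y) * (h y)\<^sup>2 - E y * (2 * h y * h' y)) / ((h y)\<^sup>2 * (h y)\<^sup>2) = w y * q y"
      using hne[OF y] by (simp add: w_def q_def power2_eq_square field_simps)
    ultimately show ?thesis by (simp add: w_def[abs_def])
  qed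
  have dq: "(q has_real_derivative - 2 * (G y * h y - h' y * h' y) / (h y)\<^sup>2 - 2) (at y)" if y: "y \<in> ?I" for y
    unfolding q_def[abs_def]
    by (rule derivative_eq_intros dh dh' y hne refl)+ (use hne[OF y] in \<open>simp add: power2_eq_square field_simps\<close>)
  define V' where "V' x = s x * w x / V x" for x
  define V'' where "V'' x = (w x)\<^sup>2 / (V x)^3 + s x / V x * (w x * q x)" for x
  have dV: "(V has_real_derivative V' x) (at x)" if x: "x \<in> ?I" for x
    unfolding V_def[abs_def] V'_def by (rule DERIV_sqrt_one_plus_square[OF ds[OF x]])
  have dV': "(V' has_real_derivative V'' x) (at x)" if x: "x \<in> ?I" for x
  proof -
    have "(V' has_real_derivative ((w x * w x + s x * (w x * q x)) * V x - s x * w x * V' x) / (V x * V x)) (at x)"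
      unfolding V'_def[abs_def]
      by (rule DERIV_cong[OF DERIV_divide[OF DERIV_mult[OF ds[OF x] dw[OF x]] dV[OF x, unfolded V'_def]]])
        (use Vpos[of x] in \<open>auto simp: algebra_simps\<close>)
    moreover have "((w x * w x + s x * (w x * q x)) * V x - s x * w x * V' x) / (V x * V x) = V'' x"
    proof -
      have "(w x * w x + s x * (w x * q x)) * V x - s x * w x * V' x
          = (w x * w x * ((V x)\<^sup>2 - (s x)\<^sup>2) + s x * (w x * q x) * (V x)\<^sup>2) / V x"
        using Vpos[of x] by (simp add: V'_def field_simps power2_eq_square)
      also have "(V x)\<^sup>2 - (s x)\<^sup>2 = 1" by (simp add: V2)
      finally show ?thesis using Vpos[of x] by (simp add: V''_def field_simps power2_eq_square power3_eq_cube)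
    qed
    ultimately show ?thesis by simp
  qed
  \<comment> \<open>\<open>h''\<close> is only continuous, so the second derivative of
    \<open>1 / h\<close> need not be Lipschitz. \<open>V''\<close> involves \<open>h\<close> and
    \<open>h'\<close> alone, through \<open>s\<close>, \<open>w\<close>, \<open>V\<close> and
    \<open>q\<close>, and these are continuously differentiable.\<close>
  have V''_lip: "\<exists>L. L-lipschitz_on {a..b} V''" if ab: "{a..b} \<subseteq> ?I" for a b
  proof -
    have cs: "continuous_on {a..b} s" "continuous_on {a..b} w" "continuous_on {a..b} V" "continuous_on {a..b} q"
      using ab by (auto intro!: DERIV_continuous_on intro: has_field_derivative_at_within ds dw dV dq)
    have cV': "continuous_on {a..b} V'" using ab by (auto intro!: DERIV_continuous_on intro: has_field_derivative_at_within dV')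
    have sub: "z \<in> ?I" if "z \<in> {a..b}" for z using ab that by blast
    have L1: "\<exists>L. L-lipschitz_on {a..b} w"
      by (rule lipschitz_Icc_of_C1[where f'="\<lambda>y. w y * q y"]) (use dw sub cs in \<open>auto intro!: continuous_intros\<close>)
    have L2: "\<exists>L. L-lipschitz_on {a..b} q"
      by (rule lipschitz_Icc_of_C1[OF dq[OF sub]])
        (use hne sub in \<open>auto intro!: continuous_intros continuous_on_subset[OF cG ab] continuous_on_subset[OF ch ab] continuous_on_subset[OF ch' ab]\<close>)
    have L3: "\<exists>L. L-lipschitz_on {a..b} s"
      by (rule lipschitz_Icc_of_C1[where f'=w]) (use ds sub cs in auto)
    have L4: "\<exists>L. L-lipschitz_on {a..b} (\<lambda>y. inverse (V y))"
    proof (rule lipschitz_Icc_of_C1[where f'="\<lambda>y. - (inverse (V y) * V' y * inverse (V y))"])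
      show "((\<lambda>y. inverse (V y)) has_real_derivative - (inverse (V z) * V' z * inverse (V z))) (at z)" if "z \<in> {a..b}" for z
        using Vpos[of z] dV[OF sub[OF that]] by (intro DERIV_inverse') auto
      show "continuous_on {a..b} (\<lambda>y. - (inverse (V y) * V' y * inverse (V y)))"
        using Vpos by (intro continuous_intros cs cV') (metis less_irrefl)+
    qed
    show ?thesis
    proof (rule lipschitz_Icc_cong[OF lipschitz_Icc_add])
      show "\<exists>L. L-lipschitz_on {a..b} (\<lambda>z. (w z * w z) * (inverse (V z) * (inverse (V z) * inverse (V z))))"
        by (intro lipschitz_Icc_mult L1 L4)
      show "\<exists>L. L-lipschitz_on {a..b} (\<lambda>z. (s z * inverse (V z)) * (w z * q z))"
        by (intro lipschitz_Icc_mult L1 L2 L3 L4)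
    qed (simp add: V''_def divide_inverse power2_eq_square power3_eq_cube mult_ac)
  qed
  define k3 where "k3 = (M * k2\<^sup>2)\<^sup>2 / 2 + M * k2 / \<kappa>"
  have k3_nn: "0 \<le> k3" using M_pos k2_pos \<kappa> by (simp add: k3_def)
  have gen: "V'' y / 2 + (deriv h y / h y + c) * V' y \<le> k3 * V y" if y: "y \<in> ?I" for y
  proof -
    \<comment> \<open>The drift cancels against \<open>q\<close> except for \<open>- y\<close>. The
      remaining diffusion term is at most a multiple of \<open>V\<close>, because \<open>w\<close>
      is bounded by a multiple of \<open>V^2\<close>.\<close>
    have e1: "V'' y / 2 + (deriv h y / h y + c) * V' y = (w y)\<^sup>2 / (2 * (V y)^3) - y * w y * (s y / V y)"
    proof -
      define u where "u = s y * w y / V y"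
      define t where "t = h' y / h y"
      have a: "s y / V y * (w y * q y) = u * q y" "y * w y * (s y / V y) = y * u" "V' y = u" "q y = - 2 * t - 2 * c - 2 * y"
        by (simp_all add: u_def t_def V'_def q_def)
      have "V'' y / 2 + (deriv h y / h y + c) * V' y = ((w y)\<^sup>2 / (V y)^3 + u * q y) / 2 + (t + c) * u"
        by (simp only: V''_def a(1,3) deriv_h[OF y] t_def)
      also have "\<dots> = (w y)\<^sup>2 / (V y)^3 / 2 - y * u"
      proof -
        have "(A + u * q y) / 2 + (t + c) * u = A / 2 - y * u" for A by (simp add: a(4) field_simps)
        then show ?thesis .
      qed
      also have "(w y)\<^sup>2 / (V y)^3 / 2 = (w y)\<^sup>2 / (2 * (V y)^3)" by simp
      finally show ?thesis by (simp only: a(2))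
    qed
    have wV: "w y \<le> M * k2\<^sup>2 * (V y)\<^sup>2"
    proof -
      have "w y \<le> M * (1 / h y)\<^sup>2" unfolding w_def using E_M[of y] by (simp add: divide_right_mono power_divide)
      also have "\<dots> \<le> M * (k2 * V y)\<^sup>2" using V_ge[OF y] M_pos hpos[OF y] by (intro mult_left_mono power_mono) auto
      finally show ?thesis by (simp add: power_mult_distrib)
    qed
    have t1: "(w y)\<^sup>2 / (2 * (V y)^3) \<le> (M * k2\<^sup>2)\<^sup>2 / 2 * V y"
    proof -
      have "(w y)\<^sup>2 \<le> (M * k2\<^sup>2 * (V y)\<^sup>2)\<^sup>2" using wV w_pos[OF y] by (intro power_mono) auto
      then have "(w y)\<^sup>2 / (2 * (V y)^3) \<le> (M * k2\<^sup>2 * (V y)\<^sup>2)\<^sup>2 / (2 * (V y)^3)" using Vpos[of y] by (intro divide_right_mono) auto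
      also have "\<dots> = (M * k2\<^sup>2)\<^sup>2 / 2 * V y" using Vpos[of y] by (simp add: field_simps power2_eq_square power3_eq_cube)
      finally show ?thesis .
    qed
    \<comment> \<open>To the right of \<open>m\<close> the term has a favourable sign. To the left,
      one factor \<open>1 / h\<close> of \<open>w\<close> is compensated by \<open>y\<close>, since
      \<open>y / h y\<close> is at most \<open>1 / \<kappa>\<close>, and the other is bounded by
      \<open>k2 * V y\<close>.\<close>
    have t2: "- (y * w y * (s y / V y)) \<le> M * k2 / \<kappa> * V y"
    proof (cases "m \<le> y")
      case True
      have "0 \<le> y * w y * (s y / V y)" using s_ge[OF y True] Vpos[of y] w_pos[OF y] I(1)[OF y] by simp
      moreover have "0 \<le> M * k2 / \<kappa> * V y" using M_pos k2_pos \<kappa> Vpos[of y] by simp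
      ultimately show ?thesis by linarith
    next
      case False
      then have ym: "y \<le> m" by simp
      have "- (y * w y * (s y / V y)) = (y * w y) * (\<bar>s y\<bar> / V y)" using s_le[OF y ym] by simp
      also have "\<dots> \<le> (y * w y) * 1"
        using Vs[of y] Vpos[of y] I(1)[OF y] w_pos[OF y] by (intro mult_left_mono) auto
      also have "\<dots> = E y * (y / h y) * (1 / h y)" by (simp add: w_def power2_eq_square)
      also have "\<dots> \<le> M * (1 / \<kappa>) * (k2 * V y)"
      proof (intro mult_mono E_M V_ge y)
        show "y / h y \<le> 1 / \<kappa>" using low1[OF y ym] \<kappa> hpos[OF y] by (simp add: field_simps)
      qed (use I(1)[OF y] hpos[OF y] M_pos \<kappa> E_pos in \<open>auto intro: less_imp_le\<close>)
      also have "\<dots> = M * k2 / \<kappa> * V y" by simp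
      finally show ?thesis .
    qed
    show ?thesis unfolding e1 k3_def using t1 t2 by (simp add: distrib_right)
  qed
  \<comment> \<open>One summand for each regime. Where \<open>E\<close> is at least \<open>e\<close>
    and \<bar>s\<bar> \<ge> 1, \<open>V^2\<close> \<le> \<open>2 * s^2\<close> gives
    \<open>V'^2\<close> \<ge> \<open>w^2 / 2\<close>, which is of order \<open>h^-4\<close>. Where
    \<bar>s\<bar> < 1, \<open>V^2\<close> is at most 2 and the bound \<open>1 / h\<close> \<le>
    \<open>k2 * V\<close> suffices. On the right part for \<open>r = \<infinity>\<close>,
    \<open>h\<close> is at least \<open>\<kappa>\<close>.\<close>
  define k4 where "k4 = 2 / e\<^sup>2 + 2 * k2^4 + 1 / \<kappa>^4"
  have k4_pos: "0 < k4" using e_pos k2_pos \<kappa> by (simp add: k4_def add_pos_pos)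
  have coer: "(1 / h y)^4 \<le> k4 * ((V' y)\<^sup>2 + (V y)\<^sup>2)" if y: "y \<in> ?I" for y
  proof -
    have a: "(1 / h y)^4 \<le> 2 / e\<^sup>2 * (V' y)\<^sup>2 \<or> (1 / h y)^4 \<le> 2 * k2^4 * (V y)\<^sup>2 \<or> (1 / h y)^4 \<le> 1 / \<kappa>^4 * (V y)\<^sup>2"
    proof (cases "y \<le> m \<or> r \<noteq> \<infinity>")
      case False
      then have "\<kappa> \<le> h y" using low2[OF y] by (simp add: inv_endpoint_def)
      then have "1 / h y \<le> 1 / \<kappa>" using \<kappa> by (simp add: frac_le)
      then have "(1 / h y)^4 \<le> (1 / \<kappa>)^4" using hpos[OF y] by (intro power_mono) auto
      also have "(1 / \<kappa>)^4 * 1 \<le> (1 / \<kappa>)^4 * (V y)\<^sup>2" using \<kappa> by (intro mult_left_mono) (auto simp: V2)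
      finally show ?thesis by (simp add: power_one_over)
    next
      case reg: True
      show ?thesis
      proof (cases "1 \<le> \<bar>s y\<bar>")
        case True
        have "e * (1 / h y)\<^sup>2 \<le> w y" using eE[OF y reg] unfolding w_def by (simp add: divide_right_mono power_divide)
        then have "(e * (1 / h y)\<^sup>2)\<^sup>2 \<le> (w y)\<^sup>2" using e_pos by (intro power_mono) auto
        then have 1: "e\<^sup>2 * (1 / h y)^4 \<le> (w y)\<^sup>2" by (simp add: power_mult_distrib power_mult[symmetric])
        have "1\<^sup>2 \<le> \<bar>s y\<bar>\<^sup>2" using True by (intro power_mono) auto
        then have "(V y)\<^sup>2 \<le> 2 * (s y)\<^sup>2" by (simp add: V2)
        then have "(w y)\<^sup>2 * (V y)\<^sup>2 \<le> (w y)\<^sup>2 * (2 * (s y)\<^sup>2)" by (intro mult_left_mono) auto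
        then have 2: "(w y)\<^sup>2 \<le> 2 * (V' y)\<^sup>2"
          using Vpos[of y] by (simp add: V'_def power_divide power_mult_distrib pos_le_divide_eq mult_ac)
        have "e\<^sup>2 * (1 / h y)^4 \<le> 2 * (V' y)\<^sup>2" using 1 2 by linarith
        then have "(1 / h y)^4 \<le> 2 / e\<^sup>2 * (V' y)\<^sup>2" using e_pos by (simp add: pos_le_divide_eq mult_ac)
        then show ?thesis by blast
      next
        case False
        then have "\<bar>s y\<bar>\<^sup>2 \<le> 1\<^sup>2" by (intro power_mono) auto
        then have v: "(V y)\<^sup>2 \<le> 2" by (simp add: V2)
        have "(1 / h y)^4 \<le> (k2 * V y)^4" using V_ge[OF y] hpos[OF y] by (intro power_mono) auto
        also have "\<dots> = k2^4 * ((V y)\<^sup>2 * (V y)\<^sup>2)" by (simp add: power_mult_distrib power_add[symmetric])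
        also have "\<dots> \<le> k2^4 * (2 * (V y)\<^sup>2)" using v k2_pos by (intro mult_left_mono mult_right_mono) auto
        finally show ?thesis by simp
      qed
    qed
    have n: "0 \<le> 2 / e\<^sup>2 * (V' y)\<^sup>2" "0 \<le> 2 / e\<^sup>2 * (V y)\<^sup>2" "0 \<le> 2 * k2^4 * (V y)\<^sup>2" "0 \<le> 2 * k2^4 * (V' y)\<^sup>2" "0 \<le> 1 / \<kappa>^4 * (V y)\<^sup>2" "0 \<le> 1 / \<kappa>^4 * (V' y)\<^sup>2"
      by simp_all
    have "k4 * ((V' y)\<^sup>2 + (V y)\<^sup>2) = 2 / e\<^sup>2 * (V' y)\<^sup>2 + 2 / e\<^sup>2 * (V y)\<^sup>2 + 2 * k2^4 * (V y)\<^sup>2 + 2 * k2^4 * (V' y)\<^sup>2 + 1 / \<kappa>^4 * (V y)\<^sup>2 + 1 / \<kappa>^4 * (V' y)\<^sup>2"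
      unfolding k4_def by (simp only: distrib_left distrib_right add_ac)
    then show ?thesis using a n by linarith
  qed
  define k where "k = (H + k1) + k2 + k3 + k4"
  have kk: "H + k1 \<le> k" "k2 \<le> k" "k3 \<le> k" "k4 \<le> k" "H \<le> k" "0 < k"
    using H k1(1) k2_pos k3_nn k4_pos by (auto simp: k_def)
  have "lyapunov_function r h c V V' V'' k"
  proof
    show "continuous_on ?I (\<lambda>y. deriv h y / h y + c)"
      by (rule continuous_on_eq[of _ "\<lambda>y. h' y / h y + c"])
        (use hne in \<open>auto simp: deriv_h intro!: continuous_intros ch ch'\<close>)
    fix y assume y: "y \<in> ?I"
    show "V y \<le> k / h y" using V_le[OF y] kk(1) hpos[OF y] by (meson divide_right_mono less_imp_le order_trans)
    show "1 / h y \<le> k * V y" using V_ge[OF y] mult_right_mono[OF kk(2), of "V y"] Vpos[of y] by linarith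
    show "V'' y / 2 + (deriv h y / h y + c) * V' y \<le> k * V y" using gen[OF y] mult_right_mono[OF kk(3), of "V y"] Vpos[of y] by linarith
    show "(1 / h y)^4 \<le> k * ((V' y)\<^sup>2 + (V y)\<^sup>2)" using coer[OF y] mult_right_mono[OF kk(4), of "(V' y)\<^sup>2 + (V y)\<^sup>2"] by simp
    show "h y \<le> k * y" using up1[OF y] mult_right_mono[OF kk(5), of y] I(1)[OF y] by linarith
    show "h y \<le> k * (1 - ?\<rho> * y)" using up2[OF y] mult_right_mono[OF kk(5), of "1 - ?\<rho> * y"] I(2)[OF y] by linarith
    show "y * (deriv h y / h y + c) \<le> 1" if "r = \<infinity>"
    proof -
      have "y * h' y / h y \<le> 1" using xh[OF y that] hpos[OF y] by simp
      moreover have "y * c \<le> 0" using c that I(1)[OF y] by (simp add: mult_nonneg_nonpos)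
      ultimately show ?thesis by (simp add: deriv_h[OF y] distrib_left)
    qed
  qed (use r kk hpos ch dV dV' V''_lip in auto)
  then show ?thesis by blast
qed


subsection \<open>Estimates for \<open>Y\<close>\<close>

context lyapunov_function
begin

lemma V_pos: "y \<in> state_space r \<Longrightarrow> 0 < V y"
  using V_ge[of y] h_pos[of y] k_pos by (smt (verit) divide_pos_pos zero_less_mult_pos)

lemma V_continuous: "A \<subseteq> state_space r \<Longrightarrow> continuous_on A V"
  by (rule DERIV_continuous_on) (rule has_field_derivative_at_within[OF V_deriv], blast)

lemma V'_continuous: "A \<subseteq> state_space r \<Longrightarrow> continuous_on A V'"
  by (rule DERIV_continuous_on) (rule has_field_derivative_at_within[OF V'_deriv], blast)

lemma V''_continuous: "{a..b} \<subseteq> state_space r \<Longrightarrow> continuous_on {a..b} V''"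
  using V''_lip lipschitz_on_continuous_on by blast

lemma V_powr_deriv:
  assumes "y \<in> state_space r"
  shows "((\<lambda>y. V y powr a) has_real_derivative a * V y powr (a - 1) * V' y) (at y)"
  by (rule DERIV_chain2[where f="\<lambda>z. z powr a", OF has_real_derivative_powr[OF V_pos[OF assms]] V_deriv[OF assms]])

lemma V_powr_lipschitz:
  assumes ab: "{a..b} \<subseteq> state_space r"
  shows "\<exists>L. L-lipschitz_on {a..b} (\<lambda>y. V y powr e)"
proof (rule lipschitz_Icc_of_C1)
  show "((\<lambda>y. V y powr e) has_real_derivative e * V z powr (e - 1) * V' z) (at z)" if "z \<in> {a..b}" for z
    using ab that by (intro V_powr_deriv) blast
  have "V z \<noteq> 0" if "z \<in> {a..b}" for z using V_pos[of z] ab that by force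
  then show "continuous_on {a..b} (\<lambda>z. e * V z powr (e - 1) * V' z)"
    using ab by (intro continuous_intros V_continuous V'_continuous) auto
qed

lemma V'_lipschitz: "{a..b} \<subseteq> state_space r \<Longrightarrow> \<exists>L. L-lipschitz_on {a..b} V'"
  by (rule lipschitz_Icc_of_C1[OF V'_deriv V''_continuous]) auto

text \<open>The hypotheses of the local estimate, required on the whole state space, so that one
  function serves every compact subinterval with the same constant \<open>K\<close>.\<close>

definition is_lyapunov :: "(real \<Rightarrow> real) \<Rightarrow> (real \<Rightarrow> real) \<Rightarrow> (real \<Rightarrow> real) \<Rightarrow> real \<Rightarrow> (real \<Rightarrow> real) \<Rightarrow> bool" where
  "is_lyapunov \<phi> \<phi>' \<phi>'' K \<theta> \<longleftrightarrow> 0 < K \<and>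
     (\<forall>y\<in>state_space r. (\<phi> has_real_derivative \<phi>' y) (at y) \<and> (\<phi>' has_real_derivative \<phi>'' y) (at y) \<and>
        0 \<le> \<phi> y \<and> 0 \<le> \<theta> y \<and> \<phi>'' y / 2 + (deriv h y / h y + c) * \<phi>' y \<le> K * \<phi> y - \<theta> y) \<and>
     (\<forall>a b. {a..b} \<subseteq> state_space r \<longrightarrow> (\<exists>L. L-lipschitz_on {a..b} \<phi>'')) \<and> continuous_on (state_space r) \<theta>"

text \<open>The factor \<open>k\<close> makes the function dominate \<open>1 / h\<close>
  itself.\<close>

lemma is_lyapunov_V: "is_lyapunov (\<lambda>y. k * V y) (\<lambda>y. k * V' y) (\<lambda>y. k * V'' y) k (\<lambda>_. 0)"
  unfolding is_lyapunov_def
proof (intro conjI ballI allI impI)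
  fix y assume y: "y \<in> state_space r"
  have "k * (V'' y / 2 + (deriv h y / h y + c) * V' y) \<le> k * (k * V y)"
    using V_gen[OF y] k_pos by (intro mult_left_mono) auto
  then show "k * V'' y / 2 + (deriv h y / h y + c) * (k * V' y) \<le> k * (k * V y) - 0" by (simp add: algebra_simps)
  show "0 \<le> k * V y" using V_pos[OF y] k_pos by simp
qed (auto intro: k_pos DERIV_cmult V_deriv V'_deriv lipschitz_Icc_mult[OF lipschitz_Icc_const V''_lip])

text \<open>The chain rule gives
  \<open>L (V^q) = q V^(q-1) L V - q (1 - q) / 2 * V^(q-2) V'^2\<close>. Coercivity bounds
  \<open>V'^2\<close> below by \<open>h^-4 / k - V^2\<close>, and as \<open>q < 2\<close> the bound
  V \<le> k / h gives \<open>V^(q-2)\<close> at least the order of \<open>h^(2-q)\<close>. The loss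
  \<open>V^(q-2) V^2 = V^q\<close> is absorbed in \<open>K\<close>.\<close>

lemma is_lyapunov_powr:
  assumes p: "0 \<le> p" "p < 1"
  shows "\<exists>\<phi> \<phi>' \<phi>'' K. is_lyapunov \<phi> \<phi>' \<phi>'' K (\<lambda>y. 1 / h y powr (2 + p))"
proof -
  \<comment> \<open>The midpoint of \<open>p\<close> and 1. For \<open>p = 0\<close> the exponent
    \<open>p\<close> itself would make the power constant and \<open>\<gamma>\<close> zero.\<close>
  define q where "q = (1 + p) / 2"
  have q: "0 < q" "q < 1" "p \<le> q" using p by (auto simp: q_def)
  define \<gamma> where "\<gamma> = q * (1 - q) / 2"
  have \<gamma>: "0 < \<gamma>" using q by (simp add: \<gamma>_def)
  \<comment> \<open>The coefficient of \<open>h^(-2-q)\<close> in the lower bound; dividing by it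
    normalises the gain to exactly this power. Passing to the smaller exponent \<open>2 + p\<close>
    costs at most 1 when \<open>1 / h\<close> is below 1, and the summand 1 in \<open>\<phi>\<close>
    pays for that.\<close>
  define A where "A = \<gamma> / k * k powr (q - 2)"
  have A: "0 < A" using \<gamma> k_pos by (simp add: A_def)
  define \<phi> where "\<phi> y = 1 / A * V y powr q + 1" for y
  define \<phi>' where "\<phi>' y = q / A * (V y powr (q - 1) * V' y)" for y
  define \<phi>'' where "\<phi>'' y = q / A * ((q - 1) * (V y powr (q - 2) * (V' y * V' y)) + V y powr (q - 1) * V'' y)" for y
  define K where "K = q * k + \<gamma> + 1"
  have "is_lyapunov \<phi> \<phi>' \<phi>'' K (\<lambda>y. 1 / h y powr (2 + p))"
    unfolding is_lyapunov_def
  proof (intro conjI ballI allI impI)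
    show "0 < K" using q k_pos \<gamma> by (simp add: K_def add_pos_pos)
    show "continuous_on (state_space r) (\<lambda>y. 1 / h y powr (2 + p))"
      using h_pos by (intro continuous_intros h_cont) (force dest: h_pos)+
    show "\<exists>L. L-lipschitz_on {a..b} \<phi>''" if ab: "{a..b} \<subseteq> state_space r" for a b
      unfolding \<phi>''_def
      by (intro lipschitz_Icc_mult lipschitz_Icc_add lipschitz_Icc_const V_powr_lipschitz V'_lipschitz V''_lip ab)
  next
    fix y assume y: "y \<in> state_space r"
    note Vy = V_pos[OF y] and hy = h_pos[OF y]
    show "(\<phi> has_real_derivative \<phi>' y) (at y)"
      unfolding \<phi>_def[abs_def] \<phi>'_def
      by (rule DERIV_cong[OF DERIV_add[OF DERIV_cmult[OF V_powr_deriv[OF y]] DERIV_const]]) simp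
    show "(\<phi>' has_real_derivative \<phi>'' y) (at y)"
      unfolding \<phi>'_def[abs_def] \<phi>''_def
      by (rule DERIV_cong[OF DERIV_cmult[OF DERIV_mult[OF V_powr_deriv[OF y] V'_deriv[OF y]]]]) (simp add: algebra_simps)
    have \<phi>1: "1 \<le> \<phi> y" using A by (simp add: \<phi>_def)
    then show "0 \<le> \<phi> y" by simp
    show "0 \<le> 1 / h y powr (2 + p)" by simp
    define P where "P = V y powr (q - 2)"
    have P: "0 < P" using Vy by (simp add: P_def)
    have e1: "V y powr (q - 1) = P * V y" and e2: "V y powr q = P * (V y)\<^sup>2"
    proof -
      have "V y powr (q - 1) = V y powr (q - 2) * V y powr 1" unfolding powr_add[symmetric] by simp
      then show "V y powr (q - 1) = P * V y" using Vy by (simp add: P_def)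
      have "V y powr q = V y powr (q - 2) * V y powr 2" unfolding powr_add[symmetric] by simp
      then show "V y powr q = P * (V y)\<^sup>2" using Vy by (simp add: P_def powr_numeral)
    qed
    have Pge: "k powr (q - 2) * (1 / h y) powr (2 + q) \<le> P * (1 / h y)^4"
    proof -
      have "(k / h y) powr (q - 2) \<le> P"
        unfolding P_def using q Vy V_le[OF y] by (intro powr_mono2') auto
      then have "(k / h y) powr (q - 2) * (1 / h y)^4 \<le> P * (1 / h y)^4" by (intro mult_right_mono) auto
      moreover have "(k / h y) powr (q - 2) * (1 / h y)^4 = k powr (q - 2) * (1 / h y) powr (2 + q)"
      proof -
        have "(k / h y) powr (q - 2) = k powr (q - 2) * (1 / h y) powr (q - 2)"
          using powr_mult[of k "1 / h y" "q - 2"] k_pos hy by simp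
        moreover have "(1 / h y)^4 = (1 / h y) powr 4" using hy by (simp add: powr_numeral)
        moreover have "(1 / h y) powr (q - 2) * (1 / h y) powr 4 = (1 / h y) powr (2 + q)"
          unfolding powr_add[symmetric] by (simp add: add.commute)
        ultimately show ?thesis by (simp only: mult.assoc)
      qed
      ultimately show ?thesis by simp
    qed
    have main: "q * (P * V y * (V'' y / 2 + (deriv h y / h y + c) * V' y)) - \<gamma> * (P * (V' y)\<^sup>2)
        \<le> (q * k + \<gamma>) * (P * (V y)\<^sup>2) - A * (1 / h y) powr (2 + q)"
    proof -
      have "q * (P * V y * (V'' y / 2 + (deriv h y / h y + c) * V' y)) \<le> q * (P * V y * (k * V y))"
        using V_gen[OF y] q P Vy by (intro mult_left_mono) auto
      moreover have "\<gamma> / k * (P * (1 / h y)^4) \<le> \<gamma> / k * (P * (k * ((V' y)\<^sup>2 + (V y)\<^sup>2)))"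
        using V_coercive[OF y] \<gamma> k_pos P by (intro mult_left_mono) auto
      moreover have "\<gamma> / k * (P * (k * ((V' y)\<^sup>2 + (V y)\<^sup>2))) = \<gamma> * (P * (V' y)\<^sup>2) + \<gamma> * (P * (V y)\<^sup>2)"
        using k_pos by (simp add: field_simps)
      moreover have "\<gamma> / k * (k powr (q - 2) * (1 / h y) powr (2 + q)) \<le> \<gamma> / k * (P * (1 / h y)^4)"
        using Pge \<gamma> k_pos by (intro mult_left_mono) auto
      moreover have "q * (P * V y * (k * V y)) = q * k * (P * (V y)\<^sup>2)" by (simp add: power2_eq_square)
      ultimately show ?thesis unfolding A_def by (simp only: distrib_right mult.assoc)
    qed
    have eq: "\<phi>'' y / 2 + (deriv h y / h y + c) * \<phi>' y
        = (q * (P * V y * (V'' y / 2 + (deriv h y / h y + c) * V' y)) - \<gamma> * (P * (V' y)\<^sup>2)) / A"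
      unfolding \<phi>''_def \<phi>'_def e1 P_def[symmetric] \<gamma>_def using A by (simp add: field_simps power2_eq_square)
    have "\<phi>'' y / 2 + (deriv h y / h y + c) * \<phi>' y \<le> ((q * k + \<gamma>) * (P * (V y)\<^sup>2) - A * (1 / h y) powr (2 + q)) / A"
      unfolding eq using main A by (intro divide_right_mono) auto
    also have "\<dots> = (q * k + \<gamma>) * (\<phi> y - 1) - (1 / h y) powr (2 + q)"
      unfolding \<phi>_def e2 using A by (simp add: diff_divide_distrib)
    also have "\<dots> \<le> (q * k + \<gamma>) * \<phi> y + \<phi> y - 1 / h y powr (2 + p)"
    proof -
      have "1 / h y powr (2 + p) = (1 / h y) powr (2 + p)" using hy by (simp add: powr_divide)
      also have "\<dots> \<le> 1 + (1 / h y) powr (2 + q)"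
      proof (cases "1 \<le> 1 / h y")
        case True
        then have "(1 / h y) powr (2 + p) \<le> (1 / h y) powr (2 + q)" using q by (intro powr_mono) auto
        then show ?thesis by simp
      next
        case False
        then have "(1 / h y) powr (2 + p) \<le> 1" using hy p by (intro powr_le1) auto
        then show ?thesis by (simp add: add_increasing2)
      qed
      finally have "1 / h y powr (2 + p) \<le> 1 + (1 / h y) powr (2 + q)" .
      moreover have "(q * k + \<gamma>) * (\<phi> y - 1) \<le> (q * k + \<gamma>) * \<phi> y" using q k_pos \<gamma> by (intro mult_left_mono) auto
      ultimately show ?thesis using \<phi>1 by linarith
    qed
    also have "\<dots> = K * \<phi> y - 1 / h y powr (2 + p)" by (simp add: K_def algebra_simps)
    finally show "\<phi>'' y / 2 + (deriv h y / h y + c) * \<phi>' y \<le> K * \<phi> y - 1 / h y powr (2 + p)" .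
  qed
  then show ?thesis by blast
qed

text \<open>\<open>V\<close> tends to infinity at 0 and at a finite \<open>r\<close>, but it need
  not do so at infinity. There \<open>y^2 + 1\<close> is added: its generator is
  \<open>1 + 2 * y * (h' / h + c)\<close>, at most 3 because y h' \<le> h and c \<le> 0, and the
  summand 1 lets this constant be absorbed.\<close>

lemma is_lyapunov_proper:
  "\<exists>\<Phi> \<Phi>' \<Phi>'' K \<alpha>. is_lyapunov \<Phi> \<Phi>' \<Phi>'' K (\<lambda>_. 0) \<and> 0 < \<alpha> \<and>
     (\<forall>y\<in>state_space r. \<alpha> / y \<le> \<Phi> y \<and> (r \<noteq> \<infinity> \<longrightarrow> \<alpha> / (1 - inv_endpoint r * y) \<le> \<Phi> y) \<and> (r = \<infinity> \<longrightarrow> y\<^sup>2 \<le> \<Phi> y))"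
proof -
  \<comment> \<open>One factor \<open>k\<close> comes from h \<le> k u, the other from 1 / h \<le> k
    V.\<close>
  define \<alpha> where "\<alpha> = 1 / (k * k)"
  have \<alpha>: "0 < \<alpha>" using k_pos by (simp add: \<alpha>_def)
  note I = state_spaceD[where r=r]
  have V_low: "\<alpha> / u \<le> V y" if y: "y \<in> state_space r" and u: "0 < u" "h y \<le> k * u" for y u
  proof -
    have "1 / (k * u) \<le> 1 / h y" using u h_pos[OF y] k_pos by (intro divide_left_mono) auto
    also have "\<dots> \<le> k * V y" by (rule V_ge[OF y])
    finally have "1 / (k * u) / k \<le> V y" unfolding pos_divide_le_eq[OF k_pos] by (simp only: mult.commute)
    then show ?thesis by (simp add: \<alpha>_def mult_ac)
  qed
  show ?thesis
  proof (cases "r = \<infinity>")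
    case False
    have "is_lyapunov V V' V'' k (\<lambda>_. 0)"
      unfolding is_lyapunov_def using k_pos V_deriv V'_deriv V_pos V_gen V''_lip by (auto intro: less_imp_le)
    moreover have "\<forall>y\<in>state_space r. \<alpha> / y \<le> V y \<and> (r \<noteq> \<infinity> \<longrightarrow> \<alpha> / (1 - inv_endpoint r * y) \<le> V y) \<and> (r = \<infinity> \<longrightarrow> y\<^sup>2 \<le> V y)"
      using False V_low I h_le_left h_le_right by auto
    ultimately show ?thesis using \<alpha> by blast
  next
    case True
    let ?\<Phi> = "\<lambda>y. V y + (y\<^sup>2 + 1)"
    have "is_lyapunov ?\<Phi> (\<lambda>y. V' y + 2 * y) (\<lambda>y. V'' y + 2) (k + 3) (\<lambda>_. 0)"
      unfolding is_lyapunov_def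
    proof (intro conjI ballI allI impI)
      show "0 < k + 3" using k_pos by simp
      show "\<exists>L. L-lipschitz_on {a..b} (\<lambda>y. V'' y + 2)" if "{a..b} \<subseteq> state_space r" for a b
        by (rule lipschitz_Icc_add[OF V''_lip[OF that] lipschitz_Icc_const])
      fix y assume y: "y \<in> state_space r"
      show "(?\<Phi> has_real_derivative V' y + 2 * y) (at y)"
        by (auto intro!: derivative_eq_intros V_deriv[OF y])
      show "((\<lambda>y. V' y + 2 * y) has_real_derivative V'' y + 2) (at y)"
        by (auto intro!: derivative_eq_intros V'_deriv[OF y])
      show "0 \<le> ?\<Phi> y" using V_pos[OF y] by simp
      have "(V'' y + 2) / 2 + (deriv h y / h y + c) * (V' y + 2 * y)
          = (V'' y / 2 + (deriv h y / h y + c) * V' y) + 1 + 2 * (y * (deriv h y / h y + c))"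
        by (simp add: distrib_left mult_ac add_divide_distrib)
      also have "\<dots> \<le> k * V y + 3" using V_gen[OF y] drift_infinite[OF y True] by linarith
      also have "\<dots> \<le> (k + 3) * ?\<Phi> y - 0"
      proof -
        have "0 \<le> k * (y\<^sup>2 + 1) + 3 * (V y + y\<^sup>2)" using k_pos V_pos[OF y] by simp
        then show ?thesis by (simp add: algebra_simps)
      qed
      finally show "(V'' y + 2) / 2 + (deriv h y / h y + c) * (V' y + 2 * y) \<le> (k + 3) * ?\<Phi> y - 0" .
    qed simp_all
    moreover have "\<forall>y\<in>state_space r. \<alpha> / y \<le> ?\<Phi> y \<and> (r \<noteq> \<infinity> \<longrightarrow> \<alpha> / (1 - inv_endpoint r * y) \<le> ?\<Phi> y) \<and> (r = \<infinity> \<longrightarrow> y\<^sup>2 \<le> ?\<Phi> y)"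
    proof
      fix y assume y: "y \<in> state_space r"
      have "\<alpha> / y \<le> V y" using V_low[OF y I(1)[OF y] h_le_left[OF y]] .
      then show "\<alpha> / y \<le> ?\<Phi> y \<and> (r \<noteq> \<infinity> \<longrightarrow> \<alpha> / (1 - inv_endpoint r * y) \<le> ?\<Phi> y) \<and> (r = \<infinity> \<longrightarrow> y\<^sup>2 \<le> ?\<Phi> y)"
        using True V_pos[OF y] by (simp add: add_increasing2)
    qed
    ultimately show ?thesis using \<alpha> by blast
  qed
qed

end

section \<open>Exhaustion of the state space and removal of the localisation\<close>

locale drifted_lyapunov = lyapunov_function r h c V V' V'' k
  for r :: ereal and h c V V' V'' k +
  fixes Q :: "'a measure" and F :: "ennreal \<Rightarrow> 'a measure" and W :: "real \<Rightarrow> 'a \<Rightarrow> real"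
    and Y :: "real \<Rightarrow> 'a \<Rightarrow> ereal" and x :: real
  assumes x: "x \<in> state_space r" and fps: "filtered_prob_space Q F"
    and bm: "brownian_motion Q F W" and dp: "drifted_process Q F r h c x W Y"
begin

text \<open>The shift by 2 gives \<open>lo n < x\<close> already for \<open>n = 0\<close>. The speed
  \<open>1 / n\<close> is chosen so that a function of order \<open>1 / y\<close> grows linearly in
  \<open>n\<close> at this end point.\<close>

definition lo :: "nat \<Rightarrow> real" where "lo n = x / (real n + 2)"

definition hi :: "nat \<Rightarrow> real" where
  "hi n = (if r = \<infinity> then x + real n + 1 else real_of_ereal r - (real_of_ereal r - x) / (real n + 2))"

abbreviation "exit_set n \<equiv> {ereal (lo n)<..<ereal (hi n)}"

lemma x_pos: "0 < x" using state_spaceD[OF x] by simp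

lemma lo_pos: "0 < lo n" using x_pos by (simp add: lo_def)

lemma lo_less: "lo n < x"
  using x_pos mult_strict_left_mono[of 1 "real n + 2" x] by (simp add: lo_def pos_divide_less_eq)

lemma hi_infinite: "r = \<infinity> \<Longrightarrow> hi n = x + real n + 1"
  unfolding hi_def by auto

lemma hi_finite: "r = ereal r' \<Longrightarrow> hi n = r' - (r' - x) / (real n + 2)"
  unfolding hi_def by auto

lemma hi_greater: "x < hi n" and hi_less: "ereal (hi n) < r"
proof -
  have "x < hi n \<and> ereal (hi n) < r"
  proof (cases r)
    case (real r')
    then have "0 < r' - x" using x by (simp add: state_space_def)
    then have "(r' - x) * 1 < (r' - x) * (real n + 2)" by (intro mult_strict_left_mono) auto
    then have "(r' - x) / (real n + 2) < r' - x" "0 < (r' - x) / (real n + 2)"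
      using \<open>0 < r' - x\<close> by (auto simp: pos_divide_less_eq)
    then show ?thesis unfolding hi_finite[OF real] unfolding real by simp
  next
    case PInf
    then show ?thesis unfolding hi_infinite[OF PInf] by simp
  qed (use x in \<open>simp add: state_space_def\<close>)
  then show "x < hi n" "ereal (hi n) < r" by auto
qed

lemma interval_subset: "{lo n..hi n} \<subseteq> state_space r"
proof
  fix y assume y: "y \<in> {lo n..hi n}"
  have "ereal y \<le> ereal (hi n)" using y by simp
  also note hi_less
  finally show "y \<in> state_space r" using y lo_pos[of n] by (simp add: state_space_def)
qed

lemma over_n_tendsto: "(\<lambda>n. a / (real n + 2)) \<longlonglongrightarrow> 0"
  using LIMSEQ_ignore_initial_segment[OF lim_const_over_n[of a], of 2] by (simp add: add.commute)

lemma lo_tendsto: "lo \<longlonglongrightarrow> 0"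
  unfolding lo_def[abs_def] by (rule over_n_tendsto)

lemma exhaust:
  assumes a: "0 < a" and b: "ereal b < r"
  shows "\<forall>\<^sub>F n in sequentially. lo n < a \<and> b < hi n"
proof (rule eventually_conj)
  show "\<forall>\<^sub>F n in sequentially. lo n < a" by (rule order_tendstoD(2)[OF lo_tendsto a])
  show "\<forall>\<^sub>F n in sequentially. b < hi n"
  proof (cases "r = \<infinity>")
    case True
    obtain N where "b < real N" using reals_Archimedean2 by blast
    then show ?thesis unfolding eventually_sequentially hi_infinite[OF True] using x_pos
      by (intro exI[of _ N]) auto
  next
    case False
    then obtain r' where r': "r = ereal r'" using x by (cases r) (auto simp: state_space_def)
    have "(\<lambda>n. r' - (r' - x) / (real n + 2)) \<longlonglongrightarrow> r' - 0" by (intro tendsto_intros over_n_tendsto)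
    then have "hi \<longlonglongrightarrow> r'" by (simp add: hi_finite[OF r', abs_def])
    then show ?thesis using b unfolding r' by (intro order_tendstoD(1)) auto
  qed
qed

lemma paths: "AE \<omega> in Q. continuous_on {0..} (\<lambda>t. Y t \<omega>) \<and> Y 0 \<omega> = ereal x"
proof -
  have "AE \<omega> in Q. continuous_on {0..} (\<lambda>t. Y t \<omega>) \<and> (\<forall>t\<ge>0. Y t \<omega> \<in> {0..r}) \<and> Y 0 \<omega> = ereal x \<and>
        (\<forall>t\<ge>0. ereal t < lifetime r Y \<omega> \<longrightarrow> real_of_ereal (Y t \<omega>) = x + W t \<omega> +
             (LBINT s:{0..t}. (deriv h (real_of_ereal (Y s \<omega>)) / h (real_of_ereal (Y s \<omega>)) + c)))"
    using dp by (simp add: drifted_process_def)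
  then show ?thesis by eventually_elim blast
qed

text \<open>The bound \<open>exp (2 * K * T) * \<phi> x\<close> is the same for every interval, so
  Fatou's lemma transfers it to the lower limit of the majorants.\<close>

lemma localized_bound:
  assumes L: "is_lyapunov \<phi> \<phi>' \<phi>'' K \<theta>" and T: "0 < T" and S: "stopping_time F S"
  shows "\<exists>D. (\<forall>n. D n \<in> borel_measurable Q) \<and> (\<integral>\<^sup>+ \<omega>. liminf (\<lambda>n. D n \<omega>) \<partial>Q) \<le> ennreal (exp (2 * K * T) * \<phi> x) \<and>
    (AE \<omega> in Q. \<forall>n. ennreal (\<phi> (real_of_ereal (Y (exit_upto (exit_set n) T S Y \<omega>) \<omega>))) +
      (\<integral>\<^sup>+ s\<in>{0..exit_upto (exit_set n) T S Y \<omega>}. ennreal (\<theta> (real_of_ereal (Y s \<omega>))) \<partial>lborel) \<le> D n \<omega>)"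
proof -
  have "\<forall>n. \<exists>D\<in>borel_measurable Q. (\<integral>\<^sup>+ \<omega>. D \<omega> \<partial>Q) \<le> ennreal (exp (2 * K * T) * \<phi> x) \<and>
    (AE \<omega> in Q. let u = exit_upto (exit_set n) T S Y \<omega> in
      ennreal (\<phi> (real_of_ereal (Y u \<omega>))) + (\<integral>\<^sup>+ s\<in>{0..u}. ennreal (\<theta> (real_of_ereal (Y s \<omega>))) \<partial>lborel) \<le> D \<omega>)"
  proof
    fix n
    have sub: "z \<in> state_space r" if "z \<in> {lo n..hi n}" for z using interval_subset that by blast
    have "\<exists>L. L-lipschitz_on {lo n..hi n} \<phi>''" using L interval_subset[of n] unfolding is_lyapunov_def by blast
    then obtain Lc where Lc: "Lc-lipschitz_on {lo n..hi n} \<phi>''" by blast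
    have c\<theta>: "continuous_on {lo n..hi n} \<theta>"
      using L interval_subset[of n] continuous_on_subset unfolding is_lyapunov_def by blast
    have K: "0 < K" using L unfolding is_lyapunov_def by blast
    have pt: "(\<phi> has_real_derivative \<phi>' y) (at y)" "(\<phi>' has_real_derivative \<phi>'' y) (at y)"
        "0 \<le> \<phi> y" "0 \<le> \<theta> y" "\<phi>'' y / 2 + (deriv h y / h y + c) * \<phi>' y \<le> K * \<phi> y - \<theta> y" if "y \<in> {lo n..hi n}" for y
      using L sub[OF that] unfolding is_lyapunov_def by blast+
    show "\<exists>D\<in>borel_measurable Q. (\<integral>\<^sup>+ \<omega>. D \<omega> \<partial>Q) \<le> ennreal (exp (2 * K * T) * \<phi> x) \<and>
      (AE \<omega> in Q. let u = exit_upto (exit_set n) T S Y \<omega> in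
        ennreal (\<phi> (real_of_ereal (Y u \<omega>))) + (\<integral>\<^sup>+ s\<in>{0..u}. ennreal (\<theta> (real_of_ereal (Y s \<omega>))) \<partial>lborel) \<le> D \<omega>)"
      by (rule drifted_process_lyapunov[OF fps bm dp lo_pos lo_less hi_greater hi_less T S
            continuous_on_subset[OF drift_cont interval_subset] pt(1,2) Lc pt(3) c\<theta> pt(4) K pt(5)])
  qed
  from choice[OF this[unfolded Bex_def]] obtain D where D: "\<forall>n. D n \<in> borel_measurable Q \<and>
    (\<integral>\<^sup>+ \<omega>. D n \<omega> \<partial>Q) \<le> ennreal (exp (2 * K * T) * \<phi> x) \<and>
    (AE \<omega> in Q. let u = exit_upto (exit_set n) T S Y \<omega> in
      ennreal (\<phi> (real_of_ereal (Y u \<omega>))) + (\<integral>\<^sup>+ s\<in>{0..u}. ennreal (\<theta> (real_of_ereal (Y s \<omega>))) \<partial>lborel) \<le> D n \<omega>)"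
    by (rule exE)
  note D1 = D[rule_format, THEN conjunct1]
    and D2 = D[rule_format, THEN conjunct2, THEN conjunct1]
    and D3 = D[rule_format, THEN conjunct2, THEN conjunct2, unfolded Let_def]
  have "(\<integral>\<^sup>+ \<omega>. liminf (\<lambda>n. D n \<omega>) \<partial>Q) \<le> liminf (\<lambda>n. \<integral>\<^sup>+ \<omega>. D n \<omega> \<partial>Q)"
    by (rule nn_integral_liminf[OF D1])
  also have "\<dots> \<le> limsup (\<lambda>n. \<integral>\<^sup>+ \<omega>. D n \<omega> \<partial>Q)" by (rule Liminf_le_Limsup) simp
  also have "\<dots> \<le> ennreal (exp (2 * K * T) * \<phi> x)" by (rule Limsup_bounded) (use D2 in auto)
  finally show ?thesis
    unfolding AE_all_countable by (intro exI[of _ D] conjI allI D1 D3)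
qed

text \<open>On a path with lifetime at most \<open>T\<close>, every interval is left before
  \<open>T\<close> and through an end point, where \<open>\<Phi>\<close> is at least
  \<open>\<beta> * n\<close>. Then the majorants tend to infinity, while their lower limit is
  integrable and so almost surely finite.\<close>

lemma lifetime_infinite: "AE \<omega> in Q. lifetime r Y \<omega> = \<infinity>"
proof -
  obtain \<Phi> \<Phi>' \<Phi>'' K \<alpha> where L: "is_lyapunov \<Phi> \<Phi>' \<Phi>'' K (\<lambda>_. 0)" and \<alpha>: "0 < \<alpha>"
    and low: "\<And>y. y \<in> state_space r \<Longrightarrow> \<alpha> / y \<le> \<Phi> y"
      "\<And>y. y \<in> state_space r \<Longrightarrow> r \<noteq> \<infinity> \<Longrightarrow> \<alpha> / (1 - inv_endpoint r * y) \<le> \<Phi> y"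
      "\<And>y. y \<in> state_space r \<Longrightarrow> r = \<infinity> \<Longrightarrow> y\<^sup>2 \<le> \<Phi> y"
    using is_lyapunov_proper by blast
  \<comment> \<open>The smallest of the three linear growth rates: at an infinite right end, at
    \<open>lo n\<close>, and at a finite right end.\<close>
  define \<beta> where "\<beta> = min 1 (min (\<alpha> / x) (\<alpha> / (1 - inv_endpoint r * x)))"
  have \<beta>: "0 < \<beta>" using \<alpha> state_spaceD[OF x] by (simp add: \<beta>_def)
  have lohi: "lo n \<in> state_space r" "hi n \<in> state_space r" for n
    using interval_subset[of n] lo_less[of n] hi_greater[of n] by auto
  have \<Phi>lo: "\<beta> * real n \<le> \<Phi> (lo n)" for n
  proof -
    have "\<beta> * real n \<le> \<alpha> / x * (real n + 2)" using \<beta> by (intro mult_mono) (auto simp: \<beta>_def)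
    also have "\<dots> = \<alpha> / lo n" by (simp add: lo_def)
    also have "\<dots> \<le> \<Phi> (lo n)" by (rule low(1)[OF lohi(1)])
    finally show ?thesis .
  qed
  have \<Phi>hi: "\<beta> * real n \<le> \<Phi> (hi n)" for n
  proof (cases "r = \<infinity>")
    case True
    have "\<beta> * real n \<le> 1 * real n" by (intro mult_right_mono) (auto simp: \<beta>_def)
    also have "\<dots> \<le> hi n * 1" unfolding hi_infinite[OF True] using x_pos by simp
    also have "\<dots> \<le> hi n * hi n" unfolding hi_infinite[OF True] using x_pos by (intro mult_left_mono) auto
    also have "\<dots> \<le> \<Phi> (hi n)" using low(3)[OF lohi(2) True] by (simp add: power2_eq_square)
    finally show ?thesis .
  next
    case False
    then obtain r' where r': "r = ereal r'" using x by (cases r) (auto simp: state_space_def)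
    have r'0: "0 < r'" using r_pos by (simp add: r')
    have e: "1 - inv_endpoint r * hi n = (1 - inv_endpoint r * x) / (real n + 2)"
    proof -
      have "1 - inv_endpoint r * hi n = (r' - x) / (real n + 2) / r'" "1 - inv_endpoint r * x = (r' - x) / r'"
        unfolding hi_finite[OF r'] using r'0 by (simp_all add: r' inv_endpoint_def diff_divide_distrib)
      then show ?thesis by (simp only: divide_divide_eq_left mult.commute)
    qed
    have "\<beta> * real n \<le> \<alpha> / (1 - inv_endpoint r * x) * (real n + 2)"
      using \<beta> \<alpha> state_spaceD[OF x] by (intro mult_mono) (auto simp: \<beta>_def)
    also have "\<dots> = \<alpha> / (1 - inv_endpoint r * hi n)" by (simp add: e)
    also have "\<dots> \<le> \<Phi> (hi n)" by (rule low(2)[OF lohi(2) False])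
    finally show ?thesis .
  qed
  have "AE \<omega> in Q. ereal (real (Suc N)) < lifetime r Y \<omega>" for N
  proof -
    define T where "T = real (Suc N)"
    have T: "0 < T" by (simp add: T_def)
    obtain D where Dm: "\<And>n. D n \<in> borel_measurable Q"
      and Di: "(\<integral>\<^sup>+ \<omega>. liminf (\<lambda>n. D n \<omega>) \<partial>Q) \<le> ennreal (exp (2 * K * T) * \<Phi> x)"
      and Dae: "AE \<omega> in Q. \<forall>n. ennreal (\<Phi> (real_of_ereal (Y (exit_upto (exit_set n) T (\<lambda>_. top) Y \<omega>) \<omega>))) +
        (\<integral>\<^sup>+ s\<in>{0..exit_upto (exit_set n) T (\<lambda>_. top) Y \<omega>}. ennreal 0 \<partial>lborel) \<le> D n \<omega>"
      using localized_bound[OF L T stopping_time_const[of F top]] by blast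
    have "(\<integral>\<^sup>+ \<omega>. liminf (\<lambda>n. D n \<omega>) \<partial>Q) \<noteq> \<infinity>" using Di by (auto simp: top_unique)
    then have fin: "AE \<omega> in Q. liminf (\<lambda>n. D n \<omega>) \<noteq> \<infinity>"
      using Dm by (intro nn_integral_PInf_AE) (auto intro: borel_measurable_liminf)
    show ?thesis using fin Dae paths
    proof eventually_elim
      case (elim \<omega>)
      then have cont: "continuous_on {0..} (\<lambda>t. Y t \<omega>)" and Y0: "Y 0 \<omega> = ereal x" by auto
      show "ereal (real (Suc N)) < lifetime r Y \<omega>"
      proof (rule ccontr)
        assume "\<not> ereal (real (Suc N)) < lifetime r Y \<omega>"
        then have lt: "lifetime r Y \<omega> \<le> ereal T" by (simp add: T_def)
        have Dn: "ennreal (\<beta> * real n) \<le> D n \<omega>" for n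
        proof -
          let ?A = "exit_set n"
          define u where "u = exit_upto ?A T (\<lambda>_. top) Y \<omega>"
          have "?A \<subseteq> {0<..<r}"
          proof
            fix z assume z: "z \<in> ?A"
            have "0 < ereal (lo n)" using lo_pos by simp
            then show "z \<in> {0<..<r}" using z hi_less[of n] less_trans[of 0 "ereal (lo n)" z] less_trans[of z "ereal (hi n)" r] by simp
          qed
          then have "exit_time ?A Y \<omega> \<le> lifetime r Y \<omega>"
            unfolding lifetime_def exit_time_def by (intro INF_superset_mono) auto
          with lt have \<tau>T: "exit_time ?A Y \<omega> \<le> ereal T" by (rule order_trans[rotated])
          have u: "ereal u = exit_time ?A Y \<omega>"
            unfolding u_def using T \<tau>T by (subst ereal_exit_upto) (auto simp: min_absorb2)
          have u0: "0 \<le> u" unfolding u_def using exit_upto_range[of T ?A "\<lambda>_. top" Y \<omega>] T by simp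
          have xin: "Y 0 \<omega> \<in> {ereal (lo n)..ereal (hi n)}" using Y0 lo_less[of n] hi_greater[of n] by simp
          have opn: "open ?A" by simp
          have "Y u \<omega> \<in> {ereal (lo n)..ereal (hi n)}"
            by (rule exit_time_closed[where Y=Y and t=u and A="?A" and \<omega>=\<omega>, OF cont _ _ xin opn u0]) (auto simp: u)
          moreover have "Y u \<omega> \<notin> ?A"
          proof
            assume in_A: "Y u \<omega> \<in> ?A"
            have "\<forall>s\<in>{0..u}. Y s \<omega> \<in> ?A"
            proof
              fix s assume s: "s \<in> {0..u}"
              show "Y s \<omega> \<in> ?A"
              proof (cases "s = u")
                case False
                then have "ereal s < exit_time ?A Y \<omega>" using s by (simp add: u[symmetric])
                then show ?thesis using exit_time_gt_iff[of Y \<omega> ?A s, OF cont opn] s by auto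
              qed (use in_A in simp)
            qed
            then have "ereal u < exit_time ?A Y \<omega>" using exit_time_gt_iff[of Y \<omega> ?A u, OF cont opn u0] by blast
            then show False by (simp add: u)
          qed
          ultimately have "Y u \<omega> = ereal (lo n) \<or> Y u \<omega> = ereal (hi n)" by auto
          then have "\<beta> * real n \<le> \<Phi> (real_of_ereal (Y u \<omega>))" using \<Phi>lo \<Phi>hi by auto
          then have "ennreal (\<beta> * real n) \<le> ennreal (\<Phi> (real_of_ereal (Y u \<omega>)))" by (rule ennreal_leI)
          also have "\<dots> \<le> D n \<omega>" using elim(2)[rule_format, of n] unfolding u_def by simp
          finally show ?thesis .
        qed
        have "ennreal (\<beta> * real j) \<le> liminf (\<lambda>n. D n \<omega>)" for j
        proof (rule Liminf_bounded)
          show "\<forall>\<^sub>F n in sequentially. ennreal (\<beta> * real j) \<le> D n \<omega>"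
            unfolding eventually_sequentially
          proof (intro exI allI impI)
            fix n assume "j \<le> n"
            then have "ennreal (\<beta> * real j) \<le> ennreal (\<beta> * real n)" using \<beta> by (intro ennreal_leI mult_left_mono) auto
            then show "ennreal (\<beta> * real j) \<le> D n \<omega>" using Dn[of n] by (rule order_trans)
          qed
        qed
        moreover obtain v where v: "0 \<le> v" "liminf (\<lambda>n. D n \<omega>) = ennreal v" using elim(1) by (cases "liminf (\<lambda>n. D n \<omega>)") auto
        ultimately have *: "\<beta> * real j \<le> v" for j by (simp add: ennreal_le_iff)
        obtain j where "v / \<beta> < real j" using reals_Archimedean2 by blast
        then show False using *[of j] \<beta> by (simp add: pos_divide_less_eq mult.commute)
      qed
    qed
  qed
  then have "AE \<omega> in Q. \<forall>N. ereal (real (Suc N)) < lifetime r Y \<omega>" by (simp add: AE_all_countable)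
  then show ?thesis
  proof eventually_elim
    case (elim \<omega>)
    show ?case
    proof (rule ccontr)
      assume "lifetime r Y \<omega> \<noteq> \<infinity>"
      moreover have "0 \<le> lifetime r Y \<omega>" unfolding lifetime_def by (rule exit_time_nonneg)
      ultimately obtain v where v: "lifetime r Y \<omega> = ereal v" by (cases "lifetime r Y \<omega>") auto
      obtain N where "v < real N" using reals_Archimedean2 by blast
      then show False using elim[rule_format, of N] by (simp add: v)
    qed
  qed
qed

text \<open>With infinite lifetime a path on \<open>[0,T]\<close> attains its extrema inside
  \<open>(0,r)\<close>, so all but finitely many intervals contain it. For each such path the
  localisation is eventually void.\<close>

lemma paths_inside: "AE \<omega> in Q. \<forall>T\<ge>0. (\<forall>s\<in>{0..T}. real_of_ereal (Y s \<omega>) \<in> state_space r) \<and>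
    (\<forall>\<^sub>F n in sequentially. ereal T < exit_time (exit_set n) Y \<omega>)"
  using lifetime_infinite paths
proof eventually_elim
  case (elim \<omega>)
  show ?case
  proof (intro allI impI)
    fix T :: real assume T: "0 \<le> T"
    have cont: "continuous_on {0..} (\<lambda>t. Y t \<omega>)" using elim by simp
    have "ereal T < exit_time {0<..<r} Y \<omega>" using elim by (simp add: lifetime_def)
    then have inside: "\<forall>s\<in>{0..T}. Y s \<omega> \<in> {0<..<r}" using exit_time_gt_iff[of Y \<omega> "{0<..<r}" T, OF cont _ T] by simp
    have c: "continuous_on {0..T} (\<lambda>t. Y t \<omega>)" using cont by (rule continuous_on_subset) auto
    obtain s1 where s1: "s1 \<in> {0..T}" "\<And>s. s \<in> {0..T} \<Longrightarrow> Y s \<omega> \<le> Y s1 \<omega>"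
      using continuous_attains_sup[OF _ _ c] T by (auto simp: ball_simps)
    obtain s2 where s2: "s2 \<in> {0..T}" "\<And>s. s \<in> {0..T} \<Longrightarrow> Y s2 \<omega> \<le> Y s \<omega>"
      using continuous_attains_inf[OF _ _ c] T by (auto simp: ball_simps)
    obtain v where v: "Y s1 \<omega> = ereal v" "ereal v < r" using inside s1(1) by (cases "Y s1 \<omega>") fastforce+
    obtain w where w: "Y s2 \<omega> = ereal w" "0 < w" using inside s2(1) s2(2)[OF s1(1)] v by (cases "Y s2 \<omega>") fastforce+
    have "\<forall>\<^sub>F n in sequentially. ereal T < exit_time (exit_set n) Y \<omega>"
      using exhaust[OF w(2) v(2)]
    proof eventually_elim
      case (elim n)
      have "Y s \<omega> \<in> exit_set n" if "s \<in> {0..T}" for s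
      proof -
        have "ereal (lo n) < ereal w" "ereal v < ereal (hi n)" using elim by auto
        then show ?thesis using s1(2)[OF that] s2(2)[OF that] v(1) w(1)
            less_le_trans[of "ereal (lo n)" "ereal w" "Y s \<omega>"] le_less_trans[of "Y s \<omega>" "ereal v" "ereal (hi n)"] by simp
      qed
      then show ?case using exit_time_gt_iff[of Y \<omega> "exit_set n" T, OF cont _ T] by simp
    qed
    moreover have "real_of_ereal (Y s \<omega>) \<in> state_space r" if "s \<in> {0..T}" for s
    proof -
      have "0 < Y s \<omega>" "Y s \<omega> < r" using inside that by auto
      then show ?thesis by (cases "Y s \<omega>") (auto simp: state_space_def)
    qed
    ultimately show "(\<forall>s\<in>{0..T}. real_of_ereal (Y s \<omega>) \<in> state_space r) \<and>
      (\<forall>\<^sub>F n in sequentially. ereal T < exit_time (exit_set n) Y \<omega>)" by blast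
  qed
qed

text \<open>For almost every path the localised quantity equals the unlocalised one for large
  \<open>n\<close>, so \<open>f\<close> lies below the lower limit of the measurable majorants.
  Monotonicity of the upper integral then needs no measurability of \<open>f\<close>.\<close>

lemma global_bound:
  assumes L: "is_lyapunov \<phi> \<phi>' \<phi>'' K \<theta>" and T: "0 < T" and S: "stopping_time F S"
    and f: "AE \<omega> in Q. f \<omega> \<le> (let u = real_of_ereal (min (ereal T) (enn2ereal (S \<omega>))) in
      ennreal (\<phi> (real_of_ereal (Y u \<omega>))) + (\<integral>\<^sup>+ s\<in>{0..u}. ennreal (\<theta> (real_of_ereal (Y s \<omega>))) \<partial>lborel))"
  shows "(\<integral>\<^sup>+ \<omega>. f \<omega> \<partial>Q) \<le> ennreal (exp (2 * K * T) * \<phi> x)"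
proof -
  obtain D where Dm: "\<And>n. D n \<in> borel_measurable Q"
    and Di: "(\<integral>\<^sup>+ \<omega>. liminf (\<lambda>n. D n \<omega>) \<partial>Q) \<le> ennreal (exp (2 * K * T) * \<phi> x)"
    and Dae: "AE \<omega> in Q. \<forall>n. ennreal (\<phi> (real_of_ereal (Y (exit_upto (exit_set n) T S Y \<omega>) \<omega>))) +
      (\<integral>\<^sup>+ s\<in>{0..exit_upto (exit_set n) T S Y \<omega>}. ennreal (\<theta> (real_of_ereal (Y s \<omega>))) \<partial>lborel) \<le> D n \<omega>"
    using localized_bound[OF L T S] by blast
  have "AE \<omega> in Q. f \<omega> \<le> liminf (\<lambda>n. D n \<omega>)"
    using f Dae paths_inside
  proof eventually_elim
    case (elim \<omega>)
    have "\<forall>\<^sub>F n in sequentially. ereal T < exit_time (exit_set n) Y \<omega>" using elim(3) T by simp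
    then have "\<forall>\<^sub>F n in sequentially. f \<omega> \<le> D n \<omega>"
    proof eventually_elim
      case (elim n)
      have "min (ereal T) (min (enn2ereal (S \<omega>)) (exit_time (exit_set n) Y \<omega>)) = min (ereal T) (enn2ereal (S \<omega>))"
      proof -
        have "min (ereal T) (enn2ereal (S \<omega>)) \<le> exit_time (exit_set n) Y \<omega>"
          using elim by (meson less_imp_le min.coboundedI1)
        then show ?thesis unfolding min.assoc[symmetric] by (rule min_absorb1)
      qed
      then have e: "exit_upto (exit_set n) T S Y \<omega> = real_of_ereal (min (ereal T) (enn2ereal (S \<omega>)))" by (simp only: exit_upto_def)
      show ?case using order_trans[OF \<open>f \<omega> \<le> _\<close>[unfolded Let_def e[symmetric]]] \<open>\<forall>n. _ \<le> D n \<omega>\<close>[rule_format, of n] by blast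
    qed
    then show ?case by (rule Liminf_bounded)
  qed
  then have "(\<integral>\<^sup>+ \<omega>. f \<omega> \<partial>Q) \<le> (\<integral>\<^sup>+ \<omega>. liminf (\<lambda>n. D n \<omega>) \<partial>Q)" by (rule nn_integral_mono_AE)
  then show ?thesis using Di by (rule order_trans)
qed

text \<open>1 / h \<le> k V is used at time \<open>S\<close> and V \<le> k / h at the starting
  point, so \<open>x\<close> enters only through \<open>1 / h x\<close>. The summand 1 in the
  numerator makes the inequality strict.\<close>

lemma reciprocal_bound:
  assumes S: "stopping_time F S" and b: "AE \<omega> in Q. S \<omega> \<le> ennreal T"
  shows "(\<integral>\<^sup>+ \<omega>. ennreal (1 / h (real_of_ereal (Y (enn2real (S \<omega>)) \<omega>))) \<partial>Q)
    < ennreal ((exp (2 * k * max 1 T) * k * k + 1) / h x)"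
proof -
  \<comment> \<open>The local estimate needs a positive horizon, whereas \<open>T\<close> may be
    zero or negative.\<close>
  define T' where "T' = max 1 T"
  have T': "0 < T'" "0 \<le> T'" "T \<le> T'" by (auto simp: T'_def)
  have "(\<integral>\<^sup>+ \<omega>. ennreal (1 / h (real_of_ereal (Y (enn2real (S \<omega>)) \<omega>))) \<partial>Q) \<le> ennreal (exp (2 * k * T') * (k * V x))"
  proof (rule global_bound[OF is_lyapunov_V T'(1) S])
    show "AE \<omega> in Q. ennreal (1 / h (real_of_ereal (Y (enn2real (S \<omega>)) \<omega>))) \<le> (let u = real_of_ereal (min (ereal T') (enn2ereal (S \<omega>))) in
      ennreal (k * V (real_of_ereal (Y u \<omega>))) + (\<integral>\<^sup>+ s\<in>{0..u}. ennreal 0 \<partial>lborel))"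
      using b paths_inside
    proof eventually_elim
      case (elim \<omega>)
      have "S \<omega> \<le> ennreal T'" using elim(1) T'(3) by (meson ennreal_leI order_trans)
      then obtain s where s: "0 \<le> s" "S \<omega> = ennreal s" "s \<le> T'"
        using T'(2) by (cases "S \<omega>") (auto simp: ennreal_le_iff top_unique)
      have u: "real_of_ereal (min (ereal T') (enn2ereal (S \<omega>))) = s"
        using s by (simp add: enn2ereal_ennreal min_absorb2)
      have "real_of_ereal (Y s \<omega>) \<in> state_space r" using elim(2) T'(2) s by auto
      from V_ge[OF this] show ?case unfolding u Let_def using s by (simp add: ennreal_leI)
    qed
  qed
  also have "\<dots> \<le> ennreal (exp (2 * k * T') * (k * (k / h x)))"
    using V_le[OF x] k_pos by (intro ennreal_leI mult_left_mono) auto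
  also have "\<dots> < ennreal ((exp (2 * k * T') * k * k + 1) / h x)"
  proof (rule ennreal_lessI)
    show "0 < (exp (2 * k * T') * k * k + 1) / h x" using h_pos[OF x] k_pos by (simp add: add_pos_pos)
    show "exp (2 * k * T') * (k * (k / h x)) < (exp (2 * k * T') * k * k + 1) / h x"
      using h_pos[OF x] by (simp add: add_divide_distrib mult.assoc)
  qed
  finally show ?thesis unfolding T'_def .
qed

lemma power_bound:
  assumes t: "0 < t" and p: "0 \<le> p" "p < 1"
  shows "(\<integral>\<^sup>+ \<omega>. (\<integral>\<^sup>+ s\<in>{0..t}. ennreal (1 / h (real_of_ereal (Y s \<omega>)) powr (2 + p)) \<partial>lborel) \<partial>Q) < \<infinity>"
proof -
  obtain \<phi> \<phi>' \<phi>'' K where L: "is_lyapunov \<phi> \<phi>' \<phi>'' K (\<lambda>y. 1 / h y powr (2 + p))"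
    using is_lyapunov_powr[OF p] by blast
  have "(\<integral>\<^sup>+ \<omega>. (\<integral>\<^sup>+ s\<in>{0..t}. ennreal (1 / h (real_of_ereal (Y s \<omega>)) powr (2 + p)) \<partial>lborel) \<partial>Q)
      \<le> ennreal (exp (2 * K * t) * \<phi> x)"
  \<comment> \<open>The constant stopping time \<open>top\<close> reduces the minimum to
    \<open>t\<close>. The nonnegative term with \<open>\<phi>\<close> is discarded.\<close>
  proof (rule global_bound[OF L t stopping_time_const[of F top]])
    have "real_of_ereal (min (ereal t) (enn2ereal top)) = t" by simp
    then show "AE \<omega> in Q. (\<integral>\<^sup>+ s\<in>{0..t}. ennreal (1 / h (real_of_ereal (Y s \<omega>)) powr (2 + p)) \<partial>lborel)
      \<le> (let u = real_of_ereal (min (ereal t) (enn2ereal top)) in ennreal (\<phi> (real_of_ereal (Y u \<omega>))) +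
        (\<integral>\<^sup>+ s\<in>{0..u}. ennreal (1 / h (real_of_ereal (Y s \<omega>)) powr (2 + p)) \<partial>lborel))"
      by (intro AE_I2) (simp add: Let_def add_increasing)
  qed
  also have "\<dots> < \<infinity>" by simp
  finally show ?thesis .
qed

end

section \<open>Combination of the two classes of \<open>h\<close> and conclusion\<close>

lemma lyapunov_function_transform:
  assumes "0 < r" "standing_coefficient r \<sigma>" "h \<in> transform_functions r \<sigma>" "r = \<infinity> \<longrightarrow> c \<le> 0"
    "(\<forall>x\<in>state_space r. h x = x) \<longrightarrow> c = 0"
  shows "\<exists>V V' V'' k. lyapunov_function r h c V V' V'' k"
proof (cases "h \<in> H0 r \<sigma>")
  case True
  then obtain h' G m \<kappa> H where "H0_profile r h h' G m \<kappa> H" using H0_profile_exists[OF assms(1,2)] by blast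
  then show ?thesis using H0_profile.lyapunov_function_exists[OF _ assms(4)] by blast
next
  case False
  then have r: "r = \<infinity>" and h: "\<And>x. x \<in> state_space r \<Longrightarrow> h x = x"
    using assms(3) by (auto simp: transform_functions_def split: if_splits)
  then have "c = 0" using assms(5) by blast
  then show ?thesis using lyapunov_function_identity[OF r h] by blast
qed

theorem theorem2p3:
  fixes r :: ereal and \<sigma> h :: "real \<Rightarrow> real" and c :: real
    and \<Omega> :: "'a set" and X :: "real \<Rightarrow> 'a \<Rightarrow> ereal"
    and P Q :: "real \<Rightarrow> 'a measure" and FP F :: "real \<Rightarrow> ennreal \<Rightarrow> 'a measure"
    and W :: "real \<Rightarrow> real \<Rightarrow> 'a \<Rightarrow> real" and Y :: "real \<Rightarrow> real \<Rightarrow> 'a \<Rightarrow> ereal"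
  assumes "0 < r"
    and "standing_coefficient r \<sigma>"
    and "standing_diffusion r \<sigma> \<Omega> X P FP"
    and "h \<in> transform_functions r \<sigma>"
    and "\<forall>x\<in>state_space r. space (Q x) = \<Omega> \<and> transform_law r \<sigma> h x X (Q x) (F x)"
    and "\<forall>x\<in>state_space r. brownian_motion (Q x) (F x) (W x)"
    and "\<forall>x\<in>state_space r. drifted_process (Q x) (F x) r h c x (W x) (Y x)"
    and "r = \<infinity> \<longrightarrow> c \<le> 0"
    and "(\<forall>x\<in>state_space r. h x = x) \<longrightarrow> c = 0"
  shows "(\<forall>x\<in>state_space r. AE \<omega> in Q x. lifetime r (Y x) \<omega> = \<infinity>) \<and>
    (\<forall>(S :: 'a \<Rightarrow> ennreal) (T :: real). \<exists>K::real. \<forall>x\<in>state_space r.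
        stopping_time (F x) S \<longrightarrow> (AE \<omega> in Q x. S \<omega> \<le> ennreal T) \<longrightarrow>
        (\<integral>\<^sup>+ \<omega>. ennreal (1 / h (real_of_ereal (Y x (enn2real (S \<omega>)) \<omega>))) \<partial>Q x) < ennreal (K / h x)) \<and>
    (\<forall>x\<in>state_space r. \<forall>t>0. \<forall>p\<in>{0..<1}.
        (\<integral>\<^sup>+ \<omega>. (\<integral>\<^sup>+ s\<in>{0..t}.
            ennreal (1 / h (real_of_ereal (Y x s \<omega>)) powr (2 + p)) \<partial>lborel) \<partial>Q x) < \<infinity>)"
proof -
  obtain V V' V'' k where V: "lyapunov_function r h c V V' V'' k"
    using lyapunov_function_transform[OF assms(1,2,4,8,9)] by blast
  have D: "drifted_lyapunov r h c V V' V'' k (Q x) (F x) (W x) (Y x) x" if "x \<in> state_space r" for x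
    using V that assms(5-7) by (simp add: drifted_lyapunov_def drifted_lyapunov_axioms_def transform_law_def)
  show ?thesis
  proof (intro conjI allI ballI impI)
    show "AE \<omega> in Q x. lifetime r (Y x) \<omega> = \<infinity>" if "x \<in> state_space r" for x
      by (rule drifted_lyapunov.lifetime_infinite[OF D[OF that]])
    show "\<exists>K::real. \<forall>x\<in>state_space r. stopping_time (F x) S \<longrightarrow> (AE \<omega> in Q x. S \<omega> \<le> ennreal T) \<longrightarrow>
        (\<integral>\<^sup>+ \<omega>. ennreal (1 / h (real_of_ereal (Y x (enn2real (S \<omega>)) \<omega>))) \<partial>Q x) < ennreal (K / h x)" for S T
    \<comment> \<open>\<open>k\<close> was obtained from \<open>r\<close>, \<open>h\<close> and
      \<open>c\<close> before any starting point is fixed, so the constant is uniform in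
      \<open>x\<close>.\<close>
    proof (rule exI[of _ "exp (2 * k * max 1 T) * k * k + 1"], intro ballI impI)
      fix x assume x: "x \<in> state_space r" and S: "stopping_time (F x) S" and T: "AE \<omega> in Q x. S \<omega> \<le> ennreal T"
      show "(\<integral>\<^sup>+ \<omega>. ennreal (1 / h (real_of_ereal (Y x (enn2real (S \<omega>)) \<omega>))) \<partial>Q x)
          < ennreal ((exp (2 * k * max 1 T) * k * k + 1) / h x)"
        by (rule drifted_lyapunov.reciprocal_bound[OF D[OF x] S T])
    qed
    show "(\<integral>\<^sup>+ \<omega>. (\<integral>\<^sup>+ s\<in>{0..t}. ennreal (1 / h (real_of_ereal (Y x s \<omega>)) powr (2 + p)) \<partial>lborel) \<partial>Q x) < \<infinity>"
      if "x \<in> state_space r" "0 < t" "p \<in> {0..<1}" for x t p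
      using drifted_lyapunov.power_bound[OF D[OF that(1)] that(2), of p] that(3) by simp
  qed
qed

end
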